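(* Let $\Sigma$ be a compact connected oriented surface. The set $\mathcal{G}(\Sigma)=\bigsqcup_{n\ge0}\mathcal{G}_n(\Sigma)$ is an open dense subset of the space $\Pi(\Sigma)$ of all Poisson structures on $\Sigma$ endowed with the Whitney $C^\infty$ topology.
   Context: On a surface every smooth bivector field is a Poisson structure, so $\Pi(\Sigma)$ is the vector space of smooth bivector fields on $\Sigma$. Fix a nowhere vanishing bivector field $\pi_0$ on $\Sigma$ (e.g. the Poisson bivector of a symplectic form); then $\Pi(\Sigma)=C^\infty(\Sigma)\cdot\pi_0$. For $n\ge0$, $\mathcal{G}_n(\Sigma)$ is the set of $\pi=f\pi_0$ whose zero set consists of $n$ pairwise disjoint smooth simple closed curves on each of which $\pi$ vanishes linearly, i.e. $df\ne0$ at every point of the zero set. *)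

theory Defs
  imports "HOL-Analysis.Analysis"
begin

section \<open>Smooth maps between open sets\<close>

text \<open>Iterated directional derivatives along a list of vectors; along basis vectors these are
  the iterated partial derivatives.\<close>

primrec dirderivs :: "'a list \<Rightarrow> ('a::real_normed_vector \<Rightarrow> 'b::real_normed_vector) \<Rightarrow> 'a \<Rightarrow> 'b" where
  "dirderivs [] f = f"
| "dirderivs (v # vs) f = (\<lambda>x. frechet_derivative (dirderivs vs f) (at x) v)"

text \<open>Only meant for open \<open>S\<close>.\<close>

definition smooth_on :: "'a::real_normed_vector set \<Rightarrow> ('a \<Rightarrow> 'b::real_normed_vector) \<Rightarrow> bool" where
  "smooth_on S f \<longleftrightarrow> (\<forall>vs. \<forall>x\<in>S. dirderivs vs f differentiable (at x))"


section \<open>Oriented surfaces\<close>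

text \<open>A chart \<open>(U, \<phi>)\<close> consists of its domain and its coordinate map; the values of \<open>\<phi>\<close> outside
  \<open>U\<close> are irrelevant. The carrier \<open>M\<close> of a surface is a subset of a Hausdorff space, with the
  subspace topology.\<close>

type_synonym 'a chart = "'a set \<times> ('a \<Rightarrow> real^2)"

definition chart_on :: "'a::t2_space set \<Rightarrow> 'a chart \<Rightarrow> bool" where
  "chart_on M c \<longleftrightarrow> openin (top_of_set M) (fst c) \<and> open (snd c ` fst c) \<and>
     (\<exists>\<psi>. homeomorphism (fst c) (snd c ` fst c) (snd c) \<psi>)"

definition chart_inv :: "'a chart \<Rightarrow> real^2 \<Rightarrow> 'a" where
  "chart_inv c = inv_into (fst c) (snd c)"

definition transition :: "'a chart \<Rightarrow> 'a chart \<Rightarrow> real^2 \<Rightarrow> real^2" where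
  "transition c d = snd d \<circ> chart_inv c"

definition smooth_atlas :: "'a::t2_space set \<Rightarrow> 'a chart set \<Rightarrow> bool" where
  "smooth_atlas M A \<longleftrightarrow> (\<forall>c\<in>A. chart_on M c) \<and> (\<Union>c\<in>A. fst c) = M \<and>
     (\<forall>c\<in>A. \<forall>d\<in>A. smooth_on (snd c ` (fst c \<inter> fst d)) (transition c d))"

definition oriented_atlas :: "'a::t2_space set \<Rightarrow> 'a chart set \<Rightarrow> bool" where
  "oriented_atlas M A \<longleftrightarrow> smooth_atlas M A \<and>
     (\<forall>c\<in>A. \<forall>d\<in>A. \<forall>p\<in>fst c \<inter> fst d. det (jacobian (transition c d) (at (snd c p))) > 0)"

text \<open>The atlas need not be maximal. Second countability follows from compactness.\<close>

definition compact_connected_oriented_surface :: "'a::t2_space set \<Rightarrow> 'a chart set \<Rightarrow> bool" where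
  "compact_connected_oriented_surface M A \<longleftrightarrow>
     oriented_atlas M A \<and> compact M \<and> connected M \<and> M \<noteq> {}"

definition smooth_function :: "'a chart set \<Rightarrow> ('a \<Rightarrow> real) \<Rightarrow> bool" where
  "smooth_function A f \<longleftrightarrow> (\<forall>c\<in>A. smooth_on (snd c ` fst c) (f \<circ> chart_inv c))"

definition differential_nonzero_at :: "'a chart set \<Rightarrow> ('a \<Rightarrow> real) \<Rightarrow> 'a \<Rightarrow> bool" where
  "differential_nonzero_at A f p \<longleftrightarrow>
     (\<forall>c\<in>A. p \<in> fst c \<longrightarrow> frechet_derivative (f \<circ> chart_inv c) (at (snd c p)) \<noteq> (\<lambda>_. 0))"

text \<open>A smooth simple closed curve is the image of a smooth embedding of the circle
  \<open>\<real> / \<int>\<close>, given by a 1-periodic immersion that is injective on \<open>[0, 1)\<close>.\<close>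

definition smooth_simple_closed_curve :: "'a::t2_space set \<Rightarrow> 'a chart set \<Rightarrow> 'a set \<Rightarrow> bool" where
  "smooth_simple_closed_curve M A C \<longleftrightarrow>
     (\<exists>\<gamma>::real \<Rightarrow> 'a. range \<gamma> = C \<and> C \<subseteq> M \<and> continuous_on UNIV \<gamma> \<and>
        (\<forall>t. \<gamma> (t + 1) = \<gamma> t) \<and> inj_on \<gamma> {0..<1} \<and>
        (\<forall>c\<in>A. smooth_on (\<gamma> -` fst c) (snd c \<circ> \<gamma>)) \<and>
        (\<forall>t. \<forall>c\<in>A. \<gamma> t \<in> fst c \<longrightarrow> vector_derivative (snd c \<circ> \<gamma>) (at t) \<noteq> 0))"


section \<open>Bivector fields and Poisson structures\<close>

text \<open>A bivector field is a skew-symmetric contravariant 2-tensor field, given by its component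
  matrices \<open>\<pi> c p $ i $ j\<close> at the point \<open>p\<close> in the chart \<open>c\<close>. The matrices are required to vanish
  where they have no meaning, so that equality of fields is equality of functions.\<close>

type_synonym 'a bivector = "'a chart \<Rightarrow> 'a \<Rightarrow> real^2^2"

definition bivector_fields :: "'a chart set \<Rightarrow> 'a bivector set" where
  "bivector_fields A = {\<pi>.
     (\<forall>c\<in>A. smooth_on (snd c ` fst c) (\<pi> c \<circ> chart_inv c)) \<and>
     (\<forall>c\<in>A. \<forall>p\<in>fst c. transpose (\<pi> c p) = - \<pi> c p) \<and>
     (\<forall>c\<in>A. \<forall>d\<in>A. \<forall>p\<in>fst c \<inter> fst d.
        \<pi> d p = jacobian (transition c d) (at (snd c p)) ** \<pi> c p
                 ** transpose (jacobian (transition c d) (at (snd c p)))) \<and>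
     (\<forall>c p. \<not> (c \<in> A \<and> p \<in> fst c) \<longrightarrow> \<pi> c p = 0)}"

definition nowhere_vanishing :: "'a chart set \<Rightarrow> 'a bivector \<Rightarrow> bool" where
  "nowhere_vanishing A \<pi> \<longleftrightarrow> (\<forall>c\<in>A. \<forall>p\<in>fst c. \<pi> c p \<noteq> 0)"

definition zero_set :: "'a chart set \<Rightarrow> 'a bivector \<Rightarrow> 'a set" where
  "zero_set A \<pi> = {p. \<exists>c\<in>A. p \<in> fst c \<and> \<pi> c p = 0}"

definition scale_bivector :: "('a \<Rightarrow> real) \<Rightarrow> 'a bivector \<Rightarrow> 'a bivector" where
  "scale_bivector f \<pi> = (\<lambda>c p. f p *\<^sub>R \<pi> c p)"

text \<open>The Jacobi identity for the bracket \<open>{g, h} = \<Sum> i j. \<pi>\<^sup>i\<^sup>j \<partial>\<^sub>i g \<partial>\<^sub>j h\<close>, evaluated on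
  the coordinate functions of each chart, i.e. the vanishing of the Schouten bracket \<open>[\<pi>, \<pi>]\<close>.\<close>

definition jacobi_identity :: "'a chart set \<Rightarrow> 'a bivector \<Rightarrow> bool" where
  "jacobi_identity A \<pi> \<longleftrightarrow>
     (\<forall>c\<in>A. \<forall>p\<in>fst c.
        let P = (\<lambda>i j. \<pi> c p $ i $ j);
            D = (\<lambda>l i j. frechet_derivative (\<pi> c \<circ> chart_inv c) (at (snd c p)) (axis l 1) $ i $ j)
        in \<forall>i j k. (\<Sum>l\<in>UNIV. P i l * D l j k + P j l * D l k i + P k l * D l i j) = 0)"

definition poisson_structures :: "'a chart set \<Rightarrow> 'a bivector set" where
  "poisson_structures A = {\<pi> \<in> bivector_fields A. jacobi_identity A \<pi>}"

text \<open>In dimension 2 the Jacobi identity is automatic.\<close>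

lemma jacobi_sum_dim2:
  fixes P :: "2 \<Rightarrow> 2 \<Rightarrow> real" and D :: "2 \<Rightarrow> 2 \<Rightarrow> 2 \<Rightarrow> real"
  assumes "\<And>i j. P j i = - P i j" "\<And>l i j. D l j i = - D l i j"
  shows "(\<Sum>l\<in>UNIV. P i l * D l j k + P j l * D l k i + P k l * D l i j) = 0"
proof -
  have z: "P i i = 0" "D l i i = 0" for i l using assms(1)[of i i] assms(2)[of l i i] by auto
  show ?thesis
    using exhaust_2[of i] exhaust_2[of j] exhaust_2[of k] assms(1)[of 1 2] assms(2)[of _ 1 2] z
    by (auto simp: sum_2)
qed

lemma frechet_derivative_skew:
  fixes F :: "real^2 \<Rightarrow> real^2^2"
  assumes "open S" "x \<in> S" "F differentiable (at x)" and sk: "\<And>y. y\<in>S \<Longrightarrow> transpose (F y) = - F y"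
  shows "frechet_derivative F (at x) v $ j $ i = - (frechet_derivative F (at x) v $ i $ j)"
proof -
  let ?D = "frechet_derivative F (at x)"
  have D: "(F has_derivative ?D) (at x)" using assms(3) by (simp add: frechet_derivative_works)
  have c: "((\<lambda>y. F y $ a $ b) has_derivative (\<lambda>v. ?D v $ a $ b)) (at x)" for a b
    by (rule bounded_linear.has_derivative[OF bounded_linear_vec_nth bounded_linear.has_derivative[OF bounded_linear_vec_nth D]])
  have s: "F y $ j $ i = - (F y $ i $ j)" if "y \<in> S" for y
    using sk[OF that] by (metis (mono_tags) transpose_def vec_lambda_beta vector_uminus_component)
  have "((\<lambda>y. F y $ j $ i) has_derivative (\<lambda>v. - (?D v $ i $ j))) (at x)"
    by (rule has_derivative_transform_within_open[OF has_derivative_minus[OF c] assms(1,2)]) (simp add: s)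
  from has_derivative_unique[OF c this] show ?thesis by metis
qed

lemma poisson_structures_eq:
  assumes "smooth_atlas M A"
  shows "poisson_structures A = bivector_fields A"
proof -
  have "jacobi_identity A \<pi>" if \<pi>: "\<pi> \<in> bivector_fields A" for \<pi>
    unfolding jacobi_identity_def Let_def
  proof (intro ballI allI)
    fix c p and i j k :: 2
    assume c: "c \<in> A" and p: "p \<in> fst c"
    have sk: "transpose (\<pi> c q) = - \<pi> c q" if "q \<in> fst c" for q
      using \<pi> c that unfolding bivector_fields_def by blast
    have op: "open (snd c ` fst c)"
      using assms c by (auto simp: smooth_atlas_def chart_on_def)
    have x: "snd c p \<in> snd c ` fst c" using p by simp
    have "smooth_on (snd c ` fst c) (\<pi> c \<circ> chart_inv c)"
      using \<pi> c unfolding bivector_fields_def by blast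
    then have "dirderivs [] (\<pi> c \<circ> chart_inv c) differentiable (at (snd c p))"
      using x unfolding smooth_on_def by blast
    then have df: "(\<pi> c \<circ> chart_inv c) differentiable (at (snd c p))"
      by (simp only: dirderivs.simps)
    have skF: "transpose ((\<pi> c \<circ> chart_inv c) y) = - (\<pi> c \<circ> chart_inv c) y"
      if "y \<in> snd c ` fst c" for y
      unfolding o_def chart_inv_def by (rule sk[OF inv_into_into[OF that]])
    have skP: "\<pi> c p $ b $ a = - (\<pi> c p $ a $ b)" for a b
      using arg_cong[OF sk[OF p], of "\<lambda>X. X $ a $ b"] by (simp add: transpose_def)
    show "(\<Sum>l\<in>UNIV.
        \<pi> c p $ i $ l * frechet_derivative (\<pi> c \<circ> chart_inv c) (at (snd c p)) (axis l 1) $ j $ k +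
        \<pi> c p $ j $ l * frechet_derivative (\<pi> c \<circ> chart_inv c) (at (snd c p)) (axis l 1) $ k $ i +
        \<pi> c p $ k $ l * frechet_derivative (\<pi> c \<circ> chart_inv c) (at (snd c p)) (axis l 1) $ i $ j) = 0"
      by (rule jacobi_sum_dim2[where P = "\<lambda>a b. \<pi> c p $ a $ b" and
            D = "\<lambda>l a b. frechet_derivative (\<pi> c \<circ> chart_inv c) (at (snd c p)) (axis l 1) $ a $ b"])
        (rule skP, rule frechet_derivative_skew[OF op x df skF])
  qed
  then show ?thesis by (auto simp: poisson_structures_def)
qed


section \<open>The Whitney topology\<close>

text \<open>Basic neighbourhoods in the Whitney (strong) \<open>C\<^sup>\<infinity>\<close> topology: a locally finite family of
  compact sets \<open>K i\<close> inside chart domains (possibly empty, so that indexing by \<open>nat\<close> is no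
  restriction), bounds \<open>\<epsilon> i > 0\<close>, and a bound on the partial derivatives up to order \<open>r\<close>.\<close>

definition whitney_data ::
  "'a::t2_space set \<Rightarrow> 'a chart set \<Rightarrow> (nat \<Rightarrow> 'a chart) \<Rightarrow> (nat \<Rightarrow> 'a set) \<Rightarrow> (nat \<Rightarrow> real) \<Rightarrow> bool" where
  "whitney_data M A c K \<epsilon> \<longleftrightarrow>
     (\<forall>i. c i \<in> A \<and> compact (K i) \<and> K i \<subseteq> fst (c i) \<and> \<epsilon> i > 0) \<and>
     (\<forall>p\<in>M. \<exists>W. openin (top_of_set M) W \<and> p \<in> W \<and> finite {i. K i \<inter> W \<noteq> {}})"

definition whitney_nbhd ::
  "'a chart set \<Rightarrow> nat \<Rightarrow> (nat \<Rightarrow> 'a chart) \<Rightarrow> (nat \<Rightarrow> 'a set) \<Rightarrow> (nat \<Rightarrow> real) \<Rightarrow> 'a bivector \<Rightarrow> 'a bivector set" where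
  "whitney_nbhd A r c K \<epsilon> \<pi> = {\<sigma> \<in> poisson_structures A.
     \<forall>i. \<forall>p\<in>K i. \<forall>vs. set vs \<subseteq> Basis \<and> length vs \<le> r \<longrightarrow>
       norm (dirderivs vs ((\<lambda>q. \<sigma> (c i) q - \<pi> (c i) q) \<circ> chart_inv (c i)) (snd (c i) p)) < \<epsilon> i}"

definition whitney_topology :: "'a::t2_space set \<Rightarrow> 'a chart set \<Rightarrow> 'a bivector topology" where
  "whitney_topology M A = topology_generated_by
     {whitney_nbhd A r c K \<epsilon> \<pi> | r c K \<epsilon> \<pi>. whitney_data M A c K \<epsilon> \<and> \<pi> \<in> poisson_structures A}"


section \<open>Poisson structures vanishing linearly on disjoint curves\<close>

definition linear_poisson ::
  "'a::t2_space set \<Rightarrow> 'a chart set \<Rightarrow> 'a bivector \<Rightarrow> nat \<Rightarrow> 'a bivector set" where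
  "linear_poisson M A \<pi>\<^sub>0 n = {\<pi> \<in> poisson_structures A.
     (\<exists>C::nat \<Rightarrow> 'a set. (\<forall>i<n. smooth_simple_closed_curve M A (C i)) \<and>
        disjoint_family_on C {..<n} \<and> zero_set A \<pi> = (\<Union>i<n. C i)) \<and>
     (\<exists>f. smooth_function A f \<and> \<pi> = scale_bivector f \<pi>\<^sub>0 \<and>
        (\<forall>p\<in>zero_set A \<pi>. differential_nonzero_at A f p))}"

end

theory Submission
  imports Defs
begin

text \<open>Dividing by \<open>\<pi>\<^sub>0\<close> turns a Poisson structure into a function \<open>f\<close>, and membership in
  \<open>\<G>(\<Sigma>)\<close> into the condition that \<open>0\<close> is a regular value of \<open>f\<close>. This is a condition on the
  1-jet, hence \<open>C\<^sup>1\<close>-open by compactness. It is dense since \<open>f - t\<close> satisfies it for almost all \<open>t\<close>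
  by Sard's theorem. Conversely, if \<open>0\<close> is a regular value, the Hamiltonian vector field of \<open>f\<close> with
  respect to \<open>\<pi>\<^sub>0\<close> is tangent to the compact set \<open>f = 0\<close> and does not vanish there, so its
  orbits are finitely many embedded circles. They are the connected components of the zero set,
  which therefore determines their number.\<close>

section \<open>Calculus of smooth maps\<close>

text \<open>The zero set is one-dimensional, so in a chart the Hamiltonian equation on it is a
  scalar separable equation, solved by integrating \<open>1 / a\<close>. Elapsed time is then a
  coordinate on the zero set, and two such coordinates differ locally by a constant. The passage to
  circles is therefore purely topological: uniqueness, continuation by a uniform time step,
  recurrence. Smoothness of the circles is recovered afterwards, because every derivative of an
  integral curve is a function of the point it passes through.

  In Sard's theorem a third-order estimate is needed only where all second partial derivatives
  vanish. Elsewhere the critical points lie locally on the zero set of one first partial, which is a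
  Lipschitz graph over a line, and second order is enough.

  Regularity is phrased through derivatives of the bivector itself, so it can be compared with
  Whitney neighbourhoods directly. Density only needs that t \<mapsto> (f - t)
  \<open>\<pi>\<^sub>0\<close> is continuous at 0, which can be tested on the sets generating the
  topology.\<close>

lemma dirderivs_snoc: "dirderivs (vs @ [v]) f = dirderivs vs (\<lambda>x. frechet_derivative f (at x) v)"
  by (induction vs) auto

lemma frechet_derivative_cong_open:
  assumes "open S" "x \<in> S" "\<And>y. y \<in> S \<Longrightarrow> f y = g y"
  shows "frechet_derivative f (at x) = frechet_derivative g (at x)"
proof -
  have "(f has_derivative D) (at x) \<longleftrightarrow> (g has_derivative D) (at x)" for D
    using has_derivative_transform_within_open[OF _ assms(1,2), of f D UNIV g]
      has_derivative_transform_within_open[OF _ assms(1,2), of g D UNIV f] assms(3) by auto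
  then show ?thesis by (simp add: frechet_derivative_def)
qed

lemma differentiable_cong_open:
  assumes "open S" "x \<in> S" "\<And>y. y \<in> S \<Longrightarrow> f y = g y" "f differentiable (at x)"
  shows "g differentiable (at x)"
  using assms has_derivative_transform_within_open[OF _ assms(1,2)] unfolding differentiable_def by blast

lemma dirderivs_cong_open:
  assumes "open S" "\<And>y. y \<in> S \<Longrightarrow> f y = g y" "x \<in> S"
  shows "dirderivs vs f x = dirderivs vs g x"
  using assms(3)
proof (induction vs arbitrary: x)
  case (Cons v vs)
  then show ?case using frechet_derivative_cong_open[OF assms(1) Cons.prems, of "dirderivs vs f" "dirderivs vs g"] by simp
qed (use assms in auto)

lemma smooth_on_cong:
  assumes "open S" "\<And>y. y \<in> S \<Longrightarrow> f y = g y" "smooth_on S f"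
  shows "smooth_on S g"
  unfolding smooth_on_def
proof (intro allI ballI)
  fix vs x assume "x \<in> S"
  then show "dirderivs vs g differentiable (at x)"
    using differentiable_cong_open[OF assms(1), of x "dirderivs vs f" "dirderivs vs g"]
      dirderivs_cong_open[OF assms(1,2)] assms(3) by (auto simp: smooth_on_def)
qed

text \<open>No formula for higher derivatives is needed: on \<open>S\<close> every iterated
  derivative equals some member of the invariant class \<open>P\<close>, and members are
  differentiable. Equality on \<open>S\<close> alone suffices because \<open>S\<close> is open and
  derivatives are local.\<close>

lemma smooth_on_coinduct:
  assumes "open S" "P f"
    and P: "\<And>f. P f \<Longrightarrow> \<exists>D. (\<forall>x\<in>S. (f has_derivative D x) (at x)) \<and> (\<forall>v. P (\<lambda>x. D x v))"
  shows "smooth_on S f"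
proof -
  have "\<exists>g. P g \<and> (\<forall>x\<in>S. dirderivs vs f x = g x)" for vs
  proof (induction vs)
    case Nil
    show ?case using assms(2) by auto
  next
    case (Cons v vs)
    then obtain g where g: "P g" "\<And>x. x\<in>S \<Longrightarrow> dirderivs vs f x = g x" by auto
    obtain D where D: "\<And>x. x \<in> S \<Longrightarrow> (g has_derivative D x) (at x)" "\<And>v. P (\<lambda>x. D x v)"
      using P[OF g(1)] by auto
    have "dirderivs (v # vs) f x = D x v" if "x \<in> S" for x
      using frechet_derivative_cong_open[OF assms(1) that g(2)] frechet_derivative_at[OF D(1)[OF that]]
      by simp
    then show ?case using D(2) by auto
  qed
  note ex = this
  show ?thesis unfolding smooth_on_def
  proof (intro allI ballI)
    fix vs x assume x: "x \<in> S"
    obtain g where g: "P g" "\<And>x. x\<in>S \<Longrightarrow> dirderivs vs f x = g x" using ex by blast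
    have "g differentiable (at x)" using P[OF g(1)] x unfolding differentiable_def by blast
    then show "dirderivs vs f differentiable (at x)"
      using differentiable_cong_open[OF assms(1) x, of g "dirderivs vs f"] g(2) by auto
  qed
qed

lemma smooth_on_has_derivative:
  assumes "smooth_on S f" "x \<in> S"
  shows "(f has_derivative frechet_derivative f (at x)) (at x)"
  using assms unfolding smooth_on_def by (metis dirderivs.simps(1) frechet_derivative_works)

text \<open>The extra direction becomes the innermost derivative, that is, the last entry of the
  list.\<close>

lemma smooth_on_dirderiv: "smooth_on S f \<Longrightarrow> smooth_on S (\<lambda>x. frechet_derivative f (at x) v)"
  unfolding smooth_on_def using dirderivs_snoc by metis

lemma smooth_on_dirderivs: "smooth_on S f \<Longrightarrow> smooth_on S (dirderivs vs f)"
  using smooth_on_dirderiv by (induction vs) auto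

lemma smooth_on_continuous: "smooth_on S f \<Longrightarrow> continuous_on S f"
  by (meson continuous_at_imp_continuous_on has_derivative_continuous smooth_on_has_derivative)

lemma smooth_on_const: "open S \<Longrightarrow> smooth_on S (\<lambda>x. c)"
proof (rule smooth_on_coinduct[where P="\<lambda>f. \<exists>c. f = (\<lambda>x. c)"])
  fix f :: "'a \<Rightarrow> 'b" assume "\<exists>c. f = (\<lambda>x. c)"
  then show "\<exists>D. (\<forall>x\<in>S. (f has_derivative D x) (at x)) \<and> (\<forall>v. \<exists>c. (\<lambda>x. D x v) = (\<lambda>x. c))"
    by (intro exI[of _ "\<lambda>_ _. 0"]) auto
qed auto

lemma smooth_on_id: "open S \<Longrightarrow> smooth_on S (\<lambda>x. x)"
proof (rule smooth_on_coinduct[where P="\<lambda>f. f = (\<lambda>x. x) \<or> (\<exists>c. f = (\<lambda>x. c))"])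
  fix f :: "'a \<Rightarrow> 'a" assume "f = (\<lambda>x. x) \<or> (\<exists>c. f = (\<lambda>x. c))"
  then show "\<exists>D. (\<forall>x\<in>S. (f has_derivative D x) (at x)) \<and> (\<forall>v. (\<lambda>x. D x v) = (\<lambda>x. x) \<or> (\<exists>c. (\<lambda>x. D x v) = (\<lambda>x. c)))"
  proof
    assume "f = (\<lambda>x. x)"
    then show ?thesis by (intro exI[of _ "\<lambda>_ v. v"]) auto
  next
    assume "\<exists>c. f = (\<lambda>x. c)"
    then show ?thesis by (intro exI[of _ "\<lambda>_ _. 0"]) auto
  qed
qed auto

lemma smooth_on_compose_linear:
  assumes "open S" "bounded_linear L" "smooth_on S f"
  shows "smooth_on S (\<lambda>x. L (f x))"
proof (rule smooth_on_coinduct[where P="\<lambda>g. \<exists>f. smooth_on S f \<and> g = (\<lambda>x. L (f x))", OF assms(1)])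
  fix g assume "\<exists>f. smooth_on S f \<and> g = (\<lambda>x. L (f x))"
  then obtain f where f: "smooth_on S f" "g = (\<lambda>x. L (f x))" by auto
  show "\<exists>D. (\<forall>x\<in>S. (g has_derivative D x) (at x)) \<and> (\<forall>v. \<exists>f. smooth_on S f \<and> (\<lambda>x. D x v) = (\<lambda>x. L (f x)))"
    unfolding f(2) using smooth_on_has_derivative[OF f(1)] smooth_on_dirderiv[OF f(1)]
    by (intro exI[where x="\<lambda>x v. L (frechet_derivative f (at x) v)"])
      (auto intro!: bounded_linear.has_derivative[OF assms(2)])
qed (use assms in auto)

lemma smooth_on_add:
  assumes "open S" "smooth_on S f" "smooth_on S g"
  shows "smooth_on S (\<lambda>x. f x + g x)"
proof (rule smooth_on_coinduct[where P="\<lambda>h. \<exists>f g. smooth_on S f \<and> smooth_on S g \<and> h = (\<lambda>x. f x + g x)", OF assms(1)])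
  fix h assume "\<exists>f g. smooth_on S f \<and> smooth_on S g \<and> h = (\<lambda>x. f x + g x)"
  then obtain f g where f: "smooth_on S f" "smooth_on S g" "h = (\<lambda>x. f x + g x)" by auto
  show "\<exists>D. (\<forall>x\<in>S. (h has_derivative D x) (at x)) \<and>
     (\<forall>v. \<exists>f g. smooth_on S f \<and> smooth_on S g \<and> (\<lambda>x. D x v) = (\<lambda>x. f x + g x))"
    unfolding f(3) using f smooth_on_has_derivative smooth_on_dirderiv
    by (intro exI[where x="\<lambda>x v. frechet_derivative f (at x) v + frechet_derivative g (at x) v"] conjI ballI allI
      has_derivative_add) blast+
qed (use assms in auto)

text \<open>The Leibniz rule produces sums of products, so the coinduction runs over the class of
  finite sums of products.\<close>

inductive sum_of_products :: "'a::real_normed_vector set \<Rightarrow> ('a \<Rightarrow> 'b::real_normed_vector) \<Rightarrow> bool" for S where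
  prod: "smooth_on S a \<Longrightarrow> smooth_on S b \<Longrightarrow> sum_of_products S (\<lambda>x. a x *\<^sub>R b x)"
| add: "sum_of_products S f \<Longrightarrow> sum_of_products S g \<Longrightarrow> sum_of_products S (\<lambda>x. f x + g x)"

lemma smooth_on_scaleR:
  assumes "open S" "smooth_on S a" "smooth_on S b"
  shows "smooth_on S (\<lambda>x. a x *\<^sub>R b x)"
proof (rule smooth_on_coinduct[where P="sum_of_products S", OF assms(1) sum_of_products.prod[OF assms(2,3)]])
  fix f :: "'a \<Rightarrow> 'b" assume "sum_of_products S f"
  then show "\<exists>D. (\<forall>x\<in>S. (f has_derivative D x) (at x)) \<and> (\<forall>v. sum_of_products S (\<lambda>x. D x v))"
  proof induction
    case (prod a b)
    have "((\<lambda>x. a x *\<^sub>R b x) has_derivative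
       (\<lambda>h. a x *\<^sub>R frechet_derivative b (at x) h + frechet_derivative a (at x) h *\<^sub>R b x)) (at x)"
      if "x \<in> S" for x
      by (intro has_derivative_scaleR smooth_on_has_derivative[OF _ that] prod)
    moreover have "sum_of_products S (\<lambda>x. a x *\<^sub>R frechet_derivative b (at x) v + frechet_derivative a (at x) v *\<^sub>R b x)" for v
      by (intro sum_of_products.intros prod smooth_on_dirderiv)
    ultimately show ?case by (intro exI[where x="\<lambda>x h. a x *\<^sub>R frechet_derivative b (at x) h + frechet_derivative a (at x) h *\<^sub>R b x"]) auto
  next
    case (add f g)
    then obtain D E where D: "\<forall>x\<in>S. (f has_derivative D x) (at x)" "\<forall>v. sum_of_products S (\<lambda>x. D x v)"
      "\<forall>x\<in>S. (g has_derivative E x) (at x)" "\<forall>v. sum_of_products S (\<lambda>x. E x v)" by auto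
    then show ?case by (intro exI[where x="\<lambda>x v. D x v + E x v"]) (auto intro!: has_derivative_add sum_of_products.add)
  qed
qed

lemma smooth_on_mult:
  fixes a b :: "'a::real_normed_vector \<Rightarrow> real"
  shows "open S \<Longrightarrow> smooth_on S a \<Longrightarrow> smooth_on S b \<Longrightarrow> smooth_on S (\<lambda>x. a x * b x)"
  using smooth_on_scaleR[of S a b] by simp

lemma smooth_on_diff:
  assumes "open S" "smooth_on S f" "smooth_on S g" shows "smooth_on S (\<lambda>x. f x - g x)"
  using smooth_on_add[OF assms(1,2) smooth_on_compose_linear[OF assms(1) bounded_linear_minus[OF bounded_linear_ident] assms(3)]]
  by simp

lemma smooth_on_power:
  fixes a :: "'a::real_normed_vector \<Rightarrow> real"
  shows "open S \<Longrightarrow> smooth_on S a \<Longrightarrow> smooth_on S (\<lambda>x. a x ^ n)"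
  by (induction n) (auto intro: smooth_on_const smooth_on_mult)

text \<open>The quotients \<open>a / b ^ n\<close> with varying \<open>a\<close> and
  \<open>n\<close> form a class closed under differentiation: the quotient rule without cancellation
  turns the exponent \<open>n\<close> into \<open>n + n\<close>.\<close>

lemma smooth_on_divide:
  fixes a b :: "'a::real_normed_vector \<Rightarrow> real"
  assumes "open S" "smooth_on S a" "smooth_on S b" "\<And>x. x \<in> S \<Longrightarrow> b x \<noteq> 0"
  shows "smooth_on S (\<lambda>x. a x / b x)"
proof (rule smooth_on_coinduct[where P="\<lambda>h. \<exists>a n. smooth_on S a \<and> h = (\<lambda>x. a x / b x ^ n)", OF assms(1)])
  show "\<exists>c n. smooth_on S c \<and> (\<lambda>x. a x / b x) = (\<lambda>x. c x / b x ^ n)"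
    using assms by (intro exI[of _ a] exI[of _ 1]) auto
next
  fix h assume "\<exists>a n. smooth_on S a \<and> h = (\<lambda>x. a x / b x ^ n)"
  then obtain a n where a: "smooth_on S a" "h = (\<lambda>x. a x / b x ^ n)" by auto
  let ?N = "\<lambda>x v. frechet_derivative a (at x) v * b x ^ n - a x * frechet_derivative (\<lambda>x. b x ^ n) (at x) v"
  have sb: "smooth_on S (\<lambda>x. b x ^ n)" using assms smooth_on_power by blast
  have "(h has_derivative (\<lambda>v. ?N x v / b x ^ (n + n))) (at x)" if "x \<in> S" for x
    using has_derivative_divide'[OF smooth_on_has_derivative[OF a(1) that] smooth_on_has_derivative[OF sb that]]
      assms(4)[OF that] unfolding a(2) by (simp add: power_add)
  moreover have "smooth_on S (\<lambda>x. ?N x v)" for v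
    by (intro smooth_on_diff smooth_on_mult smooth_on_dirderiv a sb assms)
  ultimately show "\<exists>D. (\<forall>x\<in>S. (h has_derivative D x) (at x)) \<and>
             (\<forall>v. \<exists>a n. smooth_on S a \<and> (\<lambda>x. D x v) = (\<lambda>x. a x / b x ^ n))"
    by (intro exI[where x="\<lambda>x v. ?N x v / b x ^ (n + n)"]) blast
qed

section \<open>Zero sets of functions in the plane\<close>

text \<open>An implicit function theorem, obtained by inverting the map whose two coordinates are
  the position along \<open>u\<close> and the value of \<open>H\<close>. Hypothesis
  \<open>tr\<close> is injectivity of its derivative at \<open>x0\<close>. Parametrizing by the
  \<open>u\<close>-coordinate keeps the inverse of the parametrization explicit.\<close>

lemma zero_curve:
  fixes H :: "real^2 \<Rightarrow> real"
  assumes U: "open U" and H: "smooth_on U H" and x0: "x0 \<in> U" "H x0 = 0"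
    and tr: "\<And>v. frechet_derivative H (at x0) v = 0 \<Longrightarrow> u \<bullet> v = 0 \<Longrightarrow> v = 0"
  obtains V \<delta> g where "open V" "x0 \<in> V" "V \<subseteq> U" "\<delta> > 0"
    "\<And>x. x \<in> V \<Longrightarrow> H x = 0 \<Longrightarrow> \<bar>u \<bullet> (x - x0)\<bar> < \<delta> \<and> g (u \<bullet> (x - x0)) = x"
    "\<And>s. \<bar>s\<bar> < \<delta> \<Longrightarrow> g s \<in> V \<and> H (g s) = 0 \<and> u \<bullet> (g s - x0) = s \<and> g differentiable (at s)"
proof -
  let ?D = "\<lambda>x. frechet_derivative H (at x)"
  define e1 e2 :: "real^2" where "e1 = axis 1 1" and "e2 = axis 2 1"
  have e: "e1 $ 1 = 1" "e1 $ 2 = 0" "e2 $ 1 = 0" "e2 $ 2 = 1" by (auto simp: e1_def e2_def axis_def)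
  define \<Psi> where "\<Psi> = (\<lambda>x. (u \<bullet> (x - x0)) *\<^sub>R e1 + H x *\<^sub>R e2)"
  define \<Psi>' where "\<Psi>' = (\<lambda>x. Blinfun (\<lambda>v. (u \<bullet> v) *\<^sub>R e1 + ?D x v *\<^sub>R e2))"
  have D: "(H has_derivative ?D x) (at x)" if "x \<in> U" for x
    using smooth_on_has_derivative[OF H that] .
  have bl: "bounded_linear (\<lambda>v. (u \<bullet> v) *\<^sub>R e1 + ?D x v *\<^sub>R e2)" if "x \<in> U" for x
    using has_derivative_bounded_linear[OF D[OF that]]
    by (intro bounded_linear_add bounded_linear_compose[OF bounded_linear_scaleR_left] bounded_linear_inner_right)
  have ap: "blinfun_apply (\<Psi>' x) = (\<lambda>v. (u \<bullet> v) *\<^sub>R e1 + ?D x v *\<^sub>R e2)" if "x \<in> U" for x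
    using bounded_linear_Blinfun_apply[OF bl[OF that]] unfolding \<Psi>'_def .
  have der: "(\<Psi> has_derivative blinfun_apply (\<Psi>' x)) (at x)" if "x \<in> U" for x
    unfolding ap[OF that] \<Psi>_def
    by (auto intro!: derivative_eq_intros D[OF that])
  have cont: "continuous_on U \<Psi>'"
  proof (rule continuous_on_blinfun_componentwise)
    fix i :: "real^2"
    have "continuous_on U (\<lambda>x. (u \<bullet> i) *\<^sub>R e1 + ?D x i *\<^sub>R e2)"
      by (intro continuous_intros smooth_on_continuous smooth_on_dirderiv H)
    then show "continuous_on U (\<lambda>x. blinfun_apply (\<Psi>' x) i)"
      by (rule continuous_on_eq) (simp add: ap)
  qed
  have inj: "inj (blinfun_apply (\<Psi>' x0))"
  proof (subst linear_injective_0[OF bounded_linear.linear[OF blinfun.bounded_linear_right]], intro allI impI)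
    fix v assume "blinfun_apply (\<Psi>' x0) v = 0"
    then have z: "(u \<bullet> v) *\<^sub>R e1 + ?D x0 v *\<^sub>R e2 = 0" by (simp add: ap x0)
    have "u \<bullet> v = 0" using arg_cong[OF z, of "\<lambda>w. w $ 1"] by (simp add: e)
    moreover have "?D x0 v = 0" using arg_cong[OF z, of "\<lambda>w. w $ 2"] by (simp add: e)
    ultimately show "v = 0" using tr by blast
  qed
  obtain L where L: "linear L" "L \<circ> blinfun_apply (\<Psi>' x0) = id"
    using linear_injective_left_inverse[OF _ inj] by (auto intro: bounded_linear.linear[OF blinfun.bounded_linear_right])
  have inv: "Blinfun L o\<^sub>L \<Psi>' x0 = id_blinfun"
    by (rule blinfun_eqI)
      (use L in \<open>simp add: bounded_linear_Blinfun_apply linear_conv_bounded_linear fun_eq_iff\<close>)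
  have "\<exists>U' V g g'. open U' \<and> U' \<subseteq> U \<and> x0 \<in> U' \<and> open V \<and> \<Psi> x0 \<in> V \<and> homeomorphism U' V \<Psi> g \<and>
    (\<forall>y\<in>V. (g has_derivative g' y) (at y))"
    by (rule inverse_function_theorem[OF U der cont x0(1) inv]) blast+
  then obtain U' V g g' where ift: "open U'" "U' \<subseteq> U" "x0 \<in> U'" "open V" "\<Psi> x0 \<in> V"
    "homeomorphism U' V \<Psi> g" "\<And>y. y \<in> V \<Longrightarrow> (g has_derivative g' y) (at y)" by blast
  \<comment> \<open>\<open>\<Psi> x0 = 0\<close> and \<open>e1\<close> is a unit vector, so the
    radius of a ball inside \<open>V\<close> bounds the admissible parameters of the curve
    \<open>s *\<^sub>R e1\<close>.\<close>
  have "0 \<in> V" using ift(5) x0 by (simp add: \<Psi>_def)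
  then obtain \<delta> where \<delta>: "\<delta> > 0" "ball 0 \<delta> \<subseteq> V" using openE[OF ift(4)] by metis
  have inV: "s *\<^sub>R e1 \<in> V" if "\<bar>s\<bar> < \<delta>" for s :: real
    using that \<delta>(2) by (auto simp: subset_eq e1_def)
  show ?thesis
  proof
    \<comment> \<open>\<open>U'\<close> is cut down to a strip, so that every zero in the
      neighbourhood has its parameter in the interval on which the curve is controlled.\<close>
    show "open {x \<in> U'. \<bar>u \<bullet> (x - x0)\<bar> < \<delta>}"
    proof -
      have "open {x. \<bar>u \<bullet> (x - x0)\<bar> < \<delta>}" by (intro open_Collect_less continuous_intros)
      moreover have "{x \<in> U'. \<bar>u \<bullet> (x - x0)\<bar> < \<delta>} = U' \<inter> {x. \<bar>u \<bullet> (x - x0)\<bar> < \<delta>}" by blast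
      ultimately show ?thesis using open_Int[OF ift(1)] by simp
    qed
    show "x0 \<in> {x \<in> U'. \<bar>u \<bullet> (x - x0)\<bar> < \<delta>}" "{x \<in> U'. \<bar>u \<bullet> (x - x0)\<bar> < \<delta>} \<subseteq> U" "\<delta> > 0"
      using ift \<delta> by auto
  next
    fix x assume x: "x \<in> {x \<in> U'. \<bar>u \<bullet> (x - x0)\<bar> < \<delta>}" "H x = 0"
    then have "g (\<Psi> x) = x" using ift(6) by (auto simp: homeomorphism_def)
    then show "\<bar>u \<bullet> (x - x0)\<bar> < \<delta> \<and> g ((u \<bullet> (x - x0)) *\<^sub>R e1) = x" using x by (simp add: \<Psi>_def)
  next
    fix s :: real assume s: "\<bar>s\<bar> < \<delta>"
    have z: "g (s *\<^sub>R e1) \<in> U'" "\<Psi> (g (s *\<^sub>R e1)) = s *\<^sub>R e1"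
      using inV[OF s] ift(6) by (auto simp: homeomorphism_def)
    have "u \<bullet> (g (s *\<^sub>R e1) - x0) = s" "H (g (s *\<^sub>R e1)) = 0"
      using arg_cong[OF z(2), of "\<lambda>w. w $ 1"] arg_cong[OF z(2), of "\<lambda>w. w $ 2"]
      by (simp_all add: \<Psi>_def e)
    moreover have "(\<lambda>s. g (s *\<^sub>R e1)) differentiable (at s)"
    proof -
      have "((\<lambda>s. s *\<^sub>R e1) has_derivative (\<lambda>h. h *\<^sub>R e1)) (at s)"
        by (auto intro!: derivative_eq_intros)
      from has_derivative_compose[OF this ift(7)[OF inV[OF s]]] show ?thesis
        by (rule differentiableI)
    qed
    ultimately show "g (s *\<^sub>R e1) \<in> {x \<in> U'. \<bar>u \<bullet> (x - x0)\<bar> < \<delta>} \<and> H (g (s *\<^sub>R e1)) = 0 \<and>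
         u \<bullet> (g (s *\<^sub>R e1) - x0) = s \<and> (\<lambda>s. g (s *\<^sub>R e1)) differentiable (at s)"
      using z(1) s by simp
  qed
qed

section \<open>Sard's theorem in the plane\<close>

text \<open>The labels \<open>k N\<close> cut \<open>S\<close> into finitely many cells, and the
  image of each cell lies in an interval of length \<open>2 * b N\<close> around the value at one
  chosen point. The total length is at most \<open>2 * C / N\<close>, which tends to 0.\<close>

lemma negligible_image_covering:
  fixes f :: "'a \<Rightarrow> real" and k :: "nat \<Rightarrow> 'a \<Rightarrow> 'i"
  assumes J: "\<And>N. finite (J N)" "\<And>N x. N > 0 \<Longrightarrow> x \<in> S \<Longrightarrow> k N x \<in> J N"
    and b: "\<And>N x y. N > 0 \<Longrightarrow> x \<in> S \<Longrightarrow> y \<in> S \<Longrightarrow> k N x = k N y \<Longrightarrow> \<bar>f x - f y\<bar> \<le> b N"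
    and C: "\<And>N. N > 0 \<Longrightarrow> real (card (J N)) * b N \<le> C / real N" and b0: "\<And>N. b N \<ge> 0"
  shows "negligible (f ` S)"
  unfolding negligible_outer_le
proof (intro allI impI)
  fix e :: real assume e: "e > 0"
  \<comment> \<open>The 2 comes from intervals of radius \<open>b N\<close>; the absolute value
    covers a negative \<open>C\<close>.\<close>
  obtain N :: nat where N: "real N > 2 * \<bar>C\<bar> / e" using reals_Archimedean2 by blast
  then have N0: "N > 0" using e by (smt (verit) divide_nonneg_pos of_nat_0_less_iff)
  define c where "c = (\<lambda>i. f (SOME x. x \<in> S \<and> k N x = i))"
  let ?T = "\<Union>i\<in>J N. {c i - b N..c i + b N}"
  have sub: "f ` S \<subseteq> ?T"
  proof
    fix y assume "y \<in> f ` S"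
    then obtain x where x: "x \<in> S" "y = f x" by auto
    let ?z = "SOME z. z \<in> S \<and> k N z = k N x"
    have "?z \<in> S \<and> k N ?z = k N x" by (rule someI[of _ x]) (use x in auto)
    then have "\<bar>f x - c (k N x)\<bar> \<le> b N" using b[OF N0 x(1), of ?z] by (simp add: c_def)
    then show "y \<in> ?T" using J(2)[OF N0 x(1)] x(2) by (auto intro!: bexI[of _ "k N x"])
  qed
  have "measure lebesgue ?T \<le> (\<Sum>i\<in>J N. measure lebesgue {c i - b N..c i + b N})"
    by (intro measure_UNION_le J) auto
  also have "\<dots> = (\<Sum>i\<in>J N. 2 * b N)" using b0[of N] by (intro sum.cong) auto
  also have "\<dots> = 2 * (real (card (J N)) * b N)" by simp
  also have "\<dots> \<le> 2 * (C / real N)" using C[OF N0] by simp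
  also have "\<dots> \<le> e"
  proof -
    have "2 * \<bar>C\<bar> \<le> e * real N" using N e by (simp add: field_simps)
    then have "2 * C \<le> e * real N" by linarith
    then show ?thesis using N0 by (simp add: field_simps)
  qed
  finally show "\<exists>T. f ` S \<subseteq> T \<and> T \<in> lmeasurable \<and> measure lebesgue T \<le> e"
    using sub J(1) by (intro exI[of _ ?T]) (auto intro!: fmeasurable.finite_UN)
qed

lemma floor_mult_eq_imp_diff_le:
  assumes "\<lfloor>x * real N\<rfloor> = \<lfloor>y * real N\<rfloor>" "N > 0"
  shows "\<bar>x - y\<bar> \<le> 1 / real N"
proof -
  have "\<bar>x * real N - y * real N\<bar> < 1" using assms(1) by linarith
  then have "\<bar>x - y\<bar> * real N < 1" by (simp add: left_diff_distrib[symmetric] abs_mult)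
  then show ?thesis using assms(2) by (simp add: field_simps)
qed

lemma floor_mult_bounds:
  assumes "\<bar>x\<bar> \<le> real R"
  shows "\<lfloor>x * real N\<rfloor> \<in> {- int (R * N)..int (R * N)}"
proof -
  have "\<bar>x * real N\<bar> \<le> real R * real N" using assms by (simp add: abs_mult mult_right_mono)
  then have "- real (R * N) \<le> x * real N" "x * real N \<le> real (R * N)" by auto
  then show ?thesis by (auto simp: le_floor_iff floor_le_iff)
qed

lemma card_int_box: "real (card {- int (R * N)..int (R * N)}) \<le> (2 * real R + 1) * real N" if "N > 0"
proof -
  have "real (card {- int (R * N)..int (R * N)}) = 2 * real R * real N + 1" by simp
  also have "\<dots> \<le> (2 * real R + 1) * real N" using that by (simp add: algebra_simps)
  finally show ?thesis .
qed

text \<open>Cells of width 1/N in the single coordinate \<open>l\<close> number about N, and each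
  has an image of size about 1/N^2.\<close>

lemma negligible_image_quadratic:
  fixes f l :: "'a \<Rightarrow> real"
  assumes l: "\<And>x. x \<in> S \<Longrightarrow> \<bar>l x\<bar> \<le> R"
    and f: "\<And>x y. x \<in> S \<Longrightarrow> y \<in> S \<Longrightarrow> \<bar>f x - f y\<bar> \<le> K * \<bar>l x - l y\<bar>\<^sup>2" and K: "K \<ge> 0"
  shows "negligible (f ` S)"
proof -
  obtain R' :: nat where R': "R \<le> real R'" using real_arch_simple by blast
  show ?thesis
  proof (rule negligible_image_covering[where k="\<lambda>N x. \<lfloor>l x * real N\<rfloor>" and J="\<lambda>N. {- int (R' * N)..int (R' * N)}"
        and b="\<lambda>N. K * (1 / real N)\<^sup>2" and C="K * (2 * real R' + 1)"])
    fix N x y assume N: "N > (0::nat)" and xy: "x \<in> S" "y \<in> S" "\<lfloor>l x * real N\<rfloor> = \<lfloor>l y * real N\<rfloor>"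
    have "\<bar>l x - l y\<bar>\<^sup>2 \<le> (1 / real N)\<^sup>2" using floor_mult_eq_imp_diff_le[OF xy(3) N] by (intro power_mono) auto
    then show "\<bar>f x - f y\<bar> \<le> K * (1 / real N)\<^sup>2" using f[OF xy(1,2)] K
      by (meson mult_left_mono order_trans)
  next
    fix N assume N: "N > (0::nat)"
    have "real (card {- int (R' * N)..int (R' * N)}) * (K * (1 / real N)\<^sup>2)
      \<le> ((2 * real R' + 1) * real N) * (K * (1 / real N)\<^sup>2)"
      by (rule mult_right_mono[OF card_int_box[OF N]]) (use K in auto)
    also have "\<dots> = K * (2 * real R' + 1) / real N" using N by (simp add: power2_eq_square field_simps)
    finally show "real (card {- int (R' * N)..int (R' * N)}) * (K * (1 / real N)\<^sup>2) \<le> K * (2 * real R' + 1) / real N" .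
  next
    fix N x assume "x \<in> S"
    then have "\<bar>l x\<bar> \<le> real R'" using l R' by fastforce
    then show "\<lfloor>l x * real N\<rfloor> \<in> {- int (R' * N)..int (R' * N)}" by (rule floor_mult_bounds)
  qed (use K in auto)
qed

text \<open>About N^2 squares of side 1/N, each with an image of size about 1/N^3. The diameter of a
  square is bounded by 2/N through the sum norm, whence the factor 8.\<close>

lemma negligible_image_cubic:
  fixes f :: "real^2 \<Rightarrow> real"
  assumes l: "\<And>x. x \<in> S \<Longrightarrow> norm x \<le> R"
    and f: "\<And>x y. x \<in> S \<Longrightarrow> y \<in> S \<Longrightarrow> \<bar>f x - f y\<bar> \<le> K * norm (x - y) ^ 3" and K: "K \<ge> 0"
  shows "negligible (f ` S)"
proof -
  obtain R' :: nat where R': "R \<le> real R'" using real_arch_simple by blast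
  let ?B = "\<lambda>N. {- int (R' * N)..int (R' * N)}"
  show ?thesis
  proof (rule negligible_image_covering[where k="\<lambda>N x. (\<lfloor>x$1 * real N\<rfloor>, \<lfloor>x$2 * real N\<rfloor>)" and J="\<lambda>N. ?B N \<times> ?B N"
        and b="\<lambda>N. K * (2 / real N)^3" and C="8 * K * (2 * real R' + 1)\<^sup>2"])
    fix N and x y :: "real^2" assume N: "N > (0::nat)" and xy: "x \<in> S" "y \<in> S"
      "(\<lfloor>x$1 * real N\<rfloor>, \<lfloor>x$2 * real N\<rfloor>) = (\<lfloor>y$1 * real N\<rfloor>, \<lfloor>y$2 * real N\<rfloor>)"
    have "norm (x - y) \<le> \<bar>x$1 - y$1\<bar> + \<bar>x$2 - y$2\<bar>" using norm_le_l1_cart[of "x - y"] by (simp add: sum_2)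
    also have "\<dots> \<le> 1 / real N + 1 / real N" using xy(3) floor_mult_eq_imp_diff_le[OF _ N] by (intro add_mono) auto
    finally have "norm (x - y) ^ 3 \<le> (2 / real N) ^ 3" by (intro power_mono) auto
    then show "\<bar>f x - f y\<bar> \<le> K * (2 / real N) ^ 3" using f[OF xy(1,2)] K
      by (meson mult_left_mono order_trans)
  next
    fix N assume N: "N > (0::nat)"
    have "real (card (?B N \<times> ?B N)) * (K * (2 / real N)^3) =
      (real (card (?B N)))\<^sup>2 * (K * (2 / real N)^3)" by (simp add: power2_eq_square)
    also have "\<dots> \<le> ((2 * real R' + 1) * real N)\<^sup>2 * (K * (2 / real N)^3)"
      by (intro mult_right_mono power_mono card_int_box[OF N]) (use K in auto)
    also have "\<dots> = 8 * K * (2 * real R' + 1)\<^sup>2 / real N" using N by (simp add: power2_eq_square power3_eq_cube field_simps)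
    finally show "real (card (?B N \<times> ?B N)) * (K * (2 / real N)^3) \<le> 8 * K * (2 * real R' + 1)\<^sup>2 / real N" .
  next
    fix N and x :: "real^2" assume "x \<in> S"
    then have "\<bar>x $ i\<bar> \<le> real R'" for i using l R' component_le_norm_cart[of x i] by fastforce
    then show "(\<lfloor>x$1 * real N\<rfloor>, \<lfloor>x$2 * real N\<rfloor>) \<in> ?B N \<times> ?B N" using floor_mult_bounds by blast
  qed (use K in auto)
qed

lemma negligible_image_locally:
  fixes f :: "'a::second_countable_topology \<Rightarrow> real"
  assumes "\<And>x. x \<in> S \<Longrightarrow> \<exists>V. open V \<and> x \<in> V \<and> negligible (f ` (S \<inter> V))"
  shows "negligible (f ` S)"
proof -
  let ?F = "{V. open V \<and> negligible (f ` (S \<inter> V))}"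
  obtain F' where F': "F' \<subseteq> ?F" "countable F'" "\<Union>F' = \<Union>?F"
    using Lindelof[of ?F] by auto
  have "negligible (\<Union>((\<lambda>V. f ` (S \<inter> V)) ` F'))"
    using F' by (intro negligible_countable_Union) auto
  moreover have "f ` S \<subseteq> \<Union>((\<lambda>V. f ` (S \<inter> V)) ` F')"
  proof
    fix y assume "y \<in> f ` S"
    then obtain x where x: "x \<in> S" "y = f x" by auto
    then have "x \<in> \<Union>F'" using assms[OF x(1)] unfolding F'(3) by auto
    then show "y \<in> \<Union>((\<lambda>V. f ` (S \<inter> V)) ` F')" using x by auto
  qed
  ultimately show ?thesis using negligible_subset by blast
qed

text \<open>The mean value inequality raises the order of vanishing by one, so Taylor estimates
  arise by iterating it. The factor 2 counts the coordinates, since only the partial derivatives are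
  bounded.\<close>

lemma taylor_step:
  fixes G :: "real^2 \<Rightarrow> real"
  assumes G: "\<And>z. z \<in> closed_segment x y \<Longrightarrow> (G has_derivative G' z) (at z)"
    and K: "\<And>z i. z \<in> closed_segment x y \<Longrightarrow> \<bar>G' z (axis i 1)\<bar> \<le> K * norm (z - x) ^ m" "K \<ge> 0"
    and x: "G x = 0"
  shows "\<bar>G y\<bar> \<le> 2 * K * norm (y - x) ^ Suc m"
proof -
  have "norm (G y - G x) \<le> (2 * K * norm (y - x) ^ m) * norm (y - x)"
  proof (rule differentiable_bound[of "closed_segment x y" G G'])
    fix z assume z: "z \<in> closed_segment x y"
    show "(G has_derivative G' z) (at z within closed_segment x y)"
      using G[OF z] has_derivative_at_withinI by blast
    have lin: "linear (G' z)" using G[OF z] has_derivative_linear by blast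
    have zx: "norm (z - x) ^ m \<le> norm (y - x) ^ m"
      using segment_bound1[OF z] by (intro power_mono) auto
    show "onorm (G' z) \<le> 2 * K * norm (y - x) ^ m"
    proof (rule onorm_le)
      fix v :: "real^2"
      have "v = (\<Sum>i\<in>UNIV. v $ i *\<^sub>R axis i 1)" by (simp add: vec_eq_iff axis_def if_distrib cong: if_cong)
      then have "G' z v = G' z (\<Sum>i\<in>UNIV. v $ i *\<^sub>R axis i 1)" by simp
      also have "\<dots> = (\<Sum>i\<in>UNIV. v $ i * G' z (axis i 1))"
        by (simp add: linear_sum[OF lin] linear_scale[OF lin])
      finally have "G' z v = (\<Sum>i\<in>UNIV. v $ i * G' z (axis i 1))" .
      then have "norm (G' z v) \<le> (\<Sum>i\<in>UNIV. \<bar>v $ i * G' z (axis i 1)\<bar>)"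
        using sum_abs[of "\<lambda>i. v $ i * G' z (axis i 1)" UNIV] by simp
      also have "\<dots> \<le> (\<Sum>i\<in>(UNIV::2 set). norm v * (K * norm (y - x) ^ m))"
        unfolding abs_mult using K zx by (intro sum_mono mult_mono component_le_norm_cart)
          (auto intro: order_trans[OF K(1)[OF z]] mult_left_mono)
      finally show "norm (G' z v) \<le> 2 * K * norm (y - x) ^ m * norm v" by (simp add: mult_ac)
    qed
  qed auto
  then show ?thesis using x by (simp add: mult_ac)
qed

lemma taylor_step_convex:
  fixes G :: "real^2 \<Rightarrow> real"
  assumes G: "smooth_on U G" and B: "convex B" "B \<subseteq> U" and xy: "x \<in> B" "y \<in> B"
    and K: "\<And>z i. z \<in> B \<Longrightarrow> \<bar>frechet_derivative G (at z) (axis i 1)\<bar> \<le> K * norm (z - x) ^ m" "K \<ge> 0"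
  shows "\<bar>G y - G x\<bar> \<le> 2 * K * norm (y - x) ^ Suc m"
proof (rule taylor_step[where G'="\<lambda>z. frechet_derivative G (at z)"])
  have seg: "closed_segment x y \<subseteq> B" using closed_segment_subset xy B by blast
  fix z assume z: "z \<in> closed_segment x y"
  have "(G has_derivative frechet_derivative G (at z)) (at z)"
    using smooth_on_has_derivative[OF G] z seg B by blast
  from has_derivative_diff[OF this has_derivative_const[of "G x"]]
  show "((\<lambda>y. G y - G x) has_derivative frechet_derivative G (at z)) (at z)" by simp
  show "\<bar>frechet_derivative G (at z) (axis i 1)\<bar> \<le> K * norm (z - x) ^ m" for i
    using K(1) z seg by blast
qed (use K in auto)

lemma finite_family_bounded:
  fixes g :: "'i::finite \<Rightarrow> 'a::topological_space \<Rightarrow> real"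
  assumes "compact B" "\<And>i. continuous_on B (g i)"
  obtains K where "K \<ge> 0" "\<And>i z. z \<in> B \<Longrightarrow> \<bar>g i z\<bar> \<le> K"
proof -
  have "continuous_on B (\<lambda>z. \<Sum>i\<in>UNIV. \<bar>g i z\<bar>)" by (intro continuous_intros assms)
  then have "bounded ((\<lambda>z. \<Sum>i\<in>UNIV. \<bar>g i z\<bar>) ` B)"
    using compact_continuous_image compact_imp_bounded assms(1) by blast
  then obtain K where K: "\<And>z. z \<in> B \<Longrightarrow> \<bar>\<Sum>i\<in>UNIV. \<bar>g i z\<bar>\<bar> \<le> K"
    unfolding bounded_iff by auto
  show ?thesis
  proof
    fix i z assume z: "z \<in> B"
    have "\<bar>g i z\<bar> \<le> (\<Sum>i\<in>UNIV. \<bar>g i z\<bar>)" by (rule member_le_sum) auto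
    also have "\<dots> \<le> \<bar>K\<bar>" using K[OF z] by linarith
    finally show "\<bar>g i z\<bar> \<le> \<bar>K\<bar>" .
  qed simp
qed

lemma frechet_derivative_coords:
  fixes G :: "real^2 \<Rightarrow> 'b::real_normed_vector"
  assumes "(G has_derivative D) (at z)"
  shows "D v = v $ 1 *\<^sub>R D (axis 1 1) + v $ 2 *\<^sub>R D (axis 2 1)"
proof -
  have lin: "linear D" using assms has_derivative_linear by blast
  have v: "v = v $ 1 *\<^sub>R axis 1 1 + v $ 2 *\<^sub>R axis 2 1"
    by (simp add: vec_eq_iff axis_def forall_2)
  show ?thesis by (subst v) (simp only: linear_add[OF lin] linear_scale[OF lin])
qed

text \<open>The critical points are split by their second partials. Where all of them vanish,
  \<open>F\<close> varies by the third power of the distance, which beats the N^2 squares of a grid.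
  Where some \<open>Q k j\<close> is nonzero, the nearby critical points are zeros of
  \<open>P k\<close>, which has a nonzero gradient there; they project to a line with Lipschitz
  inverse, and the second power of the distance beats the N intervals of that line.\<close>

theorem sard_plane:
  fixes F :: "real^2 \<Rightarrow> real"
  assumes U: "open U" and F: "smooth_on U F"
  shows "negligible (F ` {x \<in> U. frechet_derivative F (at x) = (\<lambda>_. 0)})"
proof -
  define P where "P = (\<lambda>k x. frechet_derivative F (at x) (axis k 1))"
  define Q where "Q = (\<lambda>k j x. frechet_derivative (P k) (at x) (axis j 1))"
  define R where "R = (\<lambda>(k, j, i) x. frechet_derivative (Q k j) (at x) (axis i 1))"
  have Pe: "frechet_derivative F (at x) (axis k 1) = P k x" for k x by (simp add: P_def)
  have Qe: "frechet_derivative (P k) (at x) (axis j 1) = Q k j x" for k j x by (simp add: Q_def)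
  have Re: "frechet_derivative (Q k j) (at x) (axis i 1) = R (k, j, i) x" for k j i x by (simp add: R_def)
  have sP: "smooth_on U (P k)" for k unfolding P_def by (rule smooth_on_dirderiv[OF F])
  have sQ: "smooth_on U (Q k j)" for k j unfolding Q_def by (rule smooth_on_dirderiv[OF sP])
  have sR: "smooth_on U (R i)" for i unfolding R_def by (cases i) (auto intro: smooth_on_dirderiv sQ)
  \<comment> \<open>Two Taylor steps, each with factor 2; the third-order estimate below uses three,
    hence its 8.\<close>
  have qest: "\<bar>F y - F x\<bar> \<le> 4 * K * norm (y - x) ^ 2"
    if K: "K \<ge> 0" "\<And>k j z. z \<in> cball x0 r \<Longrightarrow> \<bar>Q k j z\<bar> \<le> K" and r: "cball x0 r \<subseteq> U"
      and xy: "x \<in> cball x0 r" "y \<in> cball x0 r" "\<And>k. P k x = 0" for K x0 r x y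
  proof -
    have "\<bar>P k z - P k x\<bar> \<le> 2 * K * norm (z - x) ^ Suc 0" if "z \<in> cball x0 r" for k z
      by (rule taylor_step_convex[OF sP _ r xy(1) that]) (use K in \<open>auto simp: Qe\<close>)
    then have "\<bar>F y - F x\<bar> \<le> 2 * (2 * K) * norm (y - x) ^ Suc (Suc 0)"
      by (intro taylor_step_convex[OF F _ r xy(1,2)]) (use K xy(3) in \<open>auto simp: Pe\<close>)
    then show ?thesis by (simp add: eval_nat_numeral)
  qed
  have cest: "\<bar>F y - F x\<bar> \<le> 8 * K * norm (y - x) ^ 3"
    if K: "K \<ge> 0" "\<And>i z. z \<in> cball x0 r \<Longrightarrow> \<bar>R i z\<bar> \<le> K" and r: "cball x0 r \<subseteq> U"
      and xy: "x \<in> cball x0 r" "y \<in> cball x0 r" "\<And>k. P k x = 0" "\<And>k j. Q k j x = 0" for K x0 r x y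
  proof -
    have "\<bar>Q k j z - Q k j x\<bar> \<le> 2 * K * norm (z - x) ^ Suc 0" if "z \<in> cball x0 r" for k j z
      by (rule taylor_step_convex[OF sQ _ r xy(1) that]) (use K in \<open>auto simp: Re\<close>)
    then have "\<bar>P k z - P k x\<bar> \<le> 2 * (2 * K) * norm (z - x) ^ Suc (Suc 0)" if "z \<in> cball x0 r" for k z
      by (intro taylor_step_convex[OF sP _ r xy(1) that]) (use K xy(4) in \<open>auto simp: Qe\<close>)
    then have "\<bar>F y - F x\<bar> \<le> 2 * (2 * (2 * K)) * norm (y - x) ^ Suc (Suc (Suc 0))"
      by (intro taylor_step_convex[OF F _ r xy(1,2)]) (use K xy(3) in \<open>auto simp: Pe\<close>)
    then show ?thesis by (simp add: eval_nat_numeral)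
  qed
  have flat: "negligible (F ` {x \<in> U. (\<forall>k. P k x = 0) \<and> (\<forall>k j. Q k j x = 0)})" (is "negligible (F ` ?C2)")
  proof (rule negligible_image_locally)
    fix x0 assume "x0 \<in> ?C2"
    then obtain r where r: "r > 0" "cball x0 r \<subseteq> U" using U open_contains_cball by blast
    obtain K where K: "K \<ge> 0" "\<And>i z. z \<in> cball x0 r \<Longrightarrow> \<bar>R i z\<bar> \<le> K"
      using finite_family_bounded[OF compact_cball, of x0 r R] continuous_on_subset[OF smooth_on_continuous[OF sR] r(2)]
      by metis
    have "negligible (F ` (?C2 \<inter> ball x0 r))"
    proof (rule negligible_image_cubic[where K="8 * K" and R="norm x0 + r"])
      fix x assume "x \<in> ?C2 \<inter> ball x0 r"
      then have "norm (x - x0) < r" by (simp add: dist_norm norm_minus_commute)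
      then show "norm x \<le> norm x0 + r" using norm_triangle_ineq2[of x x0] by linarith
    next
      fix x y assume "x \<in> ?C2 \<inter> ball x0 r" "y \<in> ?C2 \<inter> ball x0 r"
      then show "\<bar>F x - F y\<bar> \<le> 8 * K * norm (x - y) ^ 3" by (intro cest[OF K r(2)]) auto
    qed (use K in auto)
    then show "\<exists>V. open V \<and> x0 \<in> V \<and> negligible (F ` (?C2 \<inter> V))" using r(1) by (intro exI[of _ "ball x0 r"]) auto
  qed
  have curved: "negligible (F ` {x \<in> U. (\<forall>k. P k x = 0) \<and> Q k j x \<noteq> 0})" (is "negligible (F ` ?C1)") for k j
  proof (rule negligible_image_locally)
    fix x0 assume x0: "x0 \<in> ?C1"
    define n :: "real^2" where "n = (\<chi> i. Q k i x0)"
    \<comment> \<open>The gradient \<open>n\<close> of \<open>P k\<close> at \<open>x0\<close>,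
      turned by a right angle: the tangent direction of the zero curve of \<open>P k\<close>. As
      \<open>n\<close> and \<open>u\<close> are orthogonal of equal length, \<open>pyth\<close> is
      Pythagoras.\<close>
    define u :: "real^2" where "u = (\<chi> i. if i = 1 then - n $ 2 else n $ 1)"
    have n0: "n \<noteq> 0" using x0 by (auto simp: n_def vec_eq_iff)
    have pyth: "norm n * norm w \<le> \<bar>n \<bullet> w\<bar> + \<bar>u \<bullet> w\<bar>" for w :: "real^2"
    proof -
      have "(norm n * norm w)\<^sup>2 = (n \<bullet> w)\<^sup>2 + (u \<bullet> w)\<^sup>2"
        by (simp add: power_mult_distrib power2_norm_eq_inner inner_vec_def sum_2 u_def)
          (simp add: power2_eq_square algebra_simps)
      also have "\<dots> \<le> (\<bar>n \<bullet> w\<bar> + \<bar>u \<bullet> w\<bar>)\<^sup>2" by (simp add: power2_sum)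
      finally show ?thesis by (rule power2_le_imp_le) simp
    qed
    \<comment> \<open>The linear part of \<open>P k\<close> at \<open>x0\<close> is removed. Near
      \<open>x0\<close> the partials of the remainder are at most a quarter of
      \<open>norm n\<close>, so its Lipschitz constant is at most half of
      \<open>norm n\<close>.\<close>
    define G where "G = (\<lambda>z. P k z - n \<bullet> z)"
    have sG: "smooth_on U G" unfolding G_def
      by (intro smooth_on_diff U sP smooth_on_compose_linear[OF U bounded_linear_inner_right] smooth_on_id)
    have dG: "frechet_derivative G (at z) (axis i 1) = Q k i z - n $ i" if "z \<in> U" for z i
    proof -
      have "(G has_derivative (\<lambda>v. frechet_derivative (P k) (at z) v - n \<bullet> v)) (at z)"
        unfolding G_def by (auto intro!: derivative_eq_intros smooth_on_has_derivative[OF sP that])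
      from frechet_derivative_at[OF this, symmetric] show ?thesis
        by (simp add: Q_def inner_axis)
    qed
    have "\<forall>\<^sub>F z in nhds x0. \<bar>Q k i z - n $ i\<bar> < norm n / 4" for i
    proof -
      have "isCont (Q k i) x0" using smooth_on_continuous[OF sQ] x0 U continuous_on_eq_continuous_at by blast
      then have "(Q k i \<longlongrightarrow> n $ i) (nhds x0)" by (simp add: n_def isCont_def tendsto_nhds_iff)
      from tendstoD[OF this, of "norm n / 4"] show ?thesis using n0 by (simp add: dist_real_def)
    qed
    then have "\<forall>\<^sub>F z in nhds x0. \<forall>i. \<bar>Q k i z - n $ i\<bar> < norm n / 4" by (simp add: eventually_all_finite)
    then have "\<forall>\<^sub>F z in nhds x0. (\<forall>i. \<bar>Q k i z - n $ i\<bar> < norm n / 4) \<and> z \<in> U"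
      using eventually_nhds_in_open[OF U] x0 by (simp add: eventually_conj)
    then obtain d where d: "d > 0" "\<And>z. dist z x0 < d \<Longrightarrow> (\<forall>i. \<bar>Q k i z - n $ i\<bar> < norm n / 4) \<and> z \<in> U"
      unfolding eventually_nhds_metric by blast
    define r where "r = d / 2"
    have r: "r > 0" "cball x0 r \<subseteq> U" "\<And>z i. z \<in> cball x0 r \<Longrightarrow> \<bar>Q k i z - n $ i\<bar> \<le> norm n / 4"
      using d by (fastforce simp: r_def dist_commute less_imp_le)+
    obtain K where K: "K \<ge> 0" "\<And>i z. z \<in> cball x0 r \<Longrightarrow> \<bar>(\<lambda>(k, j). Q k j) i z\<bar> \<le> K"
      using finite_family_bounded[OF compact_cball, of x0 r "\<lambda>(k, j). Q k j"] continuous_on_subset[OF smooth_on_continuous[OF sQ] r(2)]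
      by (metis (no_types, lifting) case_prod_beta)
    have K': "\<bar>Q k j z\<bar> \<le> K" if "z \<in> cball x0 r" for k j z using K(2)[OF that, of "(k, j)"] by simp
    \<comment> \<open>For two zeros of \<open>P k\<close> the increment of \<open>G\<close> is minus
      that of the linear part, so the component of \<open>x - y\<close> along \<open>n\<close>
      accounts for at most half of its length; the component along \<open>u\<close> must supply the
      other half.\<close>
    have lip: "norm (x - y) \<le> 2 / norm n * \<bar>u \<bullet> x - u \<bullet> y\<bar>"
      if "x \<in> cball x0 r" "y \<in> cball x0 r" "P k x = 0" "P k y = 0" for x y
    proof -
      have "\<bar>G x - G y\<bar> \<le> 2 * (norm n / 4) * norm (x - y) ^ Suc 0"
      proof (rule taylor_step_convex[OF sG _ r(2) that(2,1)])
        fix z i assume "z \<in> cball x0 r"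
        then show "\<bar>frechet_derivative G (at z) (axis i 1)\<bar> \<le> norm n / 4 * norm (z - y) ^ 0"
          using r(3) dG r(2) by (simp add: subset_eq)
      qed auto
      then have "\<bar>n \<bullet> (x - y)\<bar> \<le> norm n * norm (x - y) / 2"
        using that by (simp add: G_def inner_diff_right abs_minus_commute)
      then have "norm n * norm (x - y) \<le> 2 * \<bar>u \<bullet> x - u \<bullet> y\<bar>"
        using pyth[of "x - y"] by (simp add: inner_diff_right)
      then show ?thesis using n0 by (simp add: field_simps)
    qed
    have "negligible (F ` (?C1 \<inter> ball x0 r))"
    proof (rule negligible_image_quadratic[where K="4 * K * (2 / norm n)\<^sup>2" and l="\<lambda>x. u \<bullet> x" and R="norm u * (norm x0 + r)"])
      fix x assume "x \<in> ?C1 \<inter> ball x0 r"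
      then have "norm (x - x0) < r" by (simp add: dist_norm norm_minus_commute)
      then have "norm x \<le> norm x0 + r" using norm_triangle_ineq2[of x x0] by linarith
      then show "\<bar>u \<bullet> x\<bar> \<le> norm u * (norm x0 + r)"
        using Cauchy_Schwarz_ineq2[of u x] by (meson mult_left_mono norm_ge_zero order_trans)
    next
      fix x y assume xy: "x \<in> ?C1 \<inter> ball x0 r" "y \<in> ?C1 \<inter> ball x0 r"
      have "\<bar>F x - F y\<bar> \<le> 4 * K * norm (x - y) ^ 2"
        by (rule qest[OF K(1) K' r(2)]) (use xy in auto)
      also have "\<dots> \<le> 4 * K * (2 / norm n * \<bar>u \<bullet> x - u \<bullet> y\<bar>) ^ 2"
        using xy K(1) by (intro mult_left_mono power_mono lip) auto
      finally show "\<bar>F x - F y\<bar> \<le> 4 * K * (2 / norm n)\<^sup>2 * \<bar>u \<bullet> x - u \<bullet> y\<bar>\<^sup>2"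
        by (simp only: power_mult_distrib mult.assoc)
    qed (use K in auto)
    then show "\<exists>V. open V \<and> x0 \<in> V \<and> negligible (F ` (?C1 \<inter> V))" using r(1) by (intro exI[of _ "ball x0 r"]) (use x0 in auto)
  qed
  have "{x \<in> U. frechet_derivative F (at x) = (\<lambda>_. 0)} \<subseteq>
    {x \<in> U. (\<forall>k. P k x = 0) \<and> (\<forall>k j. Q k j x = 0)} \<union> (\<Union>k j. {x \<in> U. (\<forall>k. P k x = 0) \<and> Q k j x \<noteq> 0})"
    by (auto simp: P_def)
  then have sub: "F ` {x \<in> U. frechet_derivative F (at x) = (\<lambda>_. 0)} \<subseteq>
    F ` ({x \<in> U. (\<forall>k. P k x = 0) \<and> (\<forall>k j. Q k j x = 0)} \<union> (\<Union>k j. {x \<in> U. (\<forall>k. P k x = 0) \<and> Q k j x \<noteq> 0}))"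
    by (rule image_mono)
  have "negligible (\<Union>k. \<Union>j. F ` {x \<in> U. (\<forall>k. P k x = 0) \<and> Q k j x \<noteq> 0})"
    using curved by (intro negligible_Union) auto
  from negligible_subset[OF negligible_Un[OF flat this]] sub show ?thesis
    by (simp only: image_Un image_UN)
qed

section \<open>Compact 1-manifolds with a translation atlas\<close>

lemma isCont_eventually_in:
  assumes "isCont f a" "open S" "f a \<in> S"
  shows "\<forall>\<^sub>F s in nhds a. f s \<in> S"
proof -
  have "(f \<longlongrightarrow> f a) (nhds a)" using assms(1) by (simp add: isCont_def tendsto_at_iff_tendsto_nhds)
  then show ?thesis by (rule topological_tendstoD) (use assms in auto)
qed

text \<open>A compact space with an atlas of real-valued charts whose transition maps are local
  translations, i.e. a compact 1-manifold with a nowhere vanishing vector field. It is a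
  finite disjoint union of circles: a flow line recurs in some chart, hence is periodic by
  uniqueness, and its image is open.\<close>

locale translation_structure =
  fixes Z :: "'a::t2_space set" and W :: "'a \<Rightarrow> 'a set" and \<delta> :: "'a \<Rightarrow> real"
    and \<tau> :: "'a \<Rightarrow> 'a \<Rightarrow> real" and \<kappa> :: "'a \<Rightarrow> real \<Rightarrow> 'a"
  assumes compact_Z: "compact Z"
    and W_open: "q \<in> Z \<Longrightarrow> openin (top_of_set Z) (W q)" and W_base: "q \<in> Z \<Longrightarrow> q \<in> W q"
    and \<delta>_pos: "q \<in> Z \<Longrightarrow> \<delta> q > 0"
    and hom: "q \<in> Z \<Longrightarrow> homeomorphism (W q) {- \<delta> q<..<\<delta> q} (\<tau> q) (\<kappa> q)"
    and base: "q \<in> Z \<Longrightarrow> \<tau> q q = 0"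
    and compat: "\<lbrakk>q \<in> Z; q' \<in> Z; \<bar>t\<bar> < \<delta> q; \<kappa> q t \<in> W q'\<rbrakk> \<Longrightarrow>
      \<forall>\<^sub>F s in nhds t. \<tau> q' (\<kappa> q s) = \<tau> q' (\<kappa> q t) + (s - t)"
begin

text \<open>Unit speed in the time coordinate, as a condition on the germ of \<open>\<gamma>\<close>
  at \<open>t\<close>; hence flows can be shifted and glued without any differentiability. One chart
  around \<open>\<gamma> t\<close> is asked for, and \<open>flow_at_any\<close> passes to all
  others.\<close>

definition flow_at :: "(real \<Rightarrow> 'a) \<Rightarrow> real \<Rightarrow> bool" where
  "flow_at \<gamma> t \<longleftrightarrow> (\<exists>q\<in>Z. \<gamma> t \<in> W q \<and> (\<forall>\<^sub>F s in nhds t. \<gamma> s = \<kappa> q (\<tau> q (\<gamma> t) + (s - t))))"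

lemma W_sub: "q \<in> Z \<Longrightarrow> W q \<subseteq> Z"
  using W_open openin_imp_subset by blast

lemma kappa_tau: "q \<in> Z \<Longrightarrow> x \<in> W q \<Longrightarrow> \<kappa> q (\<tau> q x) = x"
  and tau_kappa: "q \<in> Z \<Longrightarrow> \<bar>t\<bar> < \<delta> q \<Longrightarrow> \<tau> q (\<kappa> q t) = t"
  and kappa_W: "q \<in> Z \<Longrightarrow> \<bar>t\<bar> < \<delta> q \<Longrightarrow> \<kappa> q t \<in> W q"
  and tau_bound: "q \<in> Z \<Longrightarrow> x \<in> W q \<Longrightarrow> \<bar>\<tau> q x\<bar> < \<delta> q"
proof -
  note h = hom[of q]
  show "q \<in> Z \<Longrightarrow> x \<in> W q \<Longrightarrow> \<kappa> q (\<tau> q x) = x" using homeomorphism_apply1[OF h] by blast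
  show "q \<in> Z \<Longrightarrow> \<bar>t\<bar> < \<delta> q \<Longrightarrow> \<tau> q (\<kappa> q t) = t" using homeomorphism_apply2[OF h] by (auto simp: abs_less_iff)
  show "q \<in> Z \<Longrightarrow> \<bar>t\<bar> < \<delta> q \<Longrightarrow> \<kappa> q t \<in> W q" using homeomorphism_image2[OF h] by (auto simp: abs_less_iff)
  assume "q \<in> Z" "x \<in> W q"
  then have "\<tau> q x \<in> {- \<delta> q<..<\<delta> q}" using homeomorphism_image1[OF h] by blast
  then show "\<bar>\<tau> q x\<bar> < \<delta> q" by auto
qed

lemma isCont_kappa: "q \<in> Z \<Longrightarrow> \<bar>t\<bar> < \<delta> q \<Longrightarrow> isCont (\<kappa> q) t"
  using homeomorphism_cont2[OF hom[of q]] by (auto simp: continuous_on_eq_continuous_at abs_less_iff)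

lemma eventually_shift:
  fixes t c :: real
  shows "(\<forall>\<^sub>F s in nhds (t + c). P s) \<Longrightarrow> \<forall>\<^sub>F s in nhds t. P (s + c)"
  by (erule eventually_compose_filterlim) (auto intro!: tendsto_intros filterlim_ident)

text \<open>By \<open>compat\<close> a chart change is a translation in time, so unit speed is
  preserved. Continuity of \<open>\<kappa> q\<close> keeps nearby points inside \<open>W q'\<close>,
  where \<open>\<tau> q'\<close> can be undone.\<close>

lemma flow_at_any:
  assumes "flow_at \<gamma> t" and q': "q' \<in> Z" "\<gamma> t \<in> W q'"
  shows "\<forall>\<^sub>F s in nhds t. \<gamma> s = \<kappa> q' (\<tau> q' (\<gamma> t) + (s - t))"
proof -
  obtain q where q: "q \<in> Z" "\<gamma> t \<in> W q" and ev: "\<forall>\<^sub>F s in nhds t. \<gamma> s = \<kappa> q (\<tau> q (\<gamma> t) + (s - t))"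
    using assms(1) by (auto simp: flow_at_def)
  define a where "a = \<tau> q (\<gamma> t)"
  have a: "\<bar>a\<bar> < \<delta> q" "\<kappa> q a = \<gamma> t" using q tau_bound kappa_tau by (auto simp: a_def)
  obtain O' where O': "open O'" "W q' = Z \<inter> O'" using W_open[OF q'(1)] openin_open by metis
  have "\<forall>\<^sub>F s in nhds a. \<kappa> q s \<in> O'"
    by (rule isCont_eventually_in[OF isCont_kappa[OF q(1) a(1)] O'(1)]) (use O' q' a(2) in auto)
  moreover have "\<forall>\<^sub>F s in nhds a. \<bar>s\<bar> < \<delta> q"
    using isCont_eventually_in[where f="\<lambda>s. s" and a=a and S="{- \<delta> q<..<\<delta> q}"] a by (auto simp: abs_less_iff elim!: eventually_mono)
  moreover have "\<forall>\<^sub>F s in nhds a. \<tau> q' (\<kappa> q s) = \<tau> q' (\<gamma> t) + (s - a)"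
    using compat[OF q(1) q'(1) a(1)] q'(2) by (simp add: a(2))
  ultimately have "\<forall>\<^sub>F s in nhds a. \<kappa> q s = \<kappa> q' (\<tau> q' (\<gamma> t) + (s - a))"
  proof eventually_elim
    case (elim s)
    have "\<kappa> q s \<in> W q'" using elim O' kappa_W[OF q(1)] W_sub[OF q(1)] by blast
    then show ?case using kappa_tau[OF q'(1)] elim(3) by metis
  qed
  then have "\<forall>\<^sub>F s in nhds (t + (a - t)). \<kappa> q s = \<kappa> q' (\<tau> q' (\<gamma> t) + (s - a))" by simp
  from eventually_shift[OF this] ev show ?thesis
    by eventually_elim (simp add: a_def algebra_simps)
qed

lemma flow_at_Z: "flow_at \<gamma> t \<Longrightarrow> \<gamma> t \<in> Z"
  using W_sub by (auto simp: flow_at_def)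

lemma flow_at_shift:
  assumes "flow_at \<gamma> (t + c)"
  shows "flow_at (\<lambda>s. \<gamma> (s + c)) t"
  using assms eventually_shift[of "\<lambda>s. \<gamma> s = \<kappa> _ (\<tau> _ (\<gamma> (t + c)) + (s - (t + c)))" t c]
  unfolding flow_at_def by (fastforce simp: algebra_simps)

lemma flow_at_cong:
  assumes "flow_at \<gamma> t" "\<forall>\<^sub>F s in nhds t. \<gamma>' s = \<gamma> s"
  shows "flow_at \<gamma>' t"
proof -
  have t: "\<gamma>' t = \<gamma> t" using eventually_nhds_x_imp_x[OF assms(2)] .
  obtain q where q: "q \<in> Z" "\<gamma> t \<in> W q" "\<forall>\<^sub>F s in nhds t. \<gamma> s = \<kappa> q (\<tau> q (\<gamma> t) + (s - t))"
    using assms(1) by (auto simp: flow_at_def)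
  have "\<forall>\<^sub>F s in nhds t. \<gamma>' s = \<kappa> q (\<tau> q (\<gamma>' t) + (s - t))"
    using q(3) assms(2) by eventually_elim (simp add: t)
  then show ?thesis using q t unfolding flow_at_def by metis
qed

lemma flow_at_kappa: "q \<in> Z \<Longrightarrow> \<bar>t\<bar> < \<delta> q \<Longrightarrow> flow_at (\<kappa> q) t"
  unfolding flow_at_def using kappa_W[of q t] tau_kappa[of q t] by (intro bexI[of _ q]) auto

lemma isCont_flow:
  assumes "flow_at \<gamma> t"
  shows "isCont \<gamma> t"
proof -
  obtain q where q: "q \<in> Z" "\<gamma> t \<in> W q" "\<forall>\<^sub>F s in nhds t. \<gamma> s = \<kappa> q (\<tau> q (\<gamma> t) + (s - t))"
    using assms by (auto simp: flow_at_def)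
  have "isCont (\<lambda>s. \<kappa> q (\<tau> q (\<gamma> t) + (s - t))) t"
    by (rule isCont_o2[where g="\<kappa> q"]) (auto intro!: isCont_kappa[OF q(1)] tau_bound q)
  then show ?thesis using isCont_cong[OF q(3)] by simp
qed

text \<open>The agreement set is open, because at a common point both curves follow the same chart
  curve, and its complement in \<open>I\<close> is open because the space is Hausdorff.
  Connectedness of \<open>I\<close> does the rest.\<close>

lemma flow_unique:
  assumes I: "open I" "connected I" "t0 \<in> I" "t \<in> I"
    and fl: "\<And>t. t \<in> I \<Longrightarrow> flow_at \<alpha> t" "\<And>t. t \<in> I \<Longrightarrow> flow_at \<beta> t" and eq: "\<alpha> t0 = \<beta> t0"
  shows "\<alpha> t = \<beta> t"
proof (rule ccontr)
  assume ne: "\<alpha> t \<noteq> \<beta> t"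
  let ?S = "{t \<in> I. \<alpha> t = \<beta> t}" and ?T = "{t \<in> I. \<alpha> t \<noteq> \<beta> t}"
  have "open ?S"
  proof (subst open_subopen, intro ballI)
    fix s assume s: "s \<in> ?S"
    obtain q where q: "q \<in> Z" "\<alpha> s \<in> W q" using fl(1)[of s] s unfolding flow_at_def by blast
    have "\<forall>\<^sub>F r in nhds s. \<alpha> r = \<beta> r"
    proof -
      have "s \<in> I" "\<beta> s \<in> W q" "\<alpha> s = \<beta> s" using s q by auto
      with flow_at_any[OF fl(1) q] flow_at_any[OF fl(2) q(1)]
      have "\<forall>\<^sub>F r in nhds s. \<alpha> r = \<kappa> q (\<tau> q (\<alpha> s) + (r - s))"
        "\<forall>\<^sub>F r in nhds s. \<beta> r = \<kappa> q (\<tau> q (\<alpha> s) + (r - s))" by auto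
      then show ?thesis by eventually_elim simp
    qed
    then have "\<forall>\<^sub>F r in nhds s. r \<in> ?S"
      using eventually_nhds_in_open[OF I(1)] s by (simp add: eventually_conj_iff)
    then show "\<exists>T. open T \<and> s \<in> T \<and> T \<subseteq> ?S" unfolding eventually_nhds by blast
  qed
  moreover have "open ?T"
  proof (subst open_subopen, intro ballI)
    fix s assume s: "s \<in> ?T"
    then obtain U V where UV: "open U" "open V" "\<alpha> s \<in> U" "\<beta> s \<in> V" "U \<inter> V = {}"
      using hausdorff[of "\<alpha> s" "\<beta> s"] by auto
    have "\<forall>\<^sub>F r in nhds s. \<alpha> r \<in> U" "\<forall>\<^sub>F r in nhds s. \<beta> r \<in> V"
      using isCont_eventually_in[OF isCont_flow[OF fl(1)]] isCont_eventually_in[OF isCont_flow[OF fl(2)]] s UV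
      by auto
    then have "\<forall>\<^sub>F r in nhds s. \<alpha> r \<noteq> \<beta> r" by eventually_elim (use UV in auto)
    then have "\<forall>\<^sub>F r in nhds s. r \<in> ?T"
      using eventually_nhds_in_open[OF I(1)] s by (simp add: eventually_conj_iff)
    then show "\<exists>U. open U \<and> s \<in> U \<and> U \<subseteq> ?T" unfolding eventually_nhds by blast
  qed
  moreover have "t0 \<in> ?S \<inter> I" "t \<in> ?T \<inter> I" using I eq ne by auto
  ultimately show False using connectedD[OF I(2), of ?S ?T] by blast
qed

lemma kappa_open_image:
  assumes "q \<in> Z" "open J" "J \<subseteq> {- \<delta> q<..<\<delta> q}"
  shows "openin (top_of_set Z) (\<kappa> q ` J)"
proof -
  have "openin (top_of_set {- \<delta> q<..<\<delta> q}) J" using assms by (simp add: open_openin_trans)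
  then have "openin (top_of_set (W q)) (\<kappa> q ` J)"
    using homeomorphism_imp_open_map[OF homeomorphism_symD[OF hom[OF assms(1)]]] by blast
  then show ?thesis using W_open[OF assms(1)] openin_trans by blast
qed

lemma finite_subcover:
  assumes "\<And>q. q \<in> Z \<Longrightarrow> openin (top_of_set Z) (V q) \<and> q \<in> V q"
  obtains F where "finite F" "F \<subseteq> Z" "Z \<subseteq> (\<Union>q\<in>F. V q)"
proof -
  have "\<forall>q\<in>Z. \<exists>O'. open O' \<and> V q = Z \<inter> O'" using assms openin_open by metis
  then obtain O' where O': "\<And>q. q \<in> Z \<Longrightarrow> open (O' q)" "\<And>q. q \<in> Z \<Longrightarrow> V q = Z \<inter> O' q" by metis
  have "Z \<subseteq> (\<Union>q\<in>Z. O' q)" using assms O' by blast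
  then obtain F where F: "F \<subseteq> Z" "finite F" "Z \<subseteq> (\<Union>q\<in>F. O' q)"
    using compactE_image[OF compact_Z, of Z O'] O'(1) by blast
  moreover have "Z \<subseteq> (\<Union>q\<in>F. V q)" using F O'(2) by blast
  ultimately show ?thesis using that by blast
qed

text \<open>Charts of half size still cover \<open>Z\<close>, and by compactness finitely many do. A
  point in such a half can move for time \<epsilon> in both directions within the full chart. Having
  one \<epsilon> for all points is what permits continuation.\<close>

lemma uniform_local_flow:
  obtains \<epsilon> \<eta> where "\<epsilon> > 0" "\<And>p. p \<in> Z \<Longrightarrow> \<eta> p 0 = p"
    "\<And>p t. p \<in> Z \<Longrightarrow> \<bar>t\<bar> < \<epsilon> \<Longrightarrow> flow_at (\<eta> p) t"
    "\<And>p. p \<in> Z \<Longrightarrow> inj_on (\<eta> p) {-\<epsilon><..<\<epsilon>}"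
    "\<And>p. p \<in> Z \<Longrightarrow> openin (top_of_set Z) (\<eta> p ` {-\<epsilon><..<\<epsilon>})"
proof -
  define V where "V = (\<lambda>q. \<kappa> q ` {- \<delta> q / 2<..<\<delta> q / 2})"
  have "openin (top_of_set Z) (V q) \<and> q \<in> V q" if q: "q \<in> Z" for q
  proof
    show "openin (top_of_set Z) (V q)" unfolding V_def
      by (rule kappa_open_image[OF q]) (use \<delta>_pos[OF q] in auto)
    have "\<kappa> q 0 = q" using kappa_tau[OF q W_base[OF q]] base[OF q] by simp
    then show "q \<in> V q" unfolding V_def by (intro image_eqI[of _ _ 0]) (use \<delta>_pos[OF q] in auto)
  qed
  then obtain F where F: "finite F" "F \<subseteq> Z" "Z \<subseteq> (\<Union>q\<in>F. V q)" using finite_subcover by metis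
  \<comment> \<open>The inserted 1 keeps the minimum meaningful when \<open>F\<close> is
    empty.\<close>
  define \<epsilon> where "\<epsilon> = Min (insert 1 ((\<lambda>q. \<delta> q / 2) ` F))"
  have \<epsilon>: "\<epsilon> > 0" using F \<delta>_pos by (auto simp: \<epsilon>_def)
  have \<epsilon>_le: "\<epsilon> \<le> \<delta> q / 2" if "q \<in> F" for q
    unfolding \<epsilon>_def by (rule Min_le) (use F that in auto)
  have "\<exists>\<eta>. \<eta> 0 = p \<and> (\<forall>t. \<bar>t\<bar> < \<epsilon> \<longrightarrow> flow_at \<eta> t) \<and> inj_on \<eta> {-\<epsilon><..<\<epsilon>} \<and>
    openin (top_of_set Z) (\<eta> ` {-\<epsilon><..<\<epsilon>})" if pZ: "p \<in> Z" for p
  proof -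
    obtain q where q: "q \<in> F" "p \<in> V q" using F(3) pZ by blast
    then have qZ: "q \<in> Z" using F by blast
    obtain a where a0: "a \<in> {- \<delta> q / 2<..<\<delta> q / 2}" "p = \<kappa> q a" using q unfolding V_def by blast
    then have a: "\<bar>a\<bar> < \<delta> q / 2" "p = \<kappa> q a" by auto
    have b: "\<bar>t + a\<bar> < \<delta> q" if "\<bar>t\<bar> < \<epsilon>" for t using \<epsilon>_le[OF q(1)] a that by linarith
    have "flow_at (\<lambda>t. \<kappa> q (t + a)) t" if "\<bar>t\<bar> < \<epsilon>" for t
      by (intro flow_at_shift flow_at_kappa[OF qZ] b that)
    moreover have "inj_on (\<lambda>t. \<kappa> q (t + a)) {-\<epsilon><..<\<epsilon>}"
    proof (rule inj_onI)
      fix x y assume xy: "x \<in> {-\<epsilon><..<\<epsilon>}" "y \<in> {-\<epsilon><..<\<epsilon>}" "\<kappa> q (x + a) = \<kappa> q (y + a)"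
      have "\<tau> q (\<kappa> q (x + a)) = x + a" "\<tau> q (\<kappa> q (y + a)) = y + a"
        by (rule tau_kappa[OF qZ b], use xy in force)+
      then have "x + a = y + a" using xy(3) by metis
      then show "x = y" by simp
    qed
    moreover have "openin (top_of_set Z) ((\<lambda>t. \<kappa> q (t + a)) ` {-\<epsilon><..<\<epsilon>})"
    proof -
      have "(\<lambda>t. \<kappa> q (t + a)) ` {-\<epsilon><..<\<epsilon>} = \<kappa> q ` {a-\<epsilon><..<a+\<epsilon>}"
      proof -
        have "r \<in> (\<lambda>t. t + a) ` {-\<epsilon><..<\<epsilon>}" if "r \<in> {a-\<epsilon><..<a+\<epsilon>}" for r
          by (rule image_eqI[of _ _ "r - a"]) (use that in auto)
        then have "(\<lambda>t. t + a) ` {-\<epsilon><..<\<epsilon>} = {a-\<epsilon><..<a+\<epsilon>}" by auto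
        then show ?thesis by (metis image_image)
      qed
      moreover have "{a-\<epsilon><..<a+\<epsilon>} \<subseteq> {- \<delta> q<..<\<delta> q}" using \<epsilon>_le[OF q(1)] a(1) by auto
      ultimately show ?thesis using kappa_open_image[OF qZ, of "{a-\<epsilon><..<a+\<epsilon>}"] by simp
    qed
    ultimately show ?thesis using a(2) by (intro exI[of _ "\<lambda>t. \<kappa> q (t + a)"]) auto
  qed
  then obtain \<eta> where "\<And>p. p \<in> Z \<Longrightarrow> \<eta> p 0 = p \<and> (\<forall>t. \<bar>t\<bar> < \<epsilon> \<longrightarrow> flow_at (\<eta> p) t) \<and>
    inj_on (\<eta> p) {-\<epsilon><..<\<epsilon>} \<and> openin (top_of_set Z) (\<eta> p ` {-\<epsilon><..<\<epsilon>})" by metis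
  then show ?thesis using that[OF \<epsilon>, of \<eta>] by blast
qed

text \<open>Local flows are chained with step \<open>h\<close>, half of their lifetime,
  \<open>x n\<close> being the position at time \<open>n * h\<close>. With half steps consecutive
  pieces overlap around each junction, and uniqueness makes them agree there.\<close>

lemma forward_flow:
  assumes \<epsilon>: "\<epsilon> > 0" and \<eta>: "\<And>p. p \<in> Z \<Longrightarrow> \<eta> p 0 = p"
    "\<And>p t. p \<in> Z \<Longrightarrow> \<bar>t\<bar> < \<epsilon> \<Longrightarrow> flow_at (\<eta> p) t" and p: "p \<in> Z"
  obtains \<gamma> where "\<gamma> 0 = p" "\<And>t. t > - \<epsilon> \<Longrightarrow> flow_at \<gamma> t"
proof -
  define h where "h = \<epsilon> / 2"
  have h: "h > 0" "\<epsilon> = 2 * h" using \<epsilon> by (auto simp: h_def)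
  define x where "x = rec_nat p (\<lambda>_ y. \<eta> y h)"
  have x: "x 0 = p" "\<And>n. x (Suc n) = \<eta> (x n) h" by (auto simp: x_def)
  have xZ: "x n \<in> Z" for n
    by (induction n) (use p x flow_at_Z[OF \<eta>(2)] h in auto)
  have step: "\<eta> (x n) (s + h) = \<eta> (x (Suc n)) s" if s: "s \<in> {-h<..<h}" for n s
  proof (rule flow_unique[of "{-h<..<h}" 0 s "\<lambda>s. \<eta> (x n) (s + h)" "\<eta> (x (Suc n))"])
    fix t assume t: "t \<in> {-h<..<h}"
    show "flow_at (\<lambda>s. \<eta> (x n) (s + h)) t" by (rule flow_at_shift, rule \<eta>(2)[OF xZ]) (use t h in auto)
    show "flow_at (\<eta> (x (Suc n))) t" by (rule \<eta>(2)[OF xZ]) (use t h in auto)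
  next
    show "\<eta> (x n) (0 + h) = \<eta> (x (Suc n)) 0" using \<eta>(1)[OF xZ[of "Suc n"]] x(2)[of n] by simp
  qed (use s h in auto)
  \<comment> \<open>\<open>nat\<close> sends negative times to piece 0, so the curve also exists for
    a short time before 0.\<close>
  define N where "N = (\<lambda>t. nat \<lfloor>t / h\<rfloor>)"
  define \<gamma> where "\<gamma> = (\<lambda>t. \<eta> (x (N t)) (t - h * N t))"
  have N: "N s = m" if "real m * h \<le> s" "s < (real m + 1) * h" for s m
  proof -
    have "\<lfloor>s / h\<rfloor> = int m" using that h by (simp add: floor_eq_iff field_simps)
    then show ?thesis by (simp add: N_def)
  qed
  have N0: "N s = 0" if "s < h" for s
  proof -
    have "s / h < 1" using that h by simp
    then have "\<lfloor>s / h\<rfloor> \<le> 0" by linarith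
    then show ?thesis by (simp add: N_def)
  qed
  have "flow_at \<gamma> t" if t: "t > - \<epsilon>" for t
  proof (cases "t < h")
    case True
    have "\<forall>\<^sub>F s in nhds t. s \<in> {..<h}" using True by (intro eventually_nhds_in_open) auto
    then have "\<forall>\<^sub>F s in nhds t. \<gamma> s = \<eta> p s" by eventually_elim (simp add: \<gamma>_def N0 x)
    moreover have "flow_at (\<eta> p) t" by (rule \<eta>(2)[OF p]) (use t True h in auto)
    ultimately show ?thesis using flow_at_cong by blast
  next
    case False
    define m where "m = N t"
    have m: "real m * h \<le> t" "t < (real m + 1) * h"
    proof -
      have "0 \<le> \<lfloor>t / h\<rfloor>" using False h by simp
      then have e: "real m = of_int \<lfloor>t / h\<rfloor>" by (simp add: m_def N_def)
      have "of_int \<lfloor>t / h\<rfloor> \<le> t / h" "t / h < of_int \<lfloor>t / h\<rfloor> + 1" by linarith+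
      then show "real m * h \<le> t" "t < (real m + 1) * h" unfolding e
        using h by (simp_all only: pos_le_divide_eq pos_divide_less_eq)
    qed
    have "m \<noteq> 0" using m(2) False by (cases m) auto
    then obtain k where k: "m = Suc k" using not0_implies_Suc by blast
    \<comment> \<open>Piece \<open>m\<close> is valid one step before its starting time too, where
      \<open>step\<close> identifies it with piece \<open>k\<close>. This gives a full neighbourhood
      of \<open>t\<close> even when \<open>t\<close> is a junction.\<close>
    have "\<gamma> s = \<eta> (x m) (s + - (real m * h))" if s: "s \<in> {real k * h<..<(real m + 1) * h}" for s
    proof (cases "s < real m * h")
      case True
      have "N s = k" by (rule N) (use s True k in \<open>auto simp: add.commute\<close>)
      then have "\<gamma> s = \<eta> (x k) ((s + - (real m * h)) + h)" by (simp add: \<gamma>_def k algebra_simps)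
      also have "\<dots> = \<eta> (x m) (s + - (real m * h))" unfolding k
        by (rule step) (use s True h in \<open>auto simp: k algebra_simps\<close>)
      finally show ?thesis .
    next
      case False
      have "N s = m" by (rule N) (use s False in auto)
      then show ?thesis by (simp add: \<gamma>_def algebra_simps)
    qed
    moreover have "\<forall>\<^sub>F s in nhds t. s \<in> {real k * h<..<(real m + 1) * h}"
    proof (rule eventually_nhds_in_open)
      show "t \<in> {real k * h<..<(real m + 1) * h}" using m h by (auto simp: k algebra_simps)
    qed auto
    ultimately have ev: "\<forall>\<^sub>F s in nhds t. \<gamma> s = \<eta> (x m) (s + - (real m * h))"
      by (auto elim: eventually_mono)
    have "flow_at (\<lambda>s. \<eta> (x m) (s + - (real m * h))) t"
      by (rule flow_at_shift, rule \<eta>(2)[OF xZ]) (use m h in \<open>auto simp: algebra_simps\<close>)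
    then show ?thesis using flow_at_cong ev by blast
  qed
  moreover have "\<gamma> 0 = p" using N0[OF h(1)] by (simp add: \<gamma>_def x \<eta>(1)[OF p])
  ultimately show ?thesis using that by blast
qed

text \<open>By pigeonhole one chart is visited at arbitrarily late integer times. A chart consists
  of a single orbit segment, so the point reached at a late visit was already passed close to the
  time of an earlier visit.\<close>

lemma recurrence:
  assumes fl: "\<And>t. t > 0 \<Longrightarrow> flow_at \<gamma> t"
  obtains t1 t2 where "0 < t1" "t1 < t2" "\<gamma> t1 = \<gamma> t2"
proof -
  obtain F where F: "finite F" "F \<subseteq> Z" "Z \<subseteq> (\<Union>q\<in>F. W q)"
    using finite_subcover[of W] W_open W_base by blast
  have "\<exists>q. q \<in> F \<and> \<gamma> (real (Suc n)) \<in> W q" for n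
    using flow_at_Z[OF fl[of "real (Suc n)"]] F(3) by auto
  then obtain f where f: "\<And>n. f n \<in> F" "\<And>n. \<gamma> (real (Suc n)) \<in> W (f n)" by metis
  have "finite (f ` UNIV)" using f(1) F(1) finite_subset[of "range f" F] by blast
  then obtain n0 where inf: "infinite {n \<in> UNIV. f n = f n0}"
    using pigeonhole_infinite[of "UNIV :: nat set" f] by auto
  define q where "q = f n0"
  have q: "q \<in> Z" using f(1) F(2) by (auto simp: q_def)
  have unb: "\<exists>n. r < real n \<and> \<gamma> (real (Suc n)) \<in> W q" for r
  proof -
    obtain k :: nat where k: "r < real k" using reals_Archimedean2 by blast
    obtain n where "n > k" "f n = q" using inf unfolding infinite_nat_iff_unbounded q_def by blast
    then show ?thesis using f(2)[of n] k by (intro exI[of _ n]) auto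
  qed
  \<comment> \<open>Two chart parameters differ by less than \<open>2 * \<delta> q\<close>. The
    bound on \<open>n\<close> keeps the compared time window positive, and the bound on
    \<open>m\<close> places the second visit after this window, so the two times differ.\<close>
  obtain n where n: "2 * \<delta> q < real n" "\<gamma> (real (Suc n)) \<in> W q" using unb by blast
  obtain m where m: "real n + 2 * \<delta> q < real m" "\<gamma> (real (Suc m)) \<in> W q" using unb by blast
  define a b where "a = \<tau> q (\<gamma> (real (Suc n)))" and "b = \<tau> q (\<gamma> (real (Suc m)))"
  have ab: "\<bar>a\<bar> < \<delta> q" "\<bar>b\<bar> < \<delta> q" "\<kappa> q a = \<gamma> (real (Suc n))" "\<kappa> q b = \<gamma> (real (Suc m))"
    using n m tau_bound[OF q] kappa_tau[OF q] by (auto simp: a_def b_def)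
  have "\<gamma> (b + (real (Suc n) - a)) = \<kappa> q b"
  proof (rule flow_unique[of "{-\<delta> q<..<\<delta> q}" a b "\<lambda>s. \<gamma> (s + (real (Suc n) - a))" "\<kappa> q"])
    fix t assume t: "t \<in> {-\<delta> q<..<\<delta> q}"
    show "flow_at (\<lambda>s. \<gamma> (s + (real (Suc n) - a))) t"
      by (rule flow_at_shift, rule fl) (use t n ab in auto)
    show "flow_at (\<kappa> q) t" by (rule flow_at_kappa[OF q]) (use t in auto)
  qed (use ab in auto)
  then have "\<gamma> (b + (real (Suc n) - a)) = \<gamma> (real (Suc m))" using ab by simp
  moreover have "0 < b + (real (Suc n) - a)" "b + (real (Suc n) - a) < real (Suc m)"
    using ab n m by auto
  ultimately show ?thesis using that by blast
qed

text \<open>Uniqueness turns one recurrence into a period \<open>P\<close> valid for all times above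
  -\<epsilon>. The curve is then extended to the whole line by adding enough periods to the
  time.\<close>

lemma periodic_flow:
  assumes p: "p \<in> Z"
  obtains \<gamma> P where "P > 0" "\<gamma> 0 = p" "\<And>t. flow_at \<gamma> t" "\<And>t. \<gamma> (t + P) = \<gamma> t"
proof -
  obtain \<epsilon> \<eta> where \<epsilon>: "\<epsilon> > 0" and \<eta>: "\<And>p. p \<in> Z \<Longrightarrow> \<eta> p 0 = p"
    "\<And>p t. p \<in> Z \<Longrightarrow> \<bar>t\<bar> < \<epsilon> \<Longrightarrow> flow_at (\<eta> p) t"
    using uniform_local_flow by metis
  obtain \<gamma> where \<gamma>: "\<gamma> 0 = p" "\<And>t. t > - \<epsilon> \<Longrightarrow> flow_at \<gamma> t"
    using forward_flow[OF \<epsilon> \<eta> p] by metis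
  obtain t1 t2 where t12: "0 < t1" "t1 < t2" "\<gamma> t1 = \<gamma> t2"
    using recurrence[of \<gamma>] \<gamma>(2) \<epsilon> by (metis less_trans neg_less_0_iff_less)
  define P where "P = t2 - t1"
  have P: "P > 0" using t12 by (simp add: P_def)
  have per1: "\<gamma> (s + P) = \<gamma> s" if "s > - \<epsilon>" for s
  proof (rule flow_unique[of "{-\<epsilon><..}" t1 s "\<lambda>s. \<gamma> (s + P)" \<gamma>])
    fix t assume t: "t \<in> {-\<epsilon><..}"
    show "flow_at (\<lambda>s. \<gamma> (s + P)) t" by (rule flow_at_shift, rule \<gamma>(2)) (use t P in auto)
    show "flow_at \<gamma> t" using \<gamma>(2) t by auto
  qed (use t12 \<epsilon> that in \<open>auto simp: P_def\<close>)
  have per: "\<gamma> (s + real n * P) = \<gamma> s" if "s > - \<epsilon>" for s n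
  proof (induction n)
    case (Suc n)
    have "s + real n * P > - \<epsilon>" using that P by (smt (verit) mult_nonneg_nonneg of_nat_0_le_iff)
    then show ?case using per1[of "s + real n * P"] Suc by (simp add: algebra_simps)
  qed simp
  define k where "k = (\<lambda>t. nat \<lceil>- t / P\<rceil>)"
  have k: "t + real (k t) * P \<ge> 0" for t
  proof -
    have "- t / P \<le> real (k t)" unfolding k_def by linarith
    then show ?thesis using P by (simp add: field_simps)
  qed
  define \<beta> where "\<beta> = (\<lambda>t. \<gamma> (t + real (k t) * P))"
  \<comment> \<open>Any number of periods gives the same value as soon as it brings the time above
    -\<epsilon>; hence near a given time one fixed \<open>n\<close> can be used, although
    \<open>k\<close> jumps.\<close>
  have \<beta>: "\<beta> t = \<gamma> (t + real n * P)" if n: "t + real n * P > - \<epsilon>" for t n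
  proof (cases "n \<ge> k t")
    case True
    then show ?thesis using per[of "t + real (k t) * P" "n - k t"] k[of t] \<epsilon>
      by (simp add: \<beta>_def of_nat_diff algebra_simps)
  next
    case False
    then show ?thesis using per[OF n, of "k t - n"]
      by (simp add: \<beta>_def of_nat_diff algebra_simps)
  qed
  have "flow_at \<beta> t" for t
  proof -
    obtain n :: nat where n: "(1 - t) / P < real n" using reals_Archimedean2 by blast
    then have nt: "t + real n * P > 1" using P by (simp add: field_simps)
    have "\<forall>\<^sub>F s in nhds t. s \<in> {- \<epsilon> - real n * P<..}"
      by (rule eventually_nhds_in_open) (use nt \<epsilon> in auto)
    then have "\<forall>\<^sub>F s in nhds t. \<beta> s = \<gamma> (s + real n * P)"
      by eventually_elim (rule \<beta>, auto)
    moreover have "flow_at (\<lambda>s. \<gamma> (s + real n * P)) t"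
      by (rule flow_at_shift, rule \<gamma>(2)) (use nt \<epsilon> in auto)
    ultimately show ?thesis using flow_at_cong by blast
  qed
  moreover have "\<beta> (t + P) = \<beta> t" for t
  proof -
    have "t + P + real (k t) * P > - \<epsilon>" using k[of t] P \<epsilon> by linarith
    from \<beta>[OF this] have "\<beta> (t + P) = \<gamma> (t + real (Suc (k t)) * P)" by (simp add: algebra_simps)
    also have "\<dots> = \<beta> t" by (rule \<beta>[symmetric]) (use k[of t] P \<epsilon> in \<open>simp add: algebra_simps\<close>)
    finally show ?thesis .
  qed
  moreover have "\<beta> 0 = p" using \<beta>[of 0 0] \<epsilon> \<gamma>(1) by simp
  ultimately show ?thesis using that P by blast
qed

lemma flow_range_eq:
  assumes "\<And>t. flow_at \<alpha> t" "\<And>t. flow_at \<beta> t" "\<alpha> a = \<beta> b"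
  shows "\<beta> (s + b) = \<alpha> (s + a)"
  using flow_unique[of UNIV 0 s "\<lambda>s. \<beta> (s + b)" "\<lambda>s. \<alpha> (s + a)"] flow_at_shift assms by simp

text \<open>The period is replaced by the first return time to \<open>p\<close>. If \<gamma> took
  one value twice in a shorter span, shifting in time by uniqueness would produce an earlier return
  to \<open>p\<close>.\<close>

lemma embedded_circle:
  assumes p: "p \<in> Z"
  obtains \<gamma> P where "P > 0" "\<gamma> 0 = p" "\<And>t. flow_at \<gamma> t" "\<And>t. \<gamma> (t + P) = \<gamma> t" "inj_on \<gamma> {0..<P}"
proof -
  obtain \<epsilon> \<eta> where \<epsilon>: "\<epsilon> > 0" and \<eta>: "\<And>p. p \<in> Z \<Longrightarrow> \<eta> p 0 = p"
    "\<And>p t. p \<in> Z \<Longrightarrow> \<bar>t\<bar> < \<epsilon> \<Longrightarrow> flow_at (\<eta> p) t"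
    "\<And>p. p \<in> Z \<Longrightarrow> inj_on (\<eta> p) {-\<epsilon><..<\<epsilon>}"
    using uniform_local_flow by metis
  obtain \<gamma> P where \<gamma>: "P > 0" "\<gamma> 0 = p" "\<And>t. flow_at \<gamma> t" "\<And>t. \<gamma> (t + P) = \<gamma> t"
    using periodic_flow[OF p] by metis
  have per: "\<gamma> (real n * P) = \<gamma> 0" for n
  proof (induction n)
    case (Suc n)
    then show ?case using \<gamma>(4)[of "real n * P"] by (simp add: algebra_simps)
  qed simp
  have loc: "\<gamma> r = \<eta> p r" if "\<bar>r\<bar> < \<epsilon>" for r
    by (rule flow_unique[of "{-\<epsilon><..<\<epsilon>}" 0 r]) (use that \<epsilon> \<gamma> \<eta>(1,2)[OF p] in auto)
  \<comment> \<open>Return times below \<epsilon> are excluded by injectivity of the local flow.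
    Starting \<open>S\<close> at \<epsilon> keeps it closed and its infimum positive.\<close>
  define S where "S = {\<epsilon>..} \<inter> \<gamma> -` {p}"
  have cont: "continuous_on UNIV \<gamma>" using isCont_flow[OF \<gamma>(3)] continuous_at_imp_continuous_on by blast
  have "closed S" unfolding S_def
    by (intro closed_Int closed_vimage cont) auto
  moreover have "S \<noteq> {}"
  proof -
    obtain n :: nat where "\<epsilon> / P < real n" using reals_Archimedean2 by blast
    then have "real n * P \<in> S" using \<gamma>(1,2) per by (simp add: S_def field_simps)
    then show ?thesis by blast
  qed
  moreover have bdd: "bdd_below S" by (rule bdd_belowI[of _ \<epsilon>]) (simp add: S_def)
  ultimately have InfS: "Inf S \<in> S" using closed_contains_Inf by blast
  have first: "\<gamma> r \<noteq> p" if r: "0 < r" "r < Inf S" for r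
  proof
    assume eq: "\<gamma> r = p"
    show False
    proof (cases "r < \<epsilon>")
      case True
      then have "\<eta> p r = \<eta> p 0" using loc[of r] r eq \<eta>(1)[OF p] by simp
      then show False using inj_onD[OF \<eta>(3)[OF p], of r 0] True r by auto
    next
      case False
      then have "r \<in> S" using eq by (simp add: S_def)
      then show False using cInf_lower[OF _ bdd] r by fastforce
    qed
  qed
  have "\<gamma> (t + Inf S) = \<gamma> t" for t
    using flow_range_eq[OF \<gamma>(3) \<gamma>(3), of 0 "Inf S" t] InfS \<gamma>(2) by (simp add: S_def)
  moreover have "inj_on \<gamma> {0..<Inf S}"
  proof (rule linorder_inj_onI)
    fix a b assume ab: "a < b" "a \<in> {0..<Inf S}" "b \<in> {0..<Inf S}"
    show "\<gamma> a \<noteq> \<gamma> b"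
    proof
      assume "\<gamma> a = \<gamma> b"
      from flow_range_eq[OF \<gamma>(3) \<gamma>(3) this, of "- a"] have "\<gamma> (b - a) = p" using \<gamma>(2) by simp
      then show False using first[of "b - a"] ab by auto
    qed
  qed auto
  moreover have "Inf S > 0" using InfS \<epsilon> by (simp add: S_def)
  ultimately show ?thesis using that \<gamma> by blast
qed

text \<open>With each point an orbit contains the whole local flow through it, which is open in
  \<open>Z\<close>.\<close>

lemma open_orbit:
  assumes fl: "\<And>t. flow_at \<gamma> t"
  shows "openin (top_of_set Z) (range \<gamma>)"
proof -
  obtain \<epsilon> \<eta> where \<epsilon>: "\<epsilon> > 0" and \<eta>: "\<And>p. p \<in> Z \<Longrightarrow> \<eta> p 0 = p"
    "\<And>p t. p \<in> Z \<Longrightarrow> \<bar>t\<bar> < \<epsilon> \<Longrightarrow> flow_at (\<eta> p) t"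
    "\<And>p. p \<in> Z \<Longrightarrow> openin (top_of_set Z) (\<eta> p ` {-\<epsilon><..<\<epsilon>})"
    using uniform_local_flow by metis
  show ?thesis
  proof (subst openin_subopen, intro ballI)
    fix x assume "x \<in> range \<gamma>"
    then obtain t where t: "x = \<gamma> t" by auto
    have x: "x \<in> Z" using flow_at_Z[OF fl] t by simp
    have "\<eta> x s = \<gamma> (s + t)" if "s \<in> {-\<epsilon><..<\<epsilon>}" for s
      by (rule flow_unique[of "{-\<epsilon><..<\<epsilon>}" 0 s "\<eta> x" "\<lambda>s. \<gamma> (s + t)"])
        (use \<epsilon> that \<eta>(1,2)[OF x] t flow_at_shift fl in auto)
    then have "\<eta> x ` {-\<epsilon><..<\<epsilon>} \<subseteq> range \<gamma>" by auto
    moreover have "x \<in> \<eta> x ` {-\<epsilon><..<\<epsilon>}" using \<eta>(1)[OF x] \<epsilon> by (intro image_eqI[of _ _ 0]) auto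
    ultimately show "\<exists>T. openin (top_of_set Z) T \<and> x \<in> T \<and> T \<subseteq> range \<gamma>" using \<eta>(3)[OF x] by blast
  qed
qed

text \<open>Orbits are open, and by \<open>flow_range_eq\<close> two that meet coincide; compactness
  leaves finitely many.\<close>

theorem finite_union_of_circles:
  obtains n :: nat and C :: "nat \<Rightarrow> 'a set" where "disjoint_family_on C {..<n}" "Z = (\<Union>i<n. C i)"
    "\<And>i. i < n \<Longrightarrow> \<exists>\<gamma> P. P > 0 \<and> range \<gamma> = C i \<and> (\<forall>t. flow_at \<gamma> t) \<and> (\<forall>t. \<gamma> (t + P) = \<gamma> t) \<and> inj_on \<gamma> {0..<P}"
proof -
  have "\<exists>\<gamma>. (\<exists>P>0. \<gamma> 0 = p \<and> (\<forall>t. flow_at \<gamma> t) \<and> (\<forall>t. \<gamma> (t + P) = \<gamma> t) \<and> inj_on \<gamma> {0..<P})" if "p \<in> Z" for p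
    using embedded_circle[OF that] by metis
  then obtain \<Gamma> where \<Gamma>: "\<And>p. p \<in> Z \<Longrightarrow> \<exists>P>0. \<Gamma> p 0 = p \<and> (\<forall>t. flow_at (\<Gamma> p) t) \<and> (\<forall>t. \<Gamma> p (t + P) = \<Gamma> p t) \<and> inj_on (\<Gamma> p) {0..<P}"
    by metis
  then have fl: "flow_at (\<Gamma> p) t" if "p \<in> Z" for p t using that by blast
  have "openin (top_of_set Z) (range (\<Gamma> p)) \<and> p \<in> range (\<Gamma> p)" if "p \<in> Z" for p
    using open_orbit[OF fl[OF that]] \<Gamma>[OF that] by (metis rangeI)
  then obtain F where F: "finite F" "F \<subseteq> Z" "Z \<subseteq> (\<Union>p\<in>F. range (\<Gamma> p))"
    using finite_subcover[of "\<lambda>p. range (\<Gamma> p)"] by blast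
  \<comment> \<open>The orbits are collected as a set before being numbered, so base points on the
    same orbit yield one circle.\<close>
  let ?O = "(\<lambda>p. range (\<Gamma> p)) ` F"
  obtain C where C: "bij_betw C {..<card ?O} ?O"
    using ex_bij_betw_nat_finite[of ?O] F(1) by (auto simp: atLeast0LessThan)
  have eq: "range (\<Gamma> p) = range (\<Gamma> q)" if "p \<in> Z" "q \<in> Z" "range (\<Gamma> p) \<inter> range (\<Gamma> q) \<noteq> {}" for p q
  proof -
    obtain a b where ab: "\<Gamma> p a = \<Gamma> q b" using \<open>range (\<Gamma> p) \<inter> range (\<Gamma> q) \<noteq> {}\<close> by auto
    have e: "\<Gamma> q (s + b) = \<Gamma> p (s + a)" for s by (rule flow_range_eq[OF fl[OF that(1)] fl[OF that(2)] ab])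
    have "\<Gamma> q t \<in> range (\<Gamma> p)" "\<Gamma> p t \<in> range (\<Gamma> q)" for t
      using e[of "t - b"] e[of "t - a"] by (metis diff_add_cancel rangeI)+
    then show ?thesis by blast
  qed
  show ?thesis
  proof
    show "disjoint_family_on C {..<card ?O}"
      unfolding disjoint_family_on_def
    proof (intro ballI impI)
      fix i j assume ij: "i \<in> {..<card ?O}" "j \<in> {..<card ?O}" "i \<noteq> j"
      then have ne: "C i \<noteq> C j" using bij_betw_imp_inj_on[OF C] by (meson inj_onD)
      have "C i \<in> ?O" "C j \<in> ?O" using bij_betwE[OF C] ij by auto
      then obtain p q where "p \<in> F" "C i = range (\<Gamma> p)" "q \<in> F" "C j = range (\<Gamma> q)" by auto
      then show "C i \<inter> C j = {}" using eq[of p q] ne F(2) by auto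
    qed
    have "(\<Union>i<card ?O. C i) = (\<Union>p\<in>F. range (\<Gamma> p))"
      using bij_betw_imp_surj_on[OF C] by simp
    moreover have "range (\<Gamma> p) \<subseteq> Z" if "p \<in> F" for p using flow_at_Z[OF fl] that F(2) by auto
    ultimately show "Z = (\<Union>i<card ?O. C i)" using F(3) by auto
  next
    fix i assume "i < card ?O"
    then have "C i \<in> ?O" using bij_betwE[OF C] by auto
    then obtain p where p: "p \<in> F" "C i = range (\<Gamma> p)" by auto
    then obtain P where "P > 0" "\<forall>t. flow_at (\<Gamma> p) t" "\<forall>t. \<Gamma> p (t + P) = \<Gamma> p t" "inj_on (\<Gamma> p) {0..<P}"
      using \<Gamma>[of p] F(2) by auto
    then show "\<exists>\<gamma> P. P > 0 \<and> range \<gamma> = C i \<and> (\<forall>t. flow_at \<gamma> t) \<and> (\<forall>t. \<gamma> (t + P) = \<gamma> t) \<and> inj_on \<gamma> {0..<P}"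
      using p(2) by (intro exI[of _ "\<Gamma> p"] exI[of _ P]) simp
  qed
qed

end

section \<open>Hamiltonian vector fields on a surface\<close>

text \<open>Reparametrization of the separable equation \<open>\<sigma>' = a \<circ> \<sigma>\<close>: the time function is
  an antiderivative of \<open>1/a\<close>.\<close>

lemma separable_ode:
  fixes a :: "real \<Rightarrow> real"
  assumes d: "d > 0" and cont: "continuous_on {-d..d} a" and pos: "\<And>s. \<bar>s\<bar> \<le> d \<Longrightarrow> a s > 0"
  obtains T \<sigma> \<delta> where "\<delta> > 0" "T 0 = 0"
    "\<And>s. \<bar>s\<bar> < d \<Longrightarrow> (T has_real_derivative 1 / a s) (at s)"
    "\<And>s. \<bar>s\<bar> < d \<Longrightarrow> \<sigma> (T s) = s"
    "\<And>t. \<bar>t\<bar> < \<delta> \<Longrightarrow> \<bar>\<sigma> t\<bar> < d \<and> T (\<sigma> t) = t \<and> (\<sigma> has_real_derivative a (\<sigma> t)) (at t)"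
proof -
  \<comment> \<open>The antiderivative is taken from the left end and normalized afterwards, so
    negative \<open>s\<close> needs no oriented integral.\<close>
  define T where "T = (\<lambda>s. integral {-d..s} (\<lambda>s. 1 / a s) - integral {-d..0} (\<lambda>s. 1 / a s))"
  have c: "continuous_on {-d..d} (\<lambda>s. 1 / a s)"
    by (intro continuous_intros cont ballI less_imp_neq[symmetric] pos) auto
  have T0: "T 0 = 0" by (simp add: T_def)
  have dT: "(T has_real_derivative 1 / a s) (at s)" if s: "\<bar>s\<bar> < d" for s
  proof -
    have "((\<lambda>x. integral {-d..x} (\<lambda>s. 1 / a s)) has_real_derivative 1 / a s) (at s within {-d..d})"
      by (rule integral_has_real_derivative[OF c]) (use s in auto)
    moreover have "at s within {-d..d} = at s" using s by (intro at_within_interior) auto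
    ultimately show ?thesis unfolding T_def by (auto intro!: derivative_eq_intros)
  qed
  have mono: "T s < T s'" if "s < s'" "\<bar>s\<bar> < d" "\<bar>s'\<bar> < d" for s s'
  proof (rule DERIV_pos_imp_increasing[OF that(1)])
    fix x assume "s \<le> x" "x \<le> s'"
    then have x: "\<bar>x\<bar> < d" using that by auto
    show "\<exists>y. (T has_real_derivative y) (at x) \<and> 0 < y"
      by (rule exI[of _ "1 / a x"]) (use dT[OF x] pos[of x] x in auto)
  qed
  have inj: "inj_on T {-d<..<d}"
    by (rule linorder_inj_onI) (use mono in \<open>fastforce simp: abs_less_iff\<close>)+
  define \<sigma> where "\<sigma> = inv_into {-d<..<d} T"
  have \<sigma>T: "\<sigma> (T s) = s" if "\<bar>s\<bar> < d" for s
    unfolding \<sigma>_def by (rule inv_into_f_f[OF inj]) (use that in auto)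
  \<comment> \<open>By the intermediate value theorem all times below \<delta> in modulus are
    attained on the closed half-size interval, inside the open interval where \<open>T\<close> is
    known to be differentiable.\<close>
  define \<delta> where "\<delta> = min (T (d / 2)) (- T (- d / 2))"
  have \<delta>: "\<delta> > 0" using mono[of 0 "d / 2"] mono[of "- d / 2" 0] d T0 by (auto simp: \<delta>_def)
  have T\<sigma>: "\<bar>\<sigma> t\<bar> < d \<and> T (\<sigma> t) = t" if t: "\<bar>t\<bar> < \<delta>" for t
  proof -
    have "continuous_on {-d/2..d/2} T"
    proof (intro continuous_at_imp_continuous_on ballI)
      fix x assume "x \<in> {-d/2..d/2}"
      then have "\<bar>x\<bar> < d" using d by (auto simp: abs_less_iff field_simps)
      then show "isCont T x" using dT DERIV_isCont by blast
    qed
    moreover have "T (-d/2) \<le> t" "t \<le> T (d/2)" "-d/2 \<le> d/2" using t d by (auto simp: \<delta>_def)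
    ultimately obtain s where s: "-d/2 \<le> s" "s \<le> d/2" "T s = t"
      using IVT'[of T "-d/2" t "d/2"] by blast
    then have "\<bar>s\<bar> < d" using d by auto
    then show ?thesis using \<sigma>T[of s] s(3) by auto
  qed
  have "(\<sigma> has_real_derivative a (\<sigma> t)) (at t)" if t: "\<bar>t\<bar> < \<delta>" for t
  proof -
    let ?s = "\<sigma> t"
    have s: "\<bar>?s\<bar> < d" "T ?s = t" using T\<sigma>[OF t] by auto
    \<comment> \<open>Half the distance to the boundary: the closed neighbourhood of this radius
      stays in the domain, as continuity of the inverse function requires.\<close>
    define e where "e = (d - \<bar>?s\<bar>) / 2"
    have e: "e > 0" using s(1) by (simp add: e_def)
    have e_less: "\<bar>z\<bar> < d" if "\<bar>z - ?s\<bar> \<le> e" for z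
    proof -
      have "\<bar>z\<bar> \<le> \<bar>z - ?s\<bar> + \<bar>?s\<bar>" using abs_triangle_ineq[of "z - ?s" ?s] by simp
      also have "\<dots> \<le> (d - \<bar>?s\<bar>) / 2 + \<bar>?s\<bar>" using that by (simp add: e_def)
      also have "\<dots> < d" using s(1) by (simp add: field_simps)
      finally show ?thesis .
    qed
    have "isCont \<sigma> (T ?s)"
      by (rule isCont_inverse_function[OF e]) (use \<sigma>T dT DERIV_isCont e_less in blast)+
    then have "(\<sigma> has_real_derivative inverse (1 / a ?s)) (at t)"
      by (intro DERIV_inverse_function[where f=T and g=\<sigma> and x=t and a="-\<delta>" and b=\<delta>])
        (use dT[OF s(1)] pos[of ?s] s t T\<sigma> in auto)
    then show ?thesis by simp
  qed
  then show ?thesis using that[of \<delta> T \<sigma>] \<delta> T0 dT \<sigma>T T\<sigma> by blast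
qed

lemma has_derivative_grad:
  fixes G :: "real^2 \<Rightarrow> real"
  assumes "(G has_derivative D) (at x)"
  shows "D v = (\<chi> i. D (axis i 1)) \<bullet> v"
  using frechet_derivative_coords[OF assms, of v] by (simp add: inner_vec_def sum_2 mult.commute)

locale poisson_surface =
  fixes M :: "'a::t2_space set" and A :: "'a chart set" and \<pi>\<^sub>0 :: "'a bivector"
  assumes atlas: "smooth_atlas M A" and compact_M: "compact M"
    and \<pi>0: "\<pi>\<^sub>0 \<in> bivector_fields A" and \<pi>0_nz: "nowhere_vanishing A \<pi>\<^sub>0"
begin

lemma chart: "c \<in> A \<Longrightarrow> chart_on M c"
  using atlas by (auto simp: smooth_atlas_def)

lemma chart_openin: "c \<in> A \<Longrightarrow> openin (top_of_set M) (fst c)"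
  and open_chart_image: "c \<in> A \<Longrightarrow> open (snd c ` fst c)"
  using chart by (auto simp: chart_on_def)

lemma chart_subset: "c \<in> A \<Longrightarrow> fst c \<subseteq> M"
  using chart_openin openin_imp_subset by blast

lemma in_some_chart: "p \<in> M \<Longrightarrow> \<exists>c\<in>A. p \<in> fst c"
  using atlas by (auto simp: smooth_atlas_def)

lemma chart_homeomorphism:
  assumes "c \<in> A"
  shows "homeomorphism (fst c) (snd c ` fst c) (snd c) (chart_inv c)"
proof -
  obtain \<psi> where \<psi>: "homeomorphism (fst c) (snd c ` fst c) (snd c) \<psi>"
    using chart[OF assms] by (auto simp: chart_on_def)
  have inj: "inj_on (snd c) (fst c)"
    using homeomorphism_apply1[OF \<psi>] by (metis inj_onI)
  have "\<psi> y = chart_inv c y" if "y \<in> snd c ` fst c" for y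
    using that homeomorphism_apply1[OF \<psi>] inv_into_f_f[OF inj] by (auto simp: chart_inv_def)
  then show ?thesis using homeomorphism_cong[OF \<psi> refl refl] by auto
qed

lemma chart_inv_left: "c \<in> A \<Longrightarrow> p \<in> fst c \<Longrightarrow> chart_inv c (snd c p) = p"
  and chart_inv_right: "c \<in> A \<Longrightarrow> y \<in> snd c ` fst c \<Longrightarrow> snd c (chart_inv c y) = y"
  and chart_inv_in: "c \<in> A \<Longrightarrow> y \<in> snd c ` fst c \<Longrightarrow> chart_inv c y \<in> fst c"
  using homeomorphism_apply1[OF chart_homeomorphism] homeomorphism_apply2[OF chart_homeomorphism]
  by (auto simp: chart_inv_def inv_into_into)

lemma continuous_on_chart: "c \<in> A \<Longrightarrow> continuous_on (fst c) (snd c)"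
  and continuous_on_chart_inv: "c \<in> A \<Longrightarrow> continuous_on (snd c ` fst c) (chart_inv c)"
  using homeomorphism_cont1[OF chart_homeomorphism] homeomorphism_cont2[OF chart_homeomorphism] by auto

lemma open_overlap:
  assumes "c \<in> A" "d \<in> A"
  shows "open (snd c ` (fst c \<inter> fst d))"
proof -
  have "openin (top_of_set (fst c)) (fst c \<inter> fst d)"
  proof -
    obtain O' where "open O'" "fst d = M \<inter> O'" using chart_openin[OF assms(2)] unfolding openin_open by auto
    moreover from this have "fst c \<inter> fst d = fst c \<inter> O'" using chart_subset[OF assms(1)] by auto
    ultimately show ?thesis by (metis openin_open_Int)
  qed
  then have "openin (top_of_set (snd c ` fst c)) (snd c ` (fst c \<inter> fst d))"
    by (rule homeomorphism_imp_open_map[OF chart_homeomorphism[OF assms(1)]])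
  then show ?thesis using open_chart_image[OF assms(1)] openin_open_trans by blast
qed

abbreviation J where "J c d p \<equiv> jacobian (transition c d) (at (snd c p))"

lemma transition_has_derivative:
  assumes "c \<in> A" "d \<in> A" "p \<in> fst c" "p \<in> fst d"
  shows "(transition c d has_derivative (*v) (J c d p)) (at (snd c p))"
proof -
  have "smooth_on (snd c ` (fst c \<inter> fst d)) (transition c d)"
    using atlas assms by (auto simp: smooth_atlas_def)
  then have "transition c d differentiable (at (snd c p))"
    using assms smooth_on_has_derivative frechet_derivative_works differentiableI by blast
  then show ?thesis by (simp add: jacobian_works)
qed

lemma transition_apply: "c \<in> A \<Longrightarrow> p \<in> fst c \<Longrightarrow> transition c d (snd c p) = snd d p"
  by (simp add: transition_def chart_inv_left)

lemma has_derivative_change_chart: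
  assumes c: "c \<in> A" "d \<in> A" "p \<in> fst c" "p \<in> fst d"
    and D: "(f \<circ> chart_inv d has_derivative D) (at (snd d p))"
  shows "(f \<circ> chart_inv c has_derivative (\<lambda>v. D (J c d p *v v))) (at (snd c p))"
proof -
  have "(f \<circ> chart_inv d has_derivative D) (at (transition c d (snd c p)))"
    using D transition_apply c by simp
  from has_derivative_compose[OF transition_has_derivative[OF c] this]
  have "((\<lambda>y. (f \<circ> chart_inv d) (transition c d y)) has_derivative (\<lambda>v. D (J c d p *v v))) (at (snd c p))" .
  then show ?thesis
  proof (rule has_derivative_transform_within_open[OF _ open_overlap[OF c(1,2)]])
    fix y assume "y \<in> snd c ` (fst c \<inter> fst d)"
    then show "(f \<circ> chart_inv d) (transition c d y) = (f \<circ> chart_inv c) y"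
      using c by (auto simp: transition_def chart_inv_left)
  qed (use c in auto)
qed

definition grad :: "('a \<Rightarrow> real) \<Rightarrow> 'a chart \<Rightarrow> 'a \<Rightarrow> real^2" where
  "grad f c p = (\<chi> i. frechet_derivative (f \<circ> chart_inv c) (at (snd c p)) (axis i 1))"

text \<open>The vector field g \<mapsto> {g, f} of the bracket given by
  \<open>\<pi>\<^sub>0\<close>, in components.\<close>

definition hamiltonian_field :: "('a \<Rightarrow> real) \<Rightarrow> 'a chart \<Rightarrow> 'a \<Rightarrow> real^2" where
  "hamiltonian_field f c p = \<pi>\<^sub>0 c p *v grad f c p"

lemma smooth_function_has_derivative:
  assumes "smooth_function A f" "c \<in> A" "p \<in> fst c"
  shows "(f \<circ> chart_inv c has_derivative (\<lambda>v. grad f c p \<bullet> v)) (at (snd c p))"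
proof -
  have "(f \<circ> chart_inv c has_derivative frechet_derivative (f \<circ> chart_inv c) (at (snd c p))) (at (snd c p))"
    using assms by (intro smooth_on_has_derivative) (auto simp: smooth_function_def)
  moreover have "frechet_derivative (f \<circ> chart_inv c) (at (snd c p)) = (\<lambda>v. grad f c p \<bullet> v)"
    unfolding grad_def by (rule ext) (rule has_derivative_grad[OF calculation])
  ultimately show ?thesis by simp
qed

lemma grad_change_chart:
  assumes f: "smooth_function A f" and c: "c \<in> A" "d \<in> A" "p \<in> fst c" "p \<in> fst d"
  shows "grad f c p = transpose (J c d p) *v grad f d p"
proof -
  have "(\<lambda>v. grad f c p \<bullet> v) = (\<lambda>v. grad f d p \<bullet> (J c d p *v v))"
    using has_derivative_unique[OF smooth_function_has_derivative[OF f c(1,3)]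
      has_derivative_change_chart[OF c smooth_function_has_derivative[OF f c(2,4)]]] .
  then have "grad f c p \<bullet> v = grad f d p \<bullet> (J c d p *v v)" for v by (rule fun_cong)
  then have "grad f c p \<bullet> v = (transpose (J c d p) *v grad f d p) \<bullet> v" for v
    by (simp only: transpose_matrix_vector dot_lmul_matrix)
  then have "\<forall>v. grad f c p \<bullet> v = (transpose (J c d p) *v grad f d p) \<bullet> v" by blast
  then show ?thesis unfolding vector_eq_rdot .
qed

lemma \<pi>0_change_chart:
  assumes "c \<in> A" "d \<in> A" "p \<in> fst c" "p \<in> fst d"
  shows "\<pi>\<^sub>0 d p = J c d p ** \<pi>\<^sub>0 c p ** transpose (J c d p)"
  using \<pi>0 assms unfolding bivector_fields_def by blast

text \<open>The bivector contributes the Jacobian on the left and its transpose on the right; the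
  transpose turns the gradient in \<open>d\<close> into the one in \<open>c\<close>, and the
  Jacobian remains.\<close>

lemma hamiltonian_field_change_chart:
  assumes f: "smooth_function A f" and c: "c \<in> A" "d \<in> A" "p \<in> fst c" "p \<in> fst d"
  shows "hamiltonian_field f d p = J c d p *v hamiltonian_field f c p"
  unfolding hamiltonian_field_def \<pi>0_change_chart[OF c] grad_change_chart[OF f c]
  by (simp only: matrix_vector_mul_assoc matrix_mul_assoc)

lemma \<pi>0_form:
  assumes "c \<in> A" "p \<in> fst c"
  obtains r where "r \<noteq> 0" "\<pi>\<^sub>0 c p $ 1 $ 1 = 0" "\<pi>\<^sub>0 c p $ 2 $ 2 = 0" "\<pi>\<^sub>0 c p $ 1 $ 2 = r" "\<pi>\<^sub>0 c p $ 2 $ 1 = - r"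
proof -
  have sk0: "transpose (\<pi>\<^sub>0 c p) = - \<pi>\<^sub>0 c p" using \<pi>0 assms unfolding bivector_fields_def by blast
  have sk: "\<pi>\<^sub>0 c p $ j $ i = - \<pi>\<^sub>0 c p $ i $ j" for i j
    using arg_cong[OF sk0, of "\<lambda>X. X $ i $ j"] by (simp add: transpose_def)
  have nz: "\<pi>\<^sub>0 c p \<noteq> 0" using \<pi>0_nz assms by (auto simp: nowhere_vanishing_def)
  have "\<pi>\<^sub>0 c p $ 1 $ 1 = 0" "\<pi>\<^sub>0 c p $ 2 $ 2 = 0" "\<pi>\<^sub>0 c p $ 2 $ 1 = - \<pi>\<^sub>0 c p $ 1 $ 2"
    using sk[of 1 1] sk[of 2 2] sk[of 2 1] by auto
  moreover from this have "\<pi>\<^sub>0 c p $ 1 $ 2 \<noteq> 0" using nz by (auto simp: vec_eq_iff forall_2)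
  ultimately show ?thesis using that by blast
qed

text \<open>A nonzero skew 2x2 matrix is a multiple of a right-angle rotation. Tangency,
  non-vanishing and transversality below are all read off from this.\<close>

lemma hamiltonian_field_form:
  assumes "c \<in> A" "p \<in> fst c"
  obtains r where "r \<noteq> 0" "hamiltonian_field f c p $ 1 = r * grad f c p $ 2" "hamiltonian_field f c p $ 2 = - r * grad f c p $ 1"
proof -
  obtain r where "r \<noteq> 0" "\<pi>\<^sub>0 c p $ 1 $ 1 = 0" "\<pi>\<^sub>0 c p $ 2 $ 2 = 0" "\<pi>\<^sub>0 c p $ 1 $ 2 = r" "\<pi>\<^sub>0 c p $ 2 $ 1 = - r"
    using \<pi>0_form[OF assms] .
  then show ?thesis using that[of r] by (simp add: hamiltonian_field_def matrix_vector_mult_def sum_2)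
qed

end

text \<open>In the plane \<open>w\<close> and \<open>g\<close> both lie on the line orthogonal to
  \<open>n\<close>; pairing with \<open>u\<close> fixes the factor.\<close>

lemma parallel_in_plane:
  fixes n w g u :: "real^2"
  assumes "n \<noteq> 0" "n \<bullet> w = 0" "n \<bullet> g = 0" "u \<bullet> g = 1"
  shows "w = (u \<bullet> w) *\<^sub>R g"
proof -
  have nw: "n$1 * w$1 + n$2 * w$2 = 0" and ng: "n$1 * g$1 + n$2 * g$2 = 0" and ug: "u$1 * g$1 + u$2 * g$2 = 1"
    using assms by (auto simp: inner_vec_def sum_2)
  have "n$1 * (w$1 * g$2 - w$2 * g$1) = 0" "n$2 * (w$1 * g$2 - w$2 * g$1) = 0"
    using nw ng by algebra+
  then have "w$1 * g$2 = w$2 * g$1" using assms(1) by (auto simp: vec_eq_iff forall_2)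
  then have "w$1 = (u$1 * w$1 + u$2 * w$2) * g$1" "w$2 = (u$1 * w$1 + u$2 * w$2) * g$2"
    using ug by algebra+
  then show ?thesis by (simp add: vec_eq_iff forall_2 inner_vec_def sum_2)
qed

section \<open>Integral curves and time coordinates on the zero set\<close>

context poisson_surface
begin

lemma hamiltonian_field_tangent: "c \<in> A \<Longrightarrow> p \<in> fst c \<Longrightarrow> grad f c p \<bullet> hamiltonian_field f c p = 0"
  by (rule hamiltonian_field_form[of c p f]) (auto simp: inner_vec_def sum_2)

lemma hamiltonian_field_nonzero: "c \<in> A \<Longrightarrow> p \<in> fst c \<Longrightarrow> grad f c p \<noteq> 0 \<Longrightarrow> hamiltonian_field f c p \<noteq> 0"
  by (rule hamiltonian_field_form[of c p f]) (auto simp: vec_eq_iff forall_2)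

text \<open>The gradient and the field are orthogonal and nonzero, hence a basis of the plane. This
  is hypothesis \<open>tr\<close> of \<open>zero_curve\<close> with the field as
  \<open>u\<close>.\<close>

lemma hamiltonian_field_transversal:
  assumes "c \<in> A" "p \<in> fst c" "grad f c p \<noteq> 0" "grad f c p \<bullet> v = 0" "hamiltonian_field f c p \<bullet> v = 0"
  shows "v = 0"
proof -
  obtain r where r: "r \<noteq> 0" "hamiltonian_field f c p $ 1 = r * grad f c p $ 2" "hamiltonian_field f c p $ 2 = - r * grad f c p $ 1"
    using hamiltonian_field_form[OF assms(1,2)] .
  let ?n = "grad f c p"
  have 1: "?n$1 * v$1 + ?n$2 * v$2 = 0" "r * (?n$2 * v$1 - ?n$1 * v$2) = 0"
    using assms(4,5) r by (auto simp: inner_vec_def sum_2 algebra_simps)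
  have 2: "?n$2 * v$1 - ?n$1 * v$2 = 0" using 1(2) r(1) by simp
  have "((?n$1)^2 + (?n$2)^2) * v$1 = 0" "((?n$1)^2 + (?n$2)^2) * v$2 = 0"
    using 1(1) 2 by algebra+
  moreover have "(?n$1)^2 + (?n$2)^2 \<noteq> 0" using assms(3) by (auto simp: vec_eq_iff forall_2 sum_power2_eq_zero_iff)
  ultimately show ?thesis by (auto simp: vec_eq_iff forall_2)
qed

lemma smooth_on_hamiltonian_field:
  assumes f: "smooth_function A f" and c: "c \<in> A"
  shows "smooth_on (snd c ` fst c) (\<lambda>y. hamiltonian_field f c (chart_inv c y))"
proof -
  let ?U = "snd c ` fst c"
  let ?g = "\<lambda>i y. frechet_derivative (f \<circ> chart_inv c) (at y) (axis i 1)"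
  have U: "open ?U" by (rule open_chart_image[OF c])
  have sf: "smooth_on ?U (f \<circ> chart_inv c)" using f c by (auto simp: smooth_function_def)
  have sp: "smooth_on ?U (\<pi>\<^sub>0 c \<circ> chart_inv c)" using \<pi>0 c unfolding bivector_fields_def by blast
  have "linear (\<lambda>X::real^2^2. column i X)" for i :: 2
    by (rule linearI) (auto simp: column_def vec_eq_iff)
  then have "bounded_linear (\<lambda>X::real^2^2. column i X)" for i :: 2
    using linear_conv_bounded_linear by blast
  from smooth_on_compose_linear[OF U this sp]
  have sc: "smooth_on ?U (\<lambda>y. column i (\<pi>\<^sub>0 c (chart_inv c y)))" for i :: 2 by (simp add: o_def)
  have "smooth_on ?U (\<lambda>y. ?g 1 y *\<^sub>R column 1 (\<pi>\<^sub>0 c (chart_inv c y)) + ?g 2 y *\<^sub>R column 2 (\<pi>\<^sub>0 c (chart_inv c y)))"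
    by (intro smooth_on_add smooth_on_scaleR U sc smooth_on_dirderiv sf)
  then show ?thesis
  proof (rule smooth_on_cong[OF U, rotated])
    fix y assume "y \<in> ?U"
    then show "?g 1 y *\<^sub>R column 1 (\<pi>\<^sub>0 c (chart_inv c y)) + ?g 2 y *\<^sub>R column 2 (\<pi>\<^sub>0 c (chart_inv c y)) = hamiltonian_field f c (chart_inv c y)"
      using chart_inv_right[OF c] by (simp add: hamiltonian_field_def matrix_mult_sum sum_2 grad_def scalar_mult_eq_scaleR)
  qed
qed

definition integral_at :: "('a \<Rightarrow> real) \<Rightarrow> (real \<Rightarrow> 'a) \<Rightarrow> real \<Rightarrow> bool" where
  "integral_at f \<alpha> t \<longleftrightarrow> (\<forall>d\<in>A. \<alpha> t \<in> fst d \<longrightarrow> (snd d \<circ> \<alpha> has_vector_derivative hamiltonian_field f d (\<alpha> t)) (at t))"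

lemma eventually_in_chart:
  assumes "isCont \<alpha> t" "\<forall>\<^sub>F s in nhds t. \<alpha> s \<in> M" "c \<in> A" "\<alpha> t \<in> fst c"
  shows "\<forall>\<^sub>F s in nhds t. \<alpha> s \<in> fst c"
proof -
  obtain O' where O': "open O'" "fst c = M \<inter> O'" using chart_openin[OF assms(3)] unfolding openin_open by auto
  have "\<forall>\<^sub>F s in nhds t. \<alpha> s \<in> O'"
    by (rule isCont_eventually_in[OF assms(1) O'(1)]) (use O' assms in auto)
  with assms(2) show ?thesis by eventually_elim (simp add: O')
qed

text \<open>The field transforms by the Jacobian that the chain rule produces. Continuity keeps
  nearby points in the chart \<open>c\<close>, so the coordinate expressions agree around
  \<open>t\<close>.\<close>

lemma integral_atI:
  assumes f: "smooth_function A f" and cont: "isCont \<alpha> t" "\<forall>\<^sub>F s in nhds t. \<alpha> s \<in> M"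
    and c: "c \<in> A" "\<alpha> t \<in> fst c"
    and der: "(snd c \<circ> \<alpha> has_vector_derivative hamiltonian_field f c (\<alpha> t)) (at t)"
  shows "integral_at f \<alpha> t"
  unfolding integral_at_def
proof (intro ballI impI)
  fix d assume d: "d \<in> A" "\<alpha> t \<in> fst d"
  have "(transition c d has_derivative (*v) (J c d (\<alpha> t))) (at ((snd c \<circ> \<alpha>) t))"
    using transition_has_derivative[OF c(1) d(1) c(2) d(2)] by simp
  from vector_derivative_diff_chain_within[OF der has_derivative_at_withinI[OF this]]
  have "(transition c d \<circ> (snd c \<circ> \<alpha>) has_vector_derivative hamiltonian_field f d (\<alpha> t)) (at t)"
    by (simp add: hamiltonian_field_change_chart[OF f c(1) d(1) c(2) d(2)] o_def)
  moreover obtain S where "open S" "t \<in> S" "\<forall>s\<in>S. \<alpha> s \<in> fst c"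
    using eventually_in_chart[OF cont c] unfolding eventually_nhds by blast
  ultimately show "(snd d \<circ> \<alpha> has_vector_derivative hamiltonian_field f d (\<alpha> t)) (at t)"
    using has_vector_derivative_transform_within_open[of "transition c d \<circ> (snd c \<circ> \<alpha>)" _ t S "snd d \<circ> \<alpha>"]
      transition_apply[OF c(1)] by auto
qed

text \<open>Near \<open>q\<close> the zero set is a curve \<open>g\<close> parametrized along
  \<open>u\<close>, and on it the field equals \<open>a s\<close> times the velocity of
  \<open>g\<close>. Solving \<sigma>' = a(\<sigma>) makes \<open>g \<circ> \<sigma>\<close> an
  integral curve whose inverse is elapsed time. The last conclusion, that this time grows at rate 1
  along every integral curve, is what makes chart changes translations.\<close>

lemma time_chart:
  assumes f: "smooth_function A f" and reg: "\<And>p c. p \<in> M \<Longrightarrow> f p = 0 \<Longrightarrow> c \<in> A \<Longrightarrow> p \<in> fst c \<Longrightarrow> grad f c p \<noteq> 0"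
    and q: "q \<in> M" "f q = 0"
  obtains W \<delta> \<tau> \<kappa> where "openin (top_of_set {p\<in>M. f p = 0}) W" "q \<in> W" "\<delta> > 0"
    "homeomorphism W {-\<delta><..<\<delta>} \<tau> \<kappa>" "\<tau> q = 0"
    "\<And>t. \<bar>t\<bar> < \<delta> \<Longrightarrow> integral_at f \<kappa> t"
    "\<And>\<alpha> t. \<alpha> t \<in> W \<Longrightarrow> integral_at f \<alpha> t \<Longrightarrow> (\<tau> \<circ> \<alpha> has_real_derivative 1) (at t)"
proof -
  obtain c where c: "c \<in> A" "q \<in> fst c" using in_some_chart[OF q(1)] by blast
  let ?U = "snd c ` fst c" and ?Z = "{p\<in>M. f p = 0}"
  define F where "F = f \<circ> chart_inv c"
  define x0 where "x0 = snd c q"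
  \<comment> \<open>Using the field at \<open>q\<close> as direction makes \<open>a 0\<close> the
    squared length of \<open>u\<close>, so \<open>a\<close> is positive near 0.\<close>
  define u where "u = hamiltonian_field f c q"
  define Y where "Y = (\<lambda>y. hamiltonian_field f c (chart_inv c y))"
  have U: "open ?U" by (rule open_chart_image[OF c(1)])
  have sF: "smooth_on ?U F" using f c by (auto simp: smooth_function_def F_def)
  have dF: "(F has_derivative (\<lambda>v. grad f c p \<bullet> v)) (at (snd c p))" if "p \<in> fst c" for p
    unfolding F_def by (rule smooth_function_has_derivative[OF f c(1) that])
  have x0: "x0 \<in> ?U" "F x0 = 0" using c q chart_inv_left by (auto simp: x0_def F_def)
  have gq: "grad f c q \<noteq> 0" using reg[OF q c] .
  have tr: "v = 0" if "frechet_derivative F (at x0) v = 0" "u \<bullet> v = 0" for v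
  proof (rule hamiltonian_field_transversal[OF c gq])
    show "grad f c q \<bullet> v = 0" using that(1) frechet_derivative_at[OF dF[OF c(2)]] by (simp add: x0_def)
    show "hamiltonian_field f c q \<bullet> v = 0" using that(2) by (simp add: u_def)
  qed
  obtain V \<delta>1 g where V: "open V" "x0 \<in> V" "V \<subseteq> ?U" "\<delta>1 > 0"
    and gL: "\<And>x. x \<in> V \<Longrightarrow> F x = 0 \<Longrightarrow> \<bar>u \<bullet> (x - x0)\<bar> < \<delta>1 \<and> g (u \<bullet> (x - x0)) = x"
    and g: "\<And>s. \<bar>s\<bar> < \<delta>1 \<Longrightarrow> g s \<in> V \<and> F (g s) = 0 \<and> u \<bullet> (g s - x0) = s \<and> g differentiable (at s)"
    by (rule zero_curve[OF U sF x0 tr]) blast+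
  define a where "a = (\<lambda>s. u \<bullet> Y (g s))"
  have g0: "g 0 = x0" using gL[OF V(2) x0(2)] by simp
  have contY: "continuous_on ?U Y" unfolding Y_def by (rule smooth_on_continuous[OF smooth_on_hamiltonian_field[OF f c(1)]])
  have contg: "isCont g s" if "\<bar>s\<bar> < \<delta>1" for s using differentiable_imp_continuous_within g[OF that] by auto
  have conta: "isCont a s" if "\<bar>s\<bar> < \<delta>1" for s
  proof -
    have "isCont Y (g s)" using contY g[OF that] V(3) U continuous_on_eq_continuous_at by blast
    then show ?thesis unfolding a_def by (intro continuous_intros isCont_o2[OF contg[OF that]])
  qed
  have "u \<noteq> 0" using hamiltonian_field_nonzero[OF c gq] by (simp add: u_def)
  moreover have "a 0 = u \<bullet> u" by (simp add: a_def g0 Y_def x0_def chart_inv_left[OF c] u_def)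
  ultimately have a0: "a 0 > 0" by simp
  have "\<forall>\<^sub>F s in nhds 0. a s \<in> {0<..}"
    by (rule isCont_eventually_in[OF conta]) (use V(4) a0 in auto)
  then obtain e where e: "e > 0" "\<And>s. \<bar>s\<bar> < e \<Longrightarrow> a s > 0"
    unfolding eventually_nhds_metric by (auto simp: dist_real_def)
  \<comment> \<open>Below both the range of the parametrization and the range where \<open>a\<close>
    is positive; halving puts the closed interval inside both.\<close>
  define d where "d = min \<delta>1 e / 2"
  have d: "d > 0" "d < \<delta>1" "d < e" using e V(4) by (auto simp: d_def)
  have ca: "continuous_on {-d..d} a"
    by (intro continuous_at_imp_continuous_on ballI conta) (use d in auto)
  obtain T \<sigma> \<delta> where \<delta>: "\<delta> > 0" and T0: "T 0 = 0"
    and dT: "\<And>s. \<bar>s\<bar> < d \<Longrightarrow> (T has_real_derivative 1 / a s) (at s)"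
    and \<sigma>T: "\<And>s. \<bar>s\<bar> < d \<Longrightarrow> \<sigma> (T s) = s"
    and \<sigma>: "\<And>t. \<bar>t\<bar> < \<delta> \<Longrightarrow> \<bar>\<sigma> t\<bar> < d \<and> T (\<sigma> t) = t \<and> (\<sigma> has_real_derivative a (\<sigma> t)) (at t)"
  proof (rule separable_ode[OF d(1) ca])
    show "a s > 0" if "\<bar>s\<bar> \<le> d" for s by (rule e(2)) (use that d in auto)
  qed blast
  have contT: "isCont T s" if "s \<in> {-d<..<d}" for s
    by (rule DERIV_isCont[OF dT]) (use that in auto)
  define L where "L = (\<lambda>p. u \<bullet> (snd c p - x0))"
  \<comment> \<open>The bound on \<open>T\<close> trims the neighbourhood so that time maps it onto
    exactly the interval of radius \<delta>.\<close>
  define B where "B = {y \<in> V. \<bar>u \<bullet> (y - x0)\<bar> < d \<and> \<bar>T (u \<bullet> (y - x0))\<bar> < \<delta>}"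
  define W where "W = {p \<in> ?Z. p \<in> fst c \<and> snd c p \<in> B}"
  define \<tau> where "\<tau> = (\<lambda>p. T (L p))"
  define \<kappa> where "\<kappa> = (\<lambda>t. chart_inv c (g (\<sigma> t)))"
  have W: "p \<in> fst c" "snd c p \<in> V" "\<bar>L p\<bar> < d" "\<bar>\<tau> p\<bar> < \<delta>" "g (L p) = snd c p" if "p \<in> W" for p
  proof -
    show p: "p \<in> fst c" "snd c p \<in> V" "\<bar>L p\<bar> < d" "\<bar>\<tau> p\<bar> < \<delta>"
      using that by (auto simp: W_def B_def L_def \<tau>_def)
    have "F (snd c p) = 0" using that p by (simp add: W_def F_def chart_inv_left[OF c(1)])
    then show "g (L p) = snd c p" using gL[OF p(2)] by (simp add: L_def)
  qed
  have sg: "snd c (\<kappa> t) = g (\<sigma> t)" "\<kappa> t \<in> fst c" "\<kappa> t \<in> W" "L (\<kappa> t) = \<sigma> t" if t: "\<bar>t\<bar> < \<delta>" for t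
  proof -
    have s: "\<bar>\<sigma> t\<bar> < \<delta>1" using \<sigma>[OF t] d by auto
    have gV: "g (\<sigma> t) \<in> V" "g (\<sigma> t) \<in> ?U" using g[OF s] V(3) by auto
    show 1: "snd c (\<kappa> t) = g (\<sigma> t)" "\<kappa> t \<in> fst c"
      using chart_inv_right[OF c(1) gV(2)] chart_inv_in[OF c(1) gV(2)] by (auto simp: \<kappa>_def)
    show "L (\<kappa> t) = \<sigma> t" using g[OF s] by (simp add: L_def 1)
    have "f (\<kappa> t) = 0" using g[OF s] by (simp add: \<kappa>_def F_def)
    then show "\<kappa> t \<in> W" using 1 g[OF s] \<sigma>[OF t] t chart_subset[OF c(1)] by (auto simp: W_def B_def)
  qed
  have openB: "open B"
  proof -
    have "open ({-d<..<d} \<inter> T -` {-\<delta><..<\<delta>})"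
      by (intro continuous_open_preimage continuous_at_imp_continuous_on ballI contT) auto
    moreover have "continuous_on UNIV (\<lambda>y. u \<bullet> (y - x0))" by (intro continuous_intros)
    ultimately have "open ((\<lambda>y. u \<bullet> (y - x0)) -` ({-d<..<d} \<inter> T -` {-\<delta><..<\<delta>}))"
      using open_vimage by blast
    moreover have "B = V \<inter> (\<lambda>y. u \<bullet> (y - x0)) -` ({-d<..<d} \<inter> T -` {-\<delta><..<\<delta>})"
      by (auto simp: B_def)
    ultimately show ?thesis using V(1) by auto
  qed
  show ?thesis
  proof
    have "openin (top_of_set (fst c)) (fst c \<inter> snd c -` B)"
      by (rule continuous_openin_preimage_gen[OF continuous_on_chart[OF c(1)] openB])
    then have "openin (top_of_set M) (fst c \<inter> snd c -` B)"
      using chart_openin[OF c(1)] openin_trans by blast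
    then obtain O' where O': "open O'" "fst c \<inter> snd c -` B = M \<inter> O'" unfolding openin_open by auto
    have "W = ?Z \<inter> O'" using O'(2) by (auto simp: W_def)
    then show "openin (top_of_set ?Z) W" using O'(1) openin_open by blast
    have "L q = 0" by (simp add: L_def x0_def)
    then show "\<tau> q = 0" by (simp add: \<tau>_def T0)
    show "q \<in> W" using q c V(2) T0 d \<delta> by (auto simp: W_def B_def x0_def)
    show "\<delta> > 0" by fact
    show "homeomorphism W {-\<delta><..<\<delta>} \<tau> \<kappa>"
    proof (rule homeomorphismI)
      have "continuous_on W L" unfolding L_def
        by (intro continuous_intros continuous_on_subset[OF continuous_on_chart[OF c(1)]]) (auto simp: W_def)
      moreover have "continuous_on {-d<..<d} T"
        by (intro continuous_at_imp_continuous_on ballI contT)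
      moreover have "L ` W \<subseteq> {-d<..<d}" using W(3) by (force simp: abs_less_iff)
      ultimately show "continuous_on W \<tau>" unfolding \<tau>_def using continuous_on_compose2 by blast
      have "continuous_on {-\<delta><..<\<delta>} (\<lambda>t. g (\<sigma> t))"
      proof (intro continuous_at_imp_continuous_on ballI)
        fix t assume t: "t \<in> {-\<delta><..<\<delta>}"
        then have "\<bar>t\<bar> < \<delta>" by auto
        then have "isCont \<sigma> t" "isCont g (\<sigma> t)" using \<sigma>[of t] contg[of "\<sigma> t"] d DERIV_isCont by auto
        then show "isCont (\<lambda>t. g (\<sigma> t)) t" by (rule isCont_o2)
      qed
      moreover have "(\<lambda>t. g (\<sigma> t)) ` {-\<delta><..<\<delta>} \<subseteq> ?U"
      proof (rule image_subsetI)
        fix t assume "t \<in> {-\<delta><..<\<delta>}"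
        then have "\<bar>t\<bar> < \<delta>" by auto
        then show "g (\<sigma> t) \<in> ?U" using imageI[OF sg(2), of t "snd c"] sg(1) by simp
      qed
      ultimately show "continuous_on {-\<delta><..<\<delta>} \<kappa>" unfolding \<kappa>_def
        using continuous_on_compose2[OF continuous_on_chart_inv[OF c(1)]] by blast
      show "\<tau> ` W \<subseteq> {-\<delta><..<\<delta>}" using W(4) by (force simp: abs_less_iff)
      show "\<kappa> ` {-\<delta><..<\<delta>} \<subseteq> W" using sg(3) by auto
      show "\<kappa> (\<tau> p) = p" if "p \<in> W" for p
        using W[OF that] \<sigma>T chart_inv_left[OF c(1)] by (simp add: \<kappa>_def \<tau>_def)
      show "\<tau> (\<kappa> t) = t" if "t \<in> {-\<delta><..<\<delta>}" for t
      proof -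
        have t: "\<bar>t\<bar> < \<delta>" using that by auto
        show ?thesis using \<sigma>[OF t] by (simp add: \<tau>_def sg(4)[OF t])
      qed
    qed
    then have cont\<kappa>: "continuous_on {-\<delta><..<\<delta>} \<kappa>" by (simp add: homeomorphism_def)
    fix t assume t: "\<bar>t\<bar> < \<delta>"
    define s where "s = \<sigma> t"
    have s: "\<bar>s\<bar> < \<delta>1" using \<sigma>[OF t] d by (auto simp: s_def)
    have evt: "\<forall>\<^sub>F r in nhds t. r \<in> {-\<delta><..<\<delta>}" by (rule eventually_nhds_in_open) (use t in auto)
    obtain g' where g': "(g has_vector_derivative g') (at s)"
      using g[OF s] vector_derivative_works by blast
    have p: "\<kappa> t \<in> fst c" "snd c (\<kappa> t) = g s" "f (\<kappa> t) = 0" "\<kappa> t \<in> M" using sg[OF t] by (auto simp: s_def W_def)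
    let ?n = "grad f c (\<kappa> t)"
    \<comment> \<open>The parameter of \<open>g\<close> is its own \<open>u\<close>-coordinate.
      Together with \<open>ng'\<close>, which holds since \<open>F\<close> is constant along
      \<open>g\<close>, this identifies the field as a multiple of \<open>g'\<close>.\<close>
    have ug': "u \<bullet> g' = 1"
    proof -
      have "((\<lambda>r. u \<bullet> (g r - x0)) has_vector_derivative u \<bullet> g') (at s)"
        using g' unfolding has_vector_derivative_def by (auto intro!: derivative_eq_intros)
      moreover have "((\<lambda>r. u \<bullet> (g r - x0)) has_vector_derivative 1) (at s)"
        by (rule has_vector_derivative_transform_within_open[of "\<lambda>r. r" _ _ "{-\<delta>1<..<\<delta>1}"]) (use s g in \<open>auto intro!: derivative_eq_intros\<close>)
      ultimately show ?thesis by (rule vector_derivative_unique_at)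
    qed
    have ng': "?n \<bullet> g' = 0"
    proof -
      have "(F has_derivative (\<lambda>v. ?n \<bullet> v)) (at (g s))" using dF[OF p(1)] p(2) by simp
      from vector_derivative_diff_chain_within[OF g' has_derivative_at_withinI[OF this]]
      have "(F \<circ> g has_vector_derivative ?n \<bullet> g') (at s)" by simp
      moreover have "(F \<circ> g has_vector_derivative 0) (at s)"
        by (rule has_vector_derivative_transform_within_open[of "\<lambda>r. 0" _ _ "{-\<delta>1<..<\<delta>1}"]) (use s g in auto)
      ultimately show ?thesis by (rule vector_derivative_unique_at)
    qed
    have Ys: "Y (g s) = hamiltonian_field f c (\<kappa> t)" by (simp add: Y_def \<kappa>_def s_def)
    have "hamiltonian_field f c (\<kappa> t) = (u \<bullet> hamiltonian_field f c (\<kappa> t)) *\<^sub>R g'"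
      by (rule parallel_in_plane[OF reg[OF p(4,3) c(1) p(1)] hamiltonian_field_tangent[OF c(1) p(1)] ng' ug'])
    then have "hamiltonian_field f c (\<kappa> t) = a s *\<^sub>R g'" by (simp add: a_def Ys)
    moreover have "((\<lambda>t. g (\<sigma> t)) has_vector_derivative a s *\<^sub>R g') (at t)"
    proof -
      have "(\<sigma> has_vector_derivative a s) (at t)" using \<sigma>[OF t] by (simp add: s_def has_real_derivative_iff_has_vector_derivative)
      from vector_diff_chain_at[OF this, of g g'] show ?thesis using g' by (simp add: s_def o_def)
    qed
    ultimately have "((\<lambda>t. g (\<sigma> t)) has_vector_derivative hamiltonian_field f c (\<kappa> t)) (at t)" by simp
    then have der: "(snd c \<circ> \<kappa> has_vector_derivative hamiltonian_field f c (\<kappa> t)) (at t)"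
      by (rule has_vector_derivative_transform_within_open[of _ _ _ "{-\<delta><..<\<delta>}"]) (use t sg(1) in auto)
    show "integral_at f \<kappa> t"
    proof (rule integral_atI[OF f _ _ c(1) p(1) der])
      have "t \<in> {-\<delta><..<\<delta>}" using t by auto
      then show "isCont \<kappa> t" using cont\<kappa> by (simp add: continuous_on_eq_continuous_at)
      show "\<forall>\<^sub>F s in nhds t. \<kappa> s \<in> M" using evt by eventually_elim (use sg(3) in \<open>auto simp: W_def\<close>)
    qed
  next
    fix \<alpha> t assume \<alpha>: "\<alpha> t \<in> W" "integral_at f \<alpha> t"
    note w = W[OF \<alpha>(1)]
    define s where "s = L (\<alpha> t)"
    \<comment> \<open>At this point the \<open>u\<close>-component of the velocity of \<alpha> is
      \<open>a s\<close>, and \<open>T\<close> has derivative \<open>1 / a s\<close>, so the rates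
      cancel.\<close>
    have s: "\<bar>s\<bar> < d" "g s = snd c (\<alpha> t)" using w by (auto simp: s_def)
    have "(snd c \<circ> \<alpha> has_vector_derivative hamiltonian_field f c (\<alpha> t)) (at t)"
      using \<alpha>(2) c(1) w(1) by (auto simp: integral_at_def)
    then have "((\<lambda>r. L (\<alpha> r)) has_real_derivative u \<bullet> hamiltonian_field f c (\<alpha> t)) (at t)"
      unfolding L_def has_real_derivative_iff_has_vector_derivative has_vector_derivative_def o_def
      by (auto intro!: derivative_eq_intros)
    moreover have "u \<bullet> hamiltonian_field f c (\<alpha> t) = a s" using w s by (simp add: a_def Y_def chart_inv_left[OF c(1)])
    ultimately have "((\<lambda>r. L (\<alpha> r)) has_real_derivative a s) (at t)" by simp
    from DERIV_chain[OF dT[OF s(1), unfolded s_def] this]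
    have "((\<lambda>r. T (L (\<alpha> r))) has_real_derivative 1 / a s * a s) (at t)" by (simp add: o_def s_def)
    moreover have "a s > 0" using e(2)[of s] s d by auto
    ultimately show "(\<tau> \<circ> \<alpha> has_real_derivative 1) (at t)" by (simp add: \<tau>_def o_def)
  qed
qed

lemma integral_at_shift:
  assumes "integral_at f \<alpha> (t + c)"
  shows "integral_at f (\<lambda>s. \<alpha> (s + c)) t"
  unfolding integral_at_def
proof (intro ballI impI)
  fix d assume d: "d \<in> A" "\<alpha> (t + c) \<in> fst d"
  have "((\<lambda>s. s + c) has_vector_derivative 1) (at t)" by (auto intro!: derivative_eq_intros)
  moreover have "(snd d \<circ> \<alpha> has_vector_derivative hamiltonian_field f d (\<alpha> (t + c))) (at (t + c))"
    using assms d by (simp add: integral_at_def)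
  ultimately show "(snd d \<circ> (\<lambda>s. \<alpha> (s + c)) has_vector_derivative hamiltonian_field f d (\<alpha> (t + c))) (at t)"
    using vector_diff_chain_at by (fastforce simp: o_def)
qed

lemma integral_at_cong:
  assumes "integral_at f \<alpha> t" "\<forall>\<^sub>F s in nhds t. \<beta> s = \<alpha> s"
  shows "integral_at f \<beta> t"
  unfolding integral_at_def
proof (intro ballI impI)
  fix d assume d: "d \<in> A" "\<beta> t \<in> fst d"
  have eq: "\<beta> t = \<alpha> t" using eventually_nhds_x_imp_x[OF assms(2)] .
  obtain S where S: "open S" "t \<in> S" "\<And>s. s \<in> S \<Longrightarrow> \<beta> s = \<alpha> s"
    using assms(2) unfolding eventually_nhds by blast
  have "(snd d \<circ> \<alpha> has_vector_derivative hamiltonian_field f d (\<beta> t)) (at t)"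
    using assms(1) d eq by (simp add: integral_at_def)
  then show "(snd d \<circ> \<beta> has_vector_derivative hamiltonian_field f d (\<beta> t)) (at t)"
    by (rule has_vector_derivative_transform_within_open[OF _ S(1,2)]) (simp add: S(3))
qed

text \<open>The iterated derivatives of a curve with velocity \<open>P *\<^sub>R hamiltonian_field f\<close> are again functions of the point,
  \<open>G \<circ> snd c \<circ> \<gamma>\<close> with \<open>G\<close> smooth.\<close>

lemma smooth_integral_curve:
  assumes f: "smooth_function A f" and c: "c \<in> A"
    and cont: "\<And>t. isCont \<gamma> t" "\<And>t. \<gamma> t \<in> M"
    and der: "\<And>t. \<gamma> t \<in> fst c \<Longrightarrow> (snd c \<circ> \<gamma> has_vector_derivative P *\<^sub>R hamiltonian_field f c (\<gamma> t)) (at t)"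
  shows "smooth_on (\<gamma> -` fst c) (snd c \<circ> \<gamma>)"
proof -
  let ?U = "snd c ` fst c"
  let ?Y = "\<lambda>y. hamiltonian_field f c (chart_inv c y)"
  have U: "open ?U" by (rule open_chart_image[OF c])
  have op: "open (\<gamma> -` fst c)"
  proof -
    obtain O' where O': "open O'" "fst c = M \<inter> O'" using chart_openin[OF c] unfolding openin_open by auto
    then have "\<gamma> -` fst c = \<gamma> -` O'" using cont(2) by auto
    then show ?thesis using open_vimage[OF O'(1)] cont(1) continuous_at_imp_continuous_on by metis
  qed
  show ?thesis
  proof (rule smooth_on_coinduct[where P="\<lambda>h. \<exists>G::real^2 \<Rightarrow> real^2. smooth_on ?U G \<and> h = (\<lambda>t. G (snd c (\<gamma> t)))", OF op])
    show "\<exists>G. smooth_on ?U G \<and> snd c \<circ> \<gamma> = (\<lambda>t. G (snd c (\<gamma> t)))"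
      using smooth_on_id[OF U] by (intro exI[of _ "\<lambda>x. x"]) auto
  next
    fix h assume "\<exists>G::real^2 \<Rightarrow> real^2. smooth_on ?U G \<and> h = (\<lambda>t. G (snd c (\<gamma> t)))"
    then obtain G :: "real^2 \<Rightarrow> real^2" where G: "smooth_on ?U G" "h = (\<lambda>t. G (snd c (\<gamma> t)))" by auto
    let ?D = "\<lambda>y. frechet_derivative G (at y)"
    \<comment> \<open>The derivative of \<open>G\<close> along the field, written with derivatives
      in fixed directions and smooth coefficients, so that its smoothness in the point is
      visible.\<close>
    let ?H = "\<lambda>y. ?Y y $ 1 *\<^sub>R ?D y (axis 1 1) + ?Y y $ 2 *\<^sub>R ?D y (axis 2 1)"
    have sY: "smooth_on ?U (\<lambda>y. ?Y y $ i)" for i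
      by (rule smooth_on_compose_linear[OF U bounded_linear_vec_nth smooth_on_hamiltonian_field[OF f c]])
    have sH: "smooth_on ?U (\<lambda>y. r *\<^sub>R ?H y)" for r
      by (intro smooth_on_scaleR smooth_on_add U smooth_on_const sY smooth_on_dirderiv G)
    have "(h has_derivative (\<lambda>v. (v * P) *\<^sub>R ?H (snd c (\<gamma> t)))) (at t)" if t: "t \<in> \<gamma> -` fst c" for t
    proof -
      have y: "snd c (\<gamma> t) \<in> ?U" using t by auto
      note dG = smooth_on_has_derivative[OF G(1) y]
      have "(G has_derivative ?D (snd c (\<gamma> t))) (at ((snd c \<circ> \<gamma>) t))" using dG by simp
      from vector_derivative_diff_chain_within[OF der has_derivative_at_withinI[OF this]] t
      have "(G \<circ> (snd c \<circ> \<gamma>) has_vector_derivative ?D (snd c (\<gamma> t)) (P *\<^sub>R hamiltonian_field f c (\<gamma> t))) (at t)" by (simp add: o_def)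
      moreover have "?D (snd c (\<gamma> t)) (P *\<^sub>R hamiltonian_field f c (\<gamma> t)) = P *\<^sub>R ?H (snd c (\<gamma> t))"
        using frechet_derivative_coords[OF dG, of "hamiltonian_field f c (\<gamma> t)"] t chart_inv_left[OF c]
          linear_scale[OF has_derivative_linear[OF dG]] by simp
      moreover have "G \<circ> (snd c \<circ> \<gamma>) = h" by (simp add: G(2) fun_eq_iff)
      ultimately show ?thesis by (simp add: has_vector_derivative_def)
    qed
    then show "\<exists>D. (\<forall>x\<in>\<gamma> -` fst c. (h has_derivative D x) (at x)) \<and>
          (\<forall>v. \<exists>G::real^2 \<Rightarrow> real^2. smooth_on ?U G \<and> (\<lambda>x. D x v) = (\<lambda>t. G (snd c (\<gamma> t))))"
      using sH by (intro exI[of _ "\<lambda>t v. (v * P) *\<^sub>R ?H (snd c (\<gamma> t))"]) blast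
  qed
qed

lemma continuous_on_smooth_function:
  assumes f: "smooth_function A f"
  shows "continuous_on M f"
proof -
  have "continuous (at p within M) f" if "p \<in> M" for p
  proof -
    obtain c where c: "c \<in> A" "p \<in> fst c" using in_some_chart[OF \<open>p \<in> M\<close>] by blast
    obtain O' where O': "open O'" "fst c = M \<inter> O'" using chart_openin[OF c(1)] unfolding openin_open by auto
    have "continuous_on (snd c ` fst c) (f \<circ> chart_inv c)"
      using f c(1) by (intro smooth_on_continuous) (auto simp: smooth_function_def)
    then have "continuous_on (fst c) (\<lambda>p. (f \<circ> chart_inv c) (snd c p))"
      by (rule continuous_on_compose2[OF _ continuous_on_chart[OF c(1)]]) auto
    then have "continuous_on (fst c) f"
      by (rule continuous_on_eq) (simp add: chart_inv_left[OF c(1)])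
    then have "continuous (at p within fst c) f" using c(2) by (simp add: continuous_on_eq_continuous_within)
    moreover have "at p within fst c = at p within M"
      by (rule at_within_nhd[of _ O']) (use c O' in auto)
    ultimately show ?thesis by simp
  qed
  then show ?thesis by (simp add: continuous_on_eq_continuous_within)
qed

text \<open>Near \<open>t\<close> the function \<open>\<tau>' \<circ> \<kappa>\<close> minus time
  has derivative 0, hence is constant. This supplies \<open>compat\<close>.\<close>

lemma integral_curves_translate:
  assumes hom: "homeomorphism W {-\<delta><..<\<delta>} \<tau> \<kappa>" and I: "\<And>t. \<bar>t\<bar> < \<delta> \<Longrightarrow> integral_at f \<kappa> t" and WZ: "W \<subseteq> Z"
    and W': "openin (top_of_set Z) W'"
    and \<tau>': "\<And>\<alpha> t. \<alpha> t \<in> W' \<Longrightarrow> integral_at f \<alpha> t \<Longrightarrow> (\<tau>' \<circ> \<alpha> has_real_derivative 1) (at t)"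
    and t: "\<bar>t\<bar> < \<delta>" "\<kappa> t \<in> W'"
  shows "\<forall>\<^sub>F s in nhds t. \<tau>' (\<kappa> s) = \<tau>' (\<kappa> t) + (s - t)"
proof -
  obtain O' where O': "open O'" "W' = Z \<inter> O'" using W' unfolding openin_open by auto
  have "open ({-\<delta><..<\<delta>} \<inter> \<kappa> -` O')"
    by (rule continuous_open_preimage[OF homeomorphism_cont2[OF hom]]) (use O' in auto)
  moreover have "t \<in> {-\<delta><..<\<delta>} \<inter> \<kappa> -` O'" using t O' by auto
  ultimately obtain e where e: "e > 0" "ball t e \<subseteq> {-\<delta><..<\<delta>} \<inter> \<kappa> -` O'" by (rule openE)
  have "(\<tau>' \<circ> \<kappa> has_real_derivative 1) (at s)" if s: "s \<in> ball t e" for s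
  proof (rule \<tau>')
    have s': "s \<in> {-\<delta><..<\<delta>}" "\<kappa> s \<in> O'" using s e(2) by auto
    then show "integral_at f \<kappa> s" by (intro I) auto
    have "\<kappa> s \<in> W" using homeomorphism_image2[OF hom] s'(1) by blast
    then show "\<kappa> s \<in> W'" using O' s' WZ by auto
  qed
  then have D: "((\<lambda>s. \<tau>' (\<kappa> s) - s) has_derivative (\<lambda>_. 0)) (at s within ball t e)" if "s \<in> ball t e" for s
  proof -
    have "((\<lambda>s. (\<tau>' \<circ> \<kappa>) s - s) has_real_derivative 1 - 1) (at s)"
      by (intro DERIV_diff DERIV_ident \<open>\<And>s. s \<in> ball t e \<Longrightarrow> (\<tau>' \<circ> \<kappa> has_real_derivative 1) (at s)\<close> that)
    then have "((\<lambda>s. \<tau>' (\<kappa> s) - s) has_derivative (\<lambda>_. 0)) (at s)"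
      by (simp add: has_field_derivative_def o_def lambda_zero)
    then show ?thesis by (rule has_derivative_at_withinI)
  qed
  have "\<tau>' (\<kappa> s) = \<tau>' (\<kappa> t) + (s - t)" if "s \<in> ball t e" for s
    using has_derivative_zero_unique[OF convex_ball D that, of t] e(1) by auto
  moreover have "\<forall>\<^sub>F s in nhds t. s \<in> ball t e" by (rule eventually_nhds_in_open) (use e in auto)
  ultimately show ?thesis by (auto elim: eventually_mono)
qed

text \<open>Time charts turn the zero set into a \<open>translation_structure\<close>. The circles
  it yields are integral curves of the field, whence they are smooth and, the field being nonzero
  there, immersed.\<close>

theorem regular_zero_set:
  assumes f: "smooth_function A f" and reg: "\<And>p c. p \<in> M \<Longrightarrow> f p = 0 \<Longrightarrow> c \<in> A \<Longrightarrow> p \<in> fst c \<Longrightarrow> grad f c p \<noteq> 0"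
  obtains n :: nat and C :: "nat \<Rightarrow> 'a set" where "disjoint_family_on C {..<n}"
    "{p\<in>M. f p = 0} = (\<Union>i<n. C i)" "\<And>i. i < n \<Longrightarrow> smooth_simple_closed_curve M A (C i)"
proof -
  let ?Z = "{p\<in>M. f p = 0}"
  \<comment> \<open>All properties of a time chart are bundled so that one choice yields the four
    families that the locale expects.\<close>
  define good where "good = (\<lambda>q W \<delta> \<tau> \<kappa>. openin (top_of_set ?Z) W \<and> q \<in> W \<and> \<delta> > 0 \<and>
    homeomorphism W {-\<delta><..<\<delta>} \<tau> \<kappa> \<and> \<tau> q = 0 \<and> (\<forall>t. \<bar>t\<bar> < \<delta> \<longrightarrow> integral_at f \<kappa> t) \<and>
    (\<forall>\<alpha> t. \<alpha> t \<in> W \<longrightarrow> integral_at f \<alpha> t \<longrightarrow> (\<tau> \<circ> \<alpha> has_real_derivative 1) (at t)))"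
  have "\<exists>W \<delta> \<tau> \<kappa>. good q W \<delta> \<tau> \<kappa>" if q: "q \<in> ?Z" for q
  proof -
    have q': "q \<in> M" "f q = 0" using q by auto
    show ?thesis unfolding good_def by (rule time_chart[OF f reg q']) blast+
  qed
  then obtain W \<delta> \<tau> \<kappa> where good: "\<And>q. q \<in> ?Z \<Longrightarrow> good q (W q) (\<delta> q) (\<tau> q) (\<kappa> q)" by metis
  have cZ: "compact ?Z"
    using closedin_compact[OF compact_M continuous_closedin_preimage_constant[OF continuous_on_smooth_function[OF f]]] .
  interpret translation_structure ?Z W \<delta> \<tau> \<kappa>
  proof
    fix q q' t assume q: "q \<in> ?Z" "q' \<in> ?Z" and t: "\<bar>t\<bar> < \<delta> q" "\<kappa> q t \<in> W q'"
    note g = good[OF q(1), unfolded good_def] good[OF q(2), unfolded good_def]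
    show "\<forall>\<^sub>F s in nhds t. \<tau> q' (\<kappa> q s) = \<tau> q' (\<kappa> q t) + (s - t)"
    proof (rule integral_curves_translate[of "W q" "\<delta> q" "\<tau> q" "\<kappa> q" f ?Z "W q'" "\<tau> q'" t])
      show "W q \<subseteq> ?Z" using g(1) openin_imp_subset by blast
    qed (use g t in auto)
  qed (use good cZ in \<open>auto simp: good_def\<close>)
  have flow: "integral_at f \<gamma> t" if fl: "flow_at \<gamma> t" for \<gamma> t
  proof -
    obtain q where q: "q \<in> ?Z" "\<gamma> t \<in> W q" "\<forall>\<^sub>F s in nhds t. \<gamma> s = \<kappa> q (\<tau> q (\<gamma> t) + (s - t))"
      using fl unfolding flow_at_def by blast
    let ?c = "\<tau> q (\<gamma> t) - t"
    have "\<bar>t + ?c\<bar> < \<delta> q" using tau_bound[OF q(1,2)] by simp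
    then have "integral_at f (\<lambda>s. \<kappa> q (s + ?c)) t"
      using good[OF q(1)] by (intro integral_at_shift) (auto simp: good_def)
    moreover have "\<forall>\<^sub>F s in nhds t. \<gamma> s = \<kappa> q (s + ?c)" using q(3) by (simp add: algebra_simps)
    ultimately show ?thesis by (rule integral_at_cong)
  qed
  obtain n and C :: "nat \<Rightarrow> 'a set" where C: "disjoint_family_on C {..<n}" "?Z = (\<Union>i<n. C i)"
    "\<And>i. i < n \<Longrightarrow> \<exists>\<gamma> P. P > 0 \<and> range \<gamma> = C i \<and> (\<forall>t. flow_at \<gamma> t) \<and> (\<forall>t. \<gamma> (t + P) = \<gamma> t) \<and> inj_on \<gamma> {0..<P}"
    by (rule finite_union_of_circles) blast
  have "smooth_simple_closed_curve M A (C i)" if i: "i < n" for i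
  proof -
    obtain \<gamma> P where \<gamma>: "P > 0" "range \<gamma> = C i" "\<And>t. flow_at \<gamma> t" "\<And>t. \<gamma> (t + P) = \<gamma> t" "inj_on \<gamma> {0..<P}"
      using C(3)[OF i] by blast
    \<comment> \<open>Time is rescaled from period \<open>P\<close> to period 1; this is the
      constant factor in front of the field.\<close>
    define \<beta> where "\<beta> = (\<lambda>t. \<gamma> (P * t))"
    have \<beta>M: "\<beta> t \<in> M" "f (\<beta> t) = 0" for t using flow_at_Z[OF \<gamma>(3)] by (auto simp: \<beta>_def)
    have \<beta>c: "isCont \<beta> t" for t
      unfolding \<beta>_def by (intro isCont_o2[OF _ isCont_flow[OF \<gamma>(3)]] continuous_intros)
    have der: "(snd c \<circ> \<beta> has_vector_derivative P *\<^sub>R hamiltonian_field f c (\<beta> t)) (at t)" if "c \<in> A" "\<beta> t \<in> fst c" for c t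
    proof -
      have "((\<lambda>t. P * t) has_vector_derivative P) (at t)" by (auto intro!: derivative_eq_intros)
      moreover have "(snd c \<circ> \<gamma> has_vector_derivative hamiltonian_field f c (\<beta> t)) (at (P * t))"
        using flow[OF \<gamma>(3), of "P * t"] that by (simp add: integral_at_def \<beta>_def)
      ultimately show ?thesis using vector_diff_chain_at by (fastforce simp: o_def \<beta>_def)
    qed
    show ?thesis unfolding smooth_simple_closed_curve_def
    proof (intro exI[of _ \<beta>] conjI allI ballI impI)
      have "\<gamma> t \<in> range \<beta>" for t by (rule range_eqI[of _ _ "t / P"]) (use \<gamma>(1) in \<open>simp add: \<beta>_def\<close>)
      then have "range \<gamma> \<subseteq> range \<beta>" by blast
      moreover have "range \<beta> \<subseteq> range \<gamma>" by (auto simp: \<beta>_def)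
      ultimately show "range \<beta> = C i" using \<gamma>(2) by blast
      show "C i \<subseteq> M" using C(2) i by auto
      show "continuous_on UNIV \<beta>" using \<beta>c continuous_at_imp_continuous_on by blast
      show "\<beta> (t + 1) = \<beta> t" for t using \<gamma>(4)[of "P * t"] by (simp add: \<beta>_def algebra_simps)
      show "inj_on \<beta> {0..<1}"
      proof (rule inj_onI)
        fix s t assume st: "s \<in> {0..<1}" "t \<in> {0..<1}" "\<beta> s = \<beta> t"
        then have "P * s \<in> {0..<P}" "P * t \<in> {0..<P}" using \<gamma>(1) by auto
        with inj_onD[OF \<gamma>(5), of "P * s" "P * t"] st(3) have "P * s = P * t" by (simp add: \<beta>_def)
        then show "s = t" using \<gamma>(1) by simp
      qed
      show "smooth_on (\<beta> -` fst c) (snd c \<circ> \<beta>)" if "c \<in> A" for c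
        by (rule smooth_integral_curve[OF f that \<beta>c \<beta>M(1) der[OF that]])
      show "vector_derivative (snd c \<circ> \<beta>) (at t) \<noteq> 0" if "c \<in> A" "\<beta> t \<in> fst c" for c t
        using vector_derivative_at[OF der[OF that]] hamiltonian_field_nonzero[OF that reg[OF \<beta>M that]] \<gamma>(1) by simp
    qed
  qed
  then show ?thesis using that C(1,2) by blast
qed

end

section \<open>Regular Poisson structures\<close>

lemma dirderivs_diff:
  assumes "open S" "smooth_on S f" "smooth_on S g" "y \<in> S"
  shows "dirderivs vs (\<lambda>x. f x - g x) y = dirderivs vs f y - dirderivs vs g y"
  using assms(4)
proof (induction vs arbitrary: y)
  case (Cons v vs)
  have d: "(dirderivs vs h has_derivative frechet_derivative (dirderivs vs h) (at y)) (at y)"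
    if "smooth_on S h" for h :: "'a \<Rightarrow> 'b"
    by (rule smooth_on_has_derivative[OF smooth_on_dirderivs[OF that] Cons.prems])
  have "dirderivs (v # vs) (\<lambda>x. f x - g x) y =
    frechet_derivative (\<lambda>x. dirderivs vs f x - dirderivs vs g x) (at y) v"
    using frechet_derivative_cong_open[OF assms(1) Cons.prems Cons.IH] by simp
  also have "\<dots> = dirderivs (v # vs) f y - dirderivs (v # vs) g y"
    using frechet_derivative_at[OF has_derivative_diff[OF d[OF assms(2)] d[OF assms(3)]], symmetric] by simp
  finally show ?case .
qed simp

lemma dirderivs_scaleR:
  assumes "open S" "smooth_on S f" "y \<in> S"
  shows "dirderivs vs (\<lambda>x. r *\<^sub>R f x) y = r *\<^sub>R dirderivs vs f y"
  using assms(3)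
proof (induction vs arbitrary: y)
  case (Cons v vs)
  have d: "(dirderivs vs f has_derivative frechet_derivative (dirderivs vs f) (at y)) (at y)"
    by (rule smooth_on_has_derivative[OF smooth_on_dirderivs[OF assms(2)] Cons.prems])
  have "dirderivs (v # vs) (\<lambda>x. r *\<^sub>R f x) y =
    frechet_derivative (\<lambda>x. r *\<^sub>R dirderivs vs f x) (at y) v"
    using frechet_derivative_cong_open[OF assms(1) Cons.prems Cons.IH] by simp
  also have "\<dots> = r *\<^sub>R dirderivs (v # vs) f y"
    using frechet_derivative_at[OF has_derivative_scaleR_right[OF d], symmetric] by simp
  finally show ?case .
qed simp

lemma dirderivs_zero: "dirderivs vs (\<lambda>x. 0) = (\<lambda>x. 0)"
  by (induction vs) auto

section \<open>The number of curves as the number of components\<close>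

lemma connected_subset_of_disjoint_closed:
  assumes fin: "finite L" and D: "disjoint_family_on D L" "\<And>i. i \<in> L \<Longrightarrow> closed (D i)"
    and S: "connected S" "S \<subseteq> (\<Union>j\<in>L. D j)" and j: "j \<in> L" "S \<inter> D j \<noteq> {}"
  shows "S \<subseteq> D j"
proof -
  have "closed (D j)" "closed (\<Union>k\<in>L - {j}. D k)" using fin D j by auto
  moreover have "D j \<inter> (\<Union>k\<in>L - {j}. D k) = {}" using D(1) j(1) by (auto simp: disjoint_family_on_def)
  ultimately have "S \<inter> (\<Union>k\<in>L - {j}. D k) = {}"
    using connected_closedD[OF S(1), of "D j" "\<Union>k\<in>L - {j}. D k"] S(2) j by blast
  then show ?thesis using S(2) by blast
qed

text \<open>Members of the two families that meet contain each other, so both families consist of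
  the same sets. Disjointness and non-emptiness make the indexings injective, so the index sets are
  equally large.\<close>

lemma disjoint_union_of_connected_unique:
  fixes C :: "'i \<Rightarrow> 'a::t2_space set" and D :: "'j \<Rightarrow> 'a set"
  assumes fin: "finite I" "finite K"
    and C: "disjoint_family_on C I" "\<And>i. i \<in> I \<Longrightarrow> connected (C i) \<and> compact (C i) \<and> C i \<noteq> {}"
    and D: "disjoint_family_on D K" "\<And>i. i \<in> K \<Longrightarrow> connected (D i) \<and> compact (D i) \<and> D i \<noteq> {}"
    and eq: "(\<Union>i\<in>I. C i) = (\<Union>i\<in>K. D i)"
  shows "card I = card K"
proof -
  have cl: "closed (C i)" if "i \<in> I" for i using C(2)[OF that] compact_imp_closed by blast
  have clD: "closed (D i)" if "i \<in> K" for i using D(2)[OF that] compact_imp_closed by blast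
  have same: "C i = D j" if ij: "i \<in> I" "j \<in> K" "C i \<inter> D j \<noteq> {}" for i j
  proof
    show "C i \<subseteq> D j"
      by (rule connected_subset_of_disjoint_closed[OF fin(2) D(1) clD]) (use C eq ij in auto)
    show "D j \<subseteq> C i"
      by (rule connected_subset_of_disjoint_closed[OF fin(1) C(1) cl]) (use D eq ij in auto)
  qed
  have "C ` I = D ` K"
  proof (intro equalityI subsetI)
    fix S assume "S \<in> C ` I"
    then obtain i x where i: "i \<in> I" "S = C i" "x \<in> C i" using C(2) by blast
    then obtain j where "j \<in> K" "x \<in> D j" using eq by blast
    then show "S \<in> D ` K" using same[of i j] i by blast
  next
    fix S assume "S \<in> D ` K"
    then obtain j x where j: "j \<in> K" "S = D j" "x \<in> D j" using D(2) by blast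
    then obtain i where "i \<in> I" "x \<in> C i" using eq by blast
    then show "S \<in> C ` I" using same[of i j] j by blast
  qed
  moreover have "inj_on C I"
  proof (rule inj_onI, rule ccontr)
    fix i j assume ij: "i \<in> I" "j \<in> I" "C i = C j" "i \<noteq> j"
    then have "C i \<inter> C j = {}" using C(1) unfolding disjoint_family_on_def by blast
    then show False using C(2)[OF ij(1)] ij(3) by simp
  qed
  moreover have "inj_on D K"
  proof (rule inj_onI, rule ccontr)
    fix i j assume ij: "i \<in> K" "j \<in> K" "D i = D j" "i \<noteq> j"
    then have "D i \<inter> D j = {}" using D(1) unfolding disjoint_family_on_def by blast
    then show False using D(2)[OF ij(1)] ij(3) by simp
  qed
  ultimately show ?thesis using card_image by metis
qed

text \<open>By periodicity the curve is the image of the unit interval.\<close>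

lemma smooth_simple_closed_curve_topology:
  assumes "smooth_simple_closed_curve M A C"
  shows "connected C \<and> compact C \<and> C \<noteq> {}"
proof -
  obtain \<gamma> :: "real \<Rightarrow> 'a" where \<gamma>: "range \<gamma> = C" "continuous_on UNIV \<gamma>" "\<And>t. \<gamma> (t + 1) = \<gamma> t"
    using assms unfolding smooth_simple_closed_curve_def by blast
  have per: "\<gamma> (t + of_int n) = \<gamma> t" for t n
  proof (induction n rule: int_induct[where k=0])
    case (step1 i)
    then show ?case using \<gamma>(3)[of "t + of_int i"] by (simp add: add.assoc)
  next
    case (step2 i)
    then show ?case using \<gamma>(3)[of "t + of_int (i - 1)"] by (simp add: algebra_simps)
  qed simp
  have "\<gamma> t \<in> \<gamma> ` {0..1}" for t
  proof
    show "\<gamma> t = \<gamma> (frac t)" using per[of "frac t" "\<lfloor>t\<rfloor>"] by (simp add: frac_def)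
    show "frac t \<in> {0..1}" using frac_lt_1[of t] by (simp add: less_imp_le)
  qed
  then have "C = \<gamma> ` {0..1}" using \<gamma>(1) by auto
  moreover have "compact (\<gamma> ` {0..1})" "connected (\<gamma> ` {0..1})"
    by (intro compact_continuous_image connected_continuous_image continuous_on_subset[OF \<gamma>(2)]; simp)+
  ultimately show ?thesis by auto
qed

lemma disjoint_linear_poisson: "disjoint_family (linear_poisson M A \<pi>\<^sub>0)"
proof -
  have "n = m" if nm: "\<pi> \<in> linear_poisson M A \<pi>\<^sub>0 n" "\<pi> \<in> linear_poisson M A \<pi>\<^sub>0 m" for \<pi> n m
  proof -
    obtain C :: "nat \<Rightarrow> 'a set" where C: "\<And>i. i < n \<Longrightarrow> smooth_simple_closed_curve M A (C i)"
      "disjoint_family_on C {..<n}" "zero_set A \<pi> = (\<Union>i<n. C i)"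
      using nm(1) unfolding linear_poisson_def by blast
    obtain D :: "nat \<Rightarrow> 'a set" where D: "\<And>i. i < m \<Longrightarrow> smooth_simple_closed_curve M A (D i)"
      "disjoint_family_on D {..<m}" "zero_set A \<pi> = (\<Union>i<m. D i)"
      using nm(2) unfolding linear_poisson_def by blast
    have "connected (C i) \<and> compact (C i) \<and> C i \<noteq> {}" if "i \<in> {..<n}" for i
      using smooth_simple_closed_curve_topology[OF C(1)] that by simp
    moreover have "connected (D i) \<and> compact (D i) \<and> D i \<noteq> {}" if "i \<in> {..<m}" for i
      using smooth_simple_closed_curve_topology[OF D(1)] that by simp
    ultimately have "card {..<n} = card {..<m}"
      using disjoint_union_of_connected_unique[OF finite_lessThan finite_lessThan C(2) _ D(2)] C(3) D(3) by metis
    then show ?thesis by simp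
  qed
  then show ?thesis by (auto simp: disjoint_family_on_def)
qed

section \<open>Bivector fields as multiples of the fixed one, and regularity\<close>

context poisson_surface
begin

lemma poisson_eq: "poisson_structures A = bivector_fields A"
  by (rule poisson_structures_eq[OF atlas])

text \<open>Both bivectors undergo the same linear transformation, so their ratio does not depend on
  the chart.\<close>

lemma scale_change_chart:
  assumes \<pi>: "\<pi> \<in> bivector_fields A" and c: "c \<in> A" "d \<in> A" "p \<in> fst c" "p \<in> fst d"
    and r: "\<pi> c p = r *\<^sub>R \<pi>\<^sub>0 c p"
  shows "\<pi> d p = r *\<^sub>R \<pi>\<^sub>0 d p"
proof -
  have "\<pi> d p = J c d p ** \<pi> c p ** transpose (J c d p)"
    using \<pi> c unfolding bivector_fields_def by blast
  also have "\<dots> = r *\<^sub>R (J c d p ** \<pi>\<^sub>0 c p ** transpose (J c d p))"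
    by (simp add: r vec_eq_iff matrix_matrix_mult_def sum_2 algebra_simps)
  finally show ?thesis using \<pi>0_change_chart[OF c] by simp
qed

text \<open>Skew 2x2 matrices form a line, so the ratio exists pointwise; it is smooth as the
  quotient of the upper right entries.\<close>

lemma exists_scale:
  assumes \<pi>: "\<pi> \<in> bivector_fields A"
  obtains f where "smooth_function A f" "\<pi> = scale_bivector f \<pi>\<^sub>0"
proof -
  have ratio: "\<pi> c p = (\<pi> c p $ 1 $ 2 / \<pi>\<^sub>0 c p $ 1 $ 2) *\<^sub>R \<pi>\<^sub>0 c p" if c: "c \<in> A" "p \<in> fst c" for c p
  proof -
    have sk: "transpose (\<pi> c p) = - \<pi> c p" using \<pi> c unfolding bivector_fields_def by blast
    have s: "\<pi> c p $ j $ i = - \<pi> c p $ i $ j" for i j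
      using arg_cong[OF sk, of "\<lambda>X. X $ i $ j"] by (simp add: transpose_def)
    have "\<pi> c p $ 1 $ 1 = 0" "\<pi> c p $ 2 $ 2 = 0" "\<pi> c p $ 2 $ 1 = - \<pi> c p $ 1 $ 2"
      using s[of 1 1] s[of 2 2] s[of 2 1] by auto
    then show ?thesis by (rule_tac \<pi>0_form[OF c]) (simp add: vec_eq_iff forall_2)
  qed
  have "\<exists>r. \<forall>c\<in>A. p \<in> fst c \<longrightarrow> \<pi> c p = r *\<^sub>R \<pi>\<^sub>0 c p" for p
  proof (cases "\<exists>c\<in>A. p \<in> fst c")
    case True
    then show ?thesis using scale_change_chart[OF \<pi>] ratio by meson
  qed blast
  then obtain f where f: "\<And>c p. c \<in> A \<Longrightarrow> p \<in> fst c \<Longrightarrow> \<pi> c p = f p *\<^sub>R \<pi>\<^sub>0 c p" by metis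
  have "smooth_function A f"
    unfolding smooth_function_def
  proof
    fix c assume c: "c \<in> A"
    let ?U = "snd c ` fst c"
    have U: "open ?U" by (rule open_chart_image[OF c])
    have bl: "bounded_linear (\<lambda>X::real^2^2. X $ 1 $ 2)"
      by (intro bounded_linear_compose[OF bounded_linear_vec_nth bounded_linear_vec_nth])
    have s: "smooth_on ?U (\<lambda>y. (\<rho> c \<circ> chart_inv c) y $ 1 $ 2)" if "\<rho> \<in> bivector_fields A" for \<rho>
      by (rule smooth_on_compose_linear[OF U bl]) (use that c in \<open>unfold bivector_fields_def, blast\<close>)
    have nz: "\<pi>\<^sub>0 c p $ 1 $ 2 \<noteq> 0" if "p \<in> fst c" for p by (rule \<pi>0_form[OF c that]) simp
    have "smooth_on ?U (\<lambda>y. (\<pi> c \<circ> chart_inv c) y $ 1 $ 2 / (\<pi>\<^sub>0 c \<circ> chart_inv c) y $ 1 $ 2)"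
      by (intro smooth_on_divide U s \<pi> \<pi>0) (use nz chart_inv_in[OF c] in auto)
    then show "smooth_on ?U (f \<circ> chart_inv c)"
    proof (rule smooth_on_cong[OF U, rotated])
      fix y assume "y \<in> ?U"
      then have p: "chart_inv c y \<in> fst c" by (rule chart_inv_in[OF c])
      show "(\<pi> c \<circ> chart_inv c) y $ 1 $ 2 / (\<pi>\<^sub>0 c \<circ> chart_inv c) y $ 1 $ 2 = (f \<circ> chart_inv c) y"
        using f[OF c p] nz[OF p] by simp
    qed
  qed
  moreover have "\<pi> = scale_bivector f \<pi>\<^sub>0"
  proof (intro ext)
    fix c p
    show "\<pi> c p = scale_bivector f \<pi>\<^sub>0 c p"
    proof (cases "c \<in> A \<and> p \<in> fst c")
      case True
      then show ?thesis using f by (simp add: scale_bivector_def)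
    next
      \<comment> \<open>Both fields are 0 by convention where the matrices have no meaning, so any
        value of \<open>f\<close> fits.\<close>
      case False
      then have "\<pi> c p = 0" "\<pi>\<^sub>0 c p = 0" using \<pi> \<pi>0 unfolding bivector_fields_def by blast+
      then show ?thesis by (simp add: scale_bivector_def)
    qed
  qed
  ultimately show ?thesis using that by blast
qed

lemma scale_bivector_in:
  assumes f: "smooth_function A f"
  shows "scale_bivector f \<pi>\<^sub>0 \<in> bivector_fields A"
  unfolding bivector_fields_def
proof (intro CollectI conjI ballI allI impI)
  fix c assume c: "c \<in> A"
  have "smooth_on (snd c ` fst c) (f \<circ> chart_inv c)" using f c unfolding smooth_function_def by blast
  moreover have "smooth_on (snd c ` fst c) (\<pi>\<^sub>0 c \<circ> chart_inv c)" using \<pi>0 c unfolding bivector_fields_def by blast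
  ultimately have "smooth_on (snd c ` fst c) (\<lambda>y. (f \<circ> chart_inv c) y *\<^sub>R (\<pi>\<^sub>0 c \<circ> chart_inv c) y)"
    by (rule smooth_on_scaleR[OF open_chart_image[OF c]])
  then show "smooth_on (snd c ` fst c) (scale_bivector f \<pi>\<^sub>0 c \<circ> chart_inv c)"
    by (simp add: scale_bivector_def o_def)
  fix p assume p: "p \<in> fst c"
  have "transpose (\<pi>\<^sub>0 c p) = - \<pi>\<^sub>0 c p" using \<pi>0 c p unfolding bivector_fields_def by blast
  moreover have "transpose (f p *\<^sub>R \<pi>\<^sub>0 c p) = f p *\<^sub>R transpose (\<pi>\<^sub>0 c p)"
    by (simp add: vec_eq_iff transpose_def)
  ultimately show "transpose (scale_bivector f \<pi>\<^sub>0 c p) = - scale_bivector f \<pi>\<^sub>0 c p"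
    by (simp add: scale_bivector_def)
next
  fix c d p assume c: "c \<in> A" "d \<in> A" "p \<in> fst c \<inter> fst d"
  then show "scale_bivector f \<pi>\<^sub>0 d p = J c d p ** scale_bivector f \<pi>\<^sub>0 c p ** transpose (J c d p)"
    using \<pi>0_change_chart[of c d p]
    by (simp add: scale_bivector_def vec_eq_iff matrix_matrix_mult_def sum_2 algebra_simps)
next
  fix c p assume "\<not> (c \<in> A \<and> p \<in> fst c)"
  then have "\<pi>\<^sub>0 c p = 0" using \<pi>0 unfolding bivector_fields_def by blast
  then show "scale_bivector f \<pi>\<^sub>0 c p = 0" by (simp add: scale_bivector_def)
qed

lemma zero_set_scale: "zero_set A (scale_bivector f \<pi>\<^sub>0) = {p \<in> M. f p = 0}"
  using \<pi>0_nz in_some_chart chart_subset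
  unfolding zero_set_def scale_bivector_def nowhere_vanishing_def by fastforce

lemma grad_nonzero_change_chart:
  assumes "smooth_function A f" "c \<in> A" "d \<in> A" "p \<in> fst c" "p \<in> fst d" "grad f c p \<noteq> 0"
  shows "grad f d p \<noteq> 0"
  using grad_change_chart[OF assms(1-5)] assms(6) by auto

lemma differential_nonzero_at_iff:
  assumes f: "smooth_function A f"
  shows "differential_nonzero_at A f p \<longleftrightarrow> (\<forall>c\<in>A. p \<in> fst c \<longrightarrow> grad f c p \<noteq> 0)"
proof -
  have "frechet_derivative (f \<circ> chart_inv c) (at (snd c p)) = (\<lambda>_. 0) \<longleftrightarrow> grad f c p = 0" if "c \<in> A" "p \<in> fst c" for c
    unfolding frechet_derivative_at[OF smooth_function_has_derivative[OF f that], symmetric]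
    by (auto simp: fun_eq_iff)
  then show ?thesis by (auto simp: differential_nonzero_at_def)
qed

text \<open>Transversality to zero as an explicitly \<open>C\<^sup>1\<close>-open condition, to be checked in one chart only.\<close>

definition regular :: "'a bivector \<Rightarrow> bool" where
  "regular \<pi> \<longleftrightarrow> (\<forall>p\<in>M. \<exists>c\<in>A. p \<in> fst c \<and> (\<exists>vs. set vs \<subseteq> Basis \<and> length vs \<le> 1 \<and>
     dirderivs vs (\<pi> c \<circ> chart_inv c) (snd c p) \<noteq> 0))"

text \<open>At a zero of \<open>f\<close> the Leibniz term with the derivative of
  \<open>\<pi>\<^sub>0\<close> drops out.\<close>

lemma scale_derivative:
  assumes f: "smooth_function A f" and c: "c \<in> A" "p \<in> fst c" and z: "f p = 0"
  shows "frechet_derivative (scale_bivector f \<pi>\<^sub>0 c \<circ> chart_inv c) (at (snd c p)) = (\<lambda>v. (grad f c p \<bullet> v) *\<^sub>R \<pi>\<^sub>0 c p)"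
proof -
  have "(\<pi>\<^sub>0 c \<circ> chart_inv c has_derivative frechet_derivative (\<pi>\<^sub>0 c \<circ> chart_inv c) (at (snd c p))) (at (snd c p))"
    by (rule smooth_on_has_derivative[of "snd c ` fst c"]) (use \<pi>0 c in \<open>unfold bivector_fields_def, blast+\<close>)
  from has_derivative_scaleR[OF smooth_function_has_derivative[OF f c] this]
  have "((\<lambda>y. (f \<circ> chart_inv c) y *\<^sub>R (\<pi>\<^sub>0 c \<circ> chart_inv c) y) has_derivative (\<lambda>v. (grad f c p \<bullet> v) *\<^sub>R \<pi>\<^sub>0 c p)) (at (snd c p))"
    using z by (simp add: chart_inv_left[OF c])
  moreover have "(\<lambda>y. (f \<circ> chart_inv c) y *\<^sub>R (\<pi>\<^sub>0 c \<circ> chart_inv c) y) = scale_bivector f \<pi>\<^sub>0 c \<circ> chart_inv c"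
    by (simp add: scale_bivector_def fun_eq_iff)
  ultimately have "(scale_bivector f \<pi>\<^sub>0 c \<circ> chart_inv c has_derivative (\<lambda>v. (grad f c p \<bullet> v) *\<^sub>R \<pi>\<^sub>0 c p)) (at (snd c p))"
    by (simp only:)
  from frechet_derivative_at[OF this] show ?thesis by (rule sym)
qed

text \<open>The empty list in \<open>regular\<close> detects points with
  \<open>f p \<noteq> 0\<close>; at a zero only a list of length 1 can succeed, and it detects the
  gradient. Whether the gradient vanishes is independent of the chart.\<close>

lemma regular_scale_iff:
  assumes f: "smooth_function A f"
  shows "regular (scale_bivector f \<pi>\<^sub>0) \<longleftrightarrow> (\<forall>p\<in>M. f p = 0 \<longrightarrow> (\<forall>c\<in>A. p \<in> fst c \<longrightarrow> grad f c p \<noteq> 0))"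
proof
  assume reg: "regular (scale_bivector f \<pi>\<^sub>0)"
  show "\<forall>p\<in>M. f p = 0 \<longrightarrow> (\<forall>c\<in>A. p \<in> fst c \<longrightarrow> grad f c p \<noteq> 0)"
  proof (intro ballI impI)
    fix p d assume p: "p \<in> M" "f p = 0" and d: "d \<in> A" "p \<in> fst d"
    obtain c vs where c: "c \<in> A" "p \<in> fst c" and vs: "length vs \<le> 1" "dirderivs vs (scale_bivector f \<pi>\<^sub>0 c \<circ> chart_inv c) (snd c p) \<noteq> 0"
      using reg p(1) unfolding regular_def by blast
    have "vs \<noteq> []" using vs(2) p(2) by (auto simp: scale_bivector_def chart_inv_left[OF c])
    then obtain v where "vs = [v]" using vs(1) by (cases vs) auto
    then have "(grad f c p \<bullet> v) *\<^sub>R \<pi>\<^sub>0 c p \<noteq> 0" using vs(2) scale_derivative[OF f c p(2)] by simp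
    then have "grad f c p \<noteq> 0" by auto
    then show "grad f d p \<noteq> 0" using grad_nonzero_change_chart[OF f c(1) d(1) c(2) d(2)] by blast
  qed
next
  assume reg: "\<forall>p\<in>M. f p = 0 \<longrightarrow> (\<forall>c\<in>A. p \<in> fst c \<longrightarrow> grad f c p \<noteq> 0)"
  show "regular (scale_bivector f \<pi>\<^sub>0)"
    unfolding regular_def
  proof
    fix p assume p: "p \<in> M"
    then obtain c where c: "c \<in> A" "p \<in> fst c" using in_some_chart by blast
    have nz: "\<pi>\<^sub>0 c p \<noteq> 0" using \<pi>0_nz c by (auto simp: nowhere_vanishing_def)
    have "\<exists>vs. set vs \<subseteq> Basis \<and> length vs \<le> 1 \<and> dirderivs vs (scale_bivector f \<pi>\<^sub>0 c \<circ> chart_inv c) (snd c p) \<noteq> 0"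
    proof (cases "f p = 0")
      case True
      then obtain i where "grad f c p $ i \<noteq> 0" using reg p c by (metis vec_eq_iff zero_index)
      then show ?thesis using scale_derivative[OF f c True] nz
        by (intro exI[of _ "[axis i 1]"]) (auto simp: inner_axis axis_in_Basis_iff)
    next
      case False
      then show ?thesis using nz by (intro exI[of _ "[]"]) (simp add: scale_bivector_def chart_inv_left[OF c])
    qed
    then show "\<exists>c\<in>A. p \<in> fst c \<and> (\<exists>vs. set vs \<subseteq> Basis \<and> length vs \<le> 1 \<and>
      dirderivs vs (scale_bivector f \<pi>\<^sub>0 c \<circ> chart_inv c) (snd c p) \<noteq> 0)" using c by blast
  qed
qed

text \<open>One direction keeps only the condition on the differential; in the other the curves, and
  with them \<open>n\<close>, come from \<open>regular_zero_set\<close>.\<close>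

lemma linear_poisson_iff_regular:
  "(\<exists>n. \<pi> \<in> linear_poisson M A \<pi>\<^sub>0 n) \<longleftrightarrow> \<pi> \<in> poisson_structures A \<and> regular \<pi>"
proof
  assume "\<exists>n. \<pi> \<in> linear_poisson M A \<pi>\<^sub>0 n"
  then obtain f where \<pi>: "\<pi> \<in> poisson_structures A" and f: "smooth_function A f" "\<pi> = scale_bivector f \<pi>\<^sub>0"
    and nz: "\<forall>p\<in>zero_set A \<pi>. differential_nonzero_at A f p"
    unfolding linear_poisson_def by blast
  have "\<forall>p\<in>M. f p = 0 \<longrightarrow> (\<forall>c\<in>A. p \<in> fst c \<longrightarrow> grad f c p \<noteq> 0)"
    using nz unfolding f(2) zero_set_scale differential_nonzero_at_iff[OF f(1)] by blast
  then show "\<pi> \<in> poisson_structures A \<and> regular \<pi>"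
    using \<pi> regular_scale_iff[OF f(1)] f(2) by blast
next
  assume \<pi>: "\<pi> \<in> poisson_structures A \<and> regular \<pi>"
  then obtain f where f: "smooth_function A f" "\<pi> = scale_bivector f \<pi>\<^sub>0" using exists_scale poisson_eq by metis
  have nz: "grad f c p \<noteq> 0" if "p \<in> M" "f p = 0" "c \<in> A" "p \<in> fst c" for p c
    using \<pi> regular_scale_iff[OF f(1)] f(2) that by blast
  obtain n and C :: "nat \<Rightarrow> 'a set" where C: "disjoint_family_on C {..<n}"
    "{p\<in>M. f p = 0} = (\<Union>i<n. C i)" "\<And>i. i < n \<Longrightarrow> smooth_simple_closed_curve M A (C i)"
    by (rule regular_zero_set[OF f(1) nz]) blast+
  have "\<pi> \<in> linear_poisson M A \<pi>\<^sub>0 n"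
    unfolding linear_poisson_def
  proof (intro CollectI conjI)
    show "\<exists>C. (\<forall>i<n. smooth_simple_closed_curve M A (C i)) \<and> disjoint_family_on C {..<n} \<and> zero_set A \<pi> = (\<Union>i<n. C i)"
      using C unfolding f(2) zero_set_scale by blast
    show "\<exists>f. smooth_function A f \<and> \<pi> = scale_bivector f \<pi>\<^sub>0 \<and> (\<forall>p\<in>zero_set A \<pi>. differential_nonzero_at A f p)"
      using f nz by (intro exI[of _ f]) (auto simp: zero_set_scale differential_nonzero_at_iff)
  qed (use \<pi> in blast)
  then show "\<exists>n. \<pi> \<in> linear_poisson M A \<pi>\<^sub>0 n" by blast
qed

section \<open>Whitney neighbourhoods and openness\<close>

lemma chart_smooth:
  assumes "\<sigma> \<in> bivector_fields A" "c \<in> A"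
  shows "smooth_on (snd c ` fst c) (\<sigma> c \<circ> chart_inv c)"
  using assms unfolding bivector_fields_def by blast

lemma dirderivs_chart_diff:
  assumes "\<sigma> \<in> bivector_fields A" "\<rho> \<in> bivector_fields A" "c \<in> A" "p \<in> fst c"
  shows "dirderivs vs ((\<lambda>q. \<sigma> c q - \<rho> c q) \<circ> chart_inv c) (snd c p) =
    dirderivs vs (\<sigma> c \<circ> chart_inv c) (snd c p) - dirderivs vs (\<rho> c \<circ> chart_inv c) (snd c p)"
  using dirderivs_diff[OF open_chart_image chart_smooth[OF assms(1)] chart_smooth[OF assms(2)], of c "snd c p" vs] assms(3,4)
  by (simp add: o_def)

lemma continuous_dirderivs_chart:
  assumes "\<sigma> \<in> bivector_fields A" "c \<in> A" "K \<subseteq> fst c"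
  shows "continuous_on K (\<lambda>p. dirderivs vs (\<sigma> c \<circ> chart_inv c) (snd c p))"
  by (rule continuous_on_compose2[OF smooth_on_continuous[OF smooth_on_dirderivs[OF chart_smooth[OF assms(1,2)]]]
    continuous_on_subset[OF continuous_on_chart[OF assms(2)] assms(3)]]) (use assms in auto)

lemma compact_openin_cover:
  assumes "\<And>p. p \<in> M \<Longrightarrow> openin (top_of_set M) (W p) \<and> p \<in> W p"
  obtains F where "finite F" "F \<subseteq> M" "M \<subseteq> (\<Union>p\<in>F. W p)"
proof -
  have "\<forall>p\<in>M. \<exists>O'. open O' \<and> W p = M \<inter> O'" using assms openin_open by metis
  then obtain O' where O': "\<And>p. p \<in> M \<Longrightarrow> open (O' p)" "\<And>p. p \<in> M \<Longrightarrow> W p = M \<inter> O' p" by metis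
  have "M \<subseteq> (\<Union>p\<in>M. O' p)" using assms O'(2) by auto
  then obtain F where F: "F \<subseteq> M" "finite F" "M \<subseteq> (\<Union>p\<in>F. O' p)"
    using compactE_image[OF compact_M, of M O'] O'(1) by metis
  have "M \<subseteq> (\<Union>p\<in>F. W p)"
  proof
    fix x assume x: "x \<in> M"
    then obtain p where "p \<in> F" "x \<in> O' p" using F(3) by auto
    then show "x \<in> (\<Union>p\<in>F. W p)" using O'(2)[of p] F(1) x by auto
  qed
  then show ?thesis using that F by blast
qed

lemma whitney_nbhd_self:
  assumes "\<pi> \<in> poisson_structures A" "\<And>i. \<epsilon> i > 0"
  shows "\<pi> \<in> whitney_nbhd A r c K \<epsilon> \<pi>"
proof -
  have "(\<lambda>q. \<pi> (c i) q - \<pi> (c i) q) \<circ> chart_inv (c i) = (\<lambda>_. 0)" for i by (simp add: fun_eq_iff)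
  then show ?thesis using assms by (simp add: whitney_nbhd_def dirderivs_zero)
qed

text \<open>Around each point one derivative of order at most 1 stays above some \<mu> in norm on a
  compact set. Finitely many such sets cover \<open>M\<close>, and any field closer than \<mu> in
  these derivatives keeps them nonzero.\<close>

lemma regular_nbhd:
  assumes ne: "M \<noteq> {}" and \<pi>: "\<pi> \<in> poisson_structures A" "regular \<pi>"
  obtains c K \<epsilon> where "whitney_data M A c K \<epsilon>" "\<And>\<sigma>. \<sigma> \<in> whitney_nbhd A 1 c K \<epsilon> \<pi> \<Longrightarrow> regular \<sigma>"
proof -
  define ok where "ok = (\<lambda>p c K W (\<mu>::real) vs. c \<in> A \<and> compact K \<and> K \<subseteq> fst c \<and> openin (top_of_set M) W \<and> p \<in> W \<and> W \<subseteq> K \<and>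
    \<mu> > 0 \<and> set vs \<subseteq> Basis \<and> length vs \<le> 1 \<and> (\<forall>x\<in>K. norm (dirderivs vs (\<pi> c \<circ> chart_inv c) (snd c x)) \<ge> \<mu>))"
  have \<pi>b: "\<pi> \<in> bivector_fields A" using \<pi> poisson_eq by simp
  have "\<exists>c K W \<mu> vs. ok p c K W \<mu> vs" if p: "p \<in> M" for p
  proof -
    obtain c vs where c: "c \<in> A" "p \<in> fst c" and vs: "set vs \<subseteq> Basis" "length vs \<le> 1"
      "dirderivs vs (\<pi> c \<circ> chart_inv c) (snd c p) \<noteq> 0" using \<pi>(2) p unfolding regular_def by blast
    let ?U = "snd c ` fst c" and ?g = "\<lambda>y. norm (dirderivs vs (\<pi> c \<circ> chart_inv c) y)"
    have "continuous_on ?U ?g"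
      by (intro continuous_on_norm smooth_on_continuous smooth_on_dirderivs chart_smooth[OF \<pi>b c(1)])
    \<comment> \<open>Half of the nonzero norm at \<open>p\<close> serves as the lower bound
      nearby.\<close>
    then have "open (?U \<inter> ?g -` {?g (snd c p) / 2<..})"
      by (rule continuous_open_preimage[OF _ open_chart_image[OF c(1)]]) simp
    moreover have "snd c p \<in> ?U \<inter> ?g -` {?g (snd c p) / 2<..}" using c(2) vs(3) by simp
    ultimately obtain r where r: "r > 0" "cball (snd c p) r \<subseteq> ?U \<inter> ?g -` {?g (snd c p) / 2<..}"
      unfolding open_contains_cball by meson
    \<comment> \<open>The closed ball gives the compact set on which the bound is imposed, the open
      ball the open set used for the covering.\<close>
    let ?K = "chart_inv c ` cball (snd c p) r" and ?W = "chart_inv c ` ball (snd c p) r"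
    have cU: "cball (snd c p) r \<subseteq> ?U" using r(2) by blast
    have "ok p c ?K ?W (?g (snd c p) / 2) vs"
      unfolding ok_def
    proof (intro conjI ballI)
      show "compact ?K" by (rule compact_continuous_image[OF continuous_on_subset[OF continuous_on_chart_inv[OF c(1)] cU] compact_cball])
      show "?K \<subseteq> fst c" using chart_inv_in[OF c(1)] cU by blast
      have bU: "ball (snd c p) r \<subseteq> ?U" using cU ball_subset_cball by blast
      then have "openin (top_of_set ?U) (ball (snd c p) r)" by (simp add: openin_open_eq open_chart_image[OF c(1)])
      then have "openin (top_of_set (fst c)) ?W"
        by (rule homeomorphism_imp_open_map[OF homeomorphism_symD[OF chart_homeomorphism[OF c(1)]]])
      then show "openin (top_of_set M) ?W" using chart_openin[OF c(1)] openin_trans by blast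
      show "p \<in> ?W" by (rule image_eqI[of _ _ "snd c p"]) (use r(1) chart_inv_left[OF c] in auto)
      show "?W \<subseteq> ?K" using ball_subset_cball by blast
      fix x assume "x \<in> ?K"
      then obtain y where y: "y \<in> cball (snd c p) r" "x = chart_inv c y" by blast
      then have "snd c x = y" using chart_inv_right[OF c(1)] cU by blast
      then show "?g (snd c p) / 2 \<le> ?g (snd c x)" using r(2) y(1) by auto
    qed (use c vs in auto)
    then show ?thesis by blast
  qed
  then obtain c K W \<mu> vs where ok: "\<And>p. p \<in> M \<Longrightarrow> ok p (c p) (K p) (W p) (\<mu> p) (vs p)" by metis
  have "openin (top_of_set M) (W p) \<and> p \<in> W p" if "p \<in> M" for p using ok[OF that] by (simp add: ok_def)
  then obtain F where F: "finite F" "F \<subseteq> M" "M \<subseteq> (\<Union>p\<in>F. W p)" using compact_openin_cover[of W] by blast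
  obtain h where h: "bij_betw h {..<card F} F"
    using ex_bij_betw_nat_finite[OF F(1)] by (auto simp: atLeast0LessThan)
  have hM: "h i \<in> M" if "i < card F" for i using bij_betwE[OF h] that F(2) by auto
  obtain c0 where c0: "c0 \<in> A" using ne in_some_chart by blast
  \<comment> \<open>The finite family is padded to all of \<open>nat\<close> by empty compact sets,
    with \<open>c0\<close> and 1 as dummy chart and bound.\<close>
  define c' where "c' = (\<lambda>i. if i < card F then c (h i) else c0)"
  define K' where "K' = (\<lambda>i. if i < card F then K (h i) else {})"
  define \<epsilon> where "\<epsilon> = (\<lambda>i. if i < card F then \<mu> (h i) else 1)"
  have "whitney_data M A c' K' \<epsilon>"
    unfolding whitney_data_def
  proof (intro conjI allI ballI)
    fix i
    show "c' i \<in> A" "compact (K' i)" "K' i \<subseteq> fst (c' i)" "\<epsilon> i > 0"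
      using ok[OF hM[of i]] c0 by (auto simp: ok_def c'_def K'_def \<epsilon>_def)
  next
    fix p assume p: "p \<in> M"
    have "finite {i. K' i \<inter> M \<noteq> {}}" by (rule finite_subset[of _ "{..<card F}"]) (auto simp: K'_def split: if_splits)
    then show "\<exists>W. openin (top_of_set M) W \<and> p \<in> W \<and> finite {i. K' i \<inter> W \<noteq> {}}"
      using p by (intro exI[of _ M]) auto
  qed
  moreover have "regular \<sigma>" if \<sigma>: "\<sigma> \<in> whitney_nbhd A 1 c' K' \<epsilon> \<pi>" for \<sigma>
    unfolding regular_def
  proof
    fix p assume "p \<in> M"
    then obtain q where q: "q \<in> F" "p \<in> W q" using F(3) by blast
    then obtain i where i: "i < card F" "q = h i" using bij_betw_imp_surj_on[OF h] by blast
    have o: "ok q (c q) (K q) (W q) (\<mu> q) (vs q)" using ok q F(2) by blast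
    then have pK: "p \<in> K q" "p \<in> fst (c q)" and cA: "c q \<in> A" using q(2) unfolding ok_def by blast+
    have \<sigma>b: "\<sigma> \<in> bivector_fields A" using \<sigma> poisson_eq by (simp add: whitney_nbhd_def)
    have "norm (dirderivs (vs q) ((\<lambda>x. \<sigma> (c' i) x - \<pi> (c' i) x) \<circ> chart_inv (c' i)) (snd (c' i) p)) < \<epsilon> i"
      using \<sigma> pK(1) o i unfolding whitney_nbhd_def ok_def by (simp add: K'_def)
    then have "norm (dirderivs (vs q) (\<sigma> (c q) \<circ> chart_inv (c q)) (snd (c q) p) -
      dirderivs (vs q) (\<pi> (c q) \<circ> chart_inv (c q)) (snd (c q) p)) < \<mu> q"
      unfolding dirderivs_chart_diff[OF \<sigma>b \<pi>b cA pK(2), symmetric] using i by (simp add: c'_def \<epsilon>_def)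
    moreover have "norm (dirderivs (vs q) (\<pi> (c q) \<circ> chart_inv (c q)) (snd (c q) p)) \<ge> \<mu> q"
      using o pK(1) unfolding ok_def by blast
    ultimately have "dirderivs (vs q) (\<sigma> (c q) \<circ> chart_inv (c q)) (snd (c q) p) \<noteq> 0" by auto
    then show "\<exists>c\<in>A. p \<in> fst c \<and> (\<exists>vs. set vs \<subseteq> Basis \<and> length vs \<le> 1 \<and>
      dirderivs vs (\<sigma> c \<circ> chart_inv c) (snd c p) \<noteq> 0)"
      using o pK(2) unfolding ok_def by blast
  qed
  ultimately show ?thesis using that by blast
qed

lemma whitney_open_nbhd:
  "whitney_data M A c K \<epsilon> \<Longrightarrow> \<pi> \<in> poisson_structures A \<Longrightarrow> openin (whitney_topology M A) (whitney_nbhd A r c K \<epsilon> \<pi>)"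
  unfolding whitney_topology_def by (rule topology_generated_by_Basis) blast

lemma openin_regular:
  assumes "M \<noteq> {}"
  shows "openin (whitney_topology M A) {\<pi> \<in> poisson_structures A. regular \<pi>}"
proof (subst openin_subopen, intro ballI)
  fix \<pi> assume \<pi>: "\<pi> \<in> {\<pi> \<in> poisson_structures A. regular \<pi>}"
  then have \<pi>': "\<pi> \<in> poisson_structures A" "regular \<pi>" by auto
  obtain c K \<epsilon> where d: "whitney_data M A c K \<epsilon>" "\<And>\<sigma>. \<sigma> \<in> whitney_nbhd A 1 c K \<epsilon> \<pi> \<Longrightarrow> regular \<sigma>"
    using regular_nbhd[OF assms \<pi>'] by metis
  have pos: "\<epsilon> i > 0" for i using d(1) by (simp add: whitney_data_def)
  show "\<exists>T. openin (whitney_topology M A) T \<and> \<pi> \<in> T \<and> T \<subseteq> {\<pi> \<in> poisson_structures A. regular \<pi>}"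
  proof (intro exI conjI)
    show "openin (whitney_topology M A) (whitney_nbhd A 1 c K \<epsilon> \<pi>)" by (rule whitney_open_nbhd[OF d(1) \<pi>'(1)])
    show "\<pi> \<in> whitney_nbhd A 1 c K \<epsilon> \<pi>" by (rule whitney_nbhd_self[of \<pi> \<epsilon> 1 c K, OF \<pi>'(1) pos])
    show "whitney_nbhd A 1 c K \<epsilon> \<pi> \<subseteq> {\<pi> \<in> poisson_structures A. regular \<pi>}"
      using d(2) by (auto simp: whitney_nbhd_def)
  qed
qed

lemma topspace_whitney:
  assumes "M \<noteq> {}"
  shows "topspace (whitney_topology M A) = poisson_structures A"
proof -
  obtain c0 where c0: "c0 \<in> A" using assms in_some_chart by blast
  \<comment> \<open>Empty compact sets impose no condition, so these data are available around every
    Poisson structure.\<close>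
  have d: "whitney_data M A (\<lambda>_. c0) (\<lambda>_. {}) (\<lambda>_. 1)"
    using c0 by (auto simp: whitney_data_def intro: exI[of _ M])
  have "\<pi> \<in> topspace (whitney_topology M A)" if "\<pi> \<in> poisson_structures A" for \<pi>
    using openin_subset[OF whitney_open_nbhd[OF d that]] whitney_nbhd_self[of \<pi> "\<lambda>_. 1", OF that] by force
  moreover have "topspace (whitney_topology M A) \<subseteq> poisson_structures A"
    unfolding whitney_topology_def topology_generated_by_topspace by (auto simp: whitney_nbhd_def)
  ultimately show ?thesis by blast
qed

section \<open>Density of the regular structures\<close>

lemma smooth_function_shift:
  assumes "smooth_function A f"
  shows "smooth_function A (\<lambda>p. f p - t)"
  unfolding smooth_function_def
proof
  fix c assume c: "c \<in> A"
  note U = open_chart_image[OF c]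
  have "smooth_on (snd c ` fst c) (f \<circ> chart_inv c)" using assms c by (simp add: smooth_function_def)
  from smooth_on_diff[OF U this smooth_on_const[OF U]]
  have "smooth_on (snd c ` fst c) (\<lambda>y. (f \<circ> chart_inv c) y - t)" .
  then show "smooth_on (snd c ` fst c) ((\<lambda>p. f p - t) \<circ> chart_inv c)" by (simp add: o_def)
qed

lemma grad_shift:
  assumes f: "smooth_function A f" and c: "c \<in> A" "p \<in> fst c"
  shows "grad (\<lambda>p. f p - t) c p = grad f c p"
proof -
  have "((\<lambda>p. f p - t) \<circ> chart_inv c has_derivative (\<lambda>v. grad f c p \<bullet> v)) (at (snd c p))"
    using has_derivative_diff[OF smooth_function_has_derivative[OF f c] has_derivative_const[of t]] by (simp add: o_def)
  from has_derivative_unique[OF smooth_function_has_derivative[OF smooth_function_shift[OF f] c] this]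
  have "\<forall>v. grad (\<lambda>p. f p - t) c p \<bullet> v = grad f c p \<bullet> v" by metis
  then show ?thesis unfolding vector_eq_rdot .
qed

text \<open>A value \<open>t\<close> can fail only if it is a critical value in one of finitely many
  charts covering \<open>M\<close>. These form a negligible set, which cannot contain an
  interval.\<close>

lemma regular_values_dense:
  assumes f: "smooth_function A f" and \<delta>: "\<delta> > 0"
  obtains t where "\<bar>t\<bar> < \<delta>" "regular (scale_bivector (\<lambda>p. f p - t) \<pi>\<^sub>0)"
proof -
  obtain c where c: "\<And>p. p \<in> M \<Longrightarrow> c p \<in> A \<and> p \<in> fst (c p)" using in_some_chart by metis
  then have "openin (top_of_set M) (fst (c p)) \<and> p \<in> fst (c p)" if "p \<in> M" for p using that chart_openin by blast
  then obtain F where F: "finite F" "F \<subseteq> M" "M \<subseteq> (\<Union>p\<in>F. fst (c p))" using compact_openin_cover[of "\<lambda>p. fst (c p)"] by blast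
  let ?C = "\<lambda>d. (f \<circ> chart_inv d) ` {x \<in> snd d ` fst d. frechet_derivative (f \<circ> chart_inv d) (at x) = (\<lambda>_. 0)}"
  have "negligible (?C d)" if "d \<in> A" for d
    by (rule sard_plane[OF open_chart_image[OF that]]) (use f that in \<open>auto simp: smooth_function_def\<close>)
  then have "negligible (?C (c p))" if "p \<in> F" for p using that F(2) c by blast
  then have neg: "negligible (\<Union>p\<in>F. ?C (c p))"
    by (intro negligible_Union[OF finite_imageI[OF F(1)]]) (erule imageE, simp only:)
  have "\<not> negligible {- \<delta><..<\<delta>}" using open_not_negligible[of "{- \<delta><..<\<delta>}"] \<delta> by auto
  then have "\<not> {- \<delta><..<\<delta>} \<subseteq> (\<Union>p\<in>F. ?C (c p))" using negligible_subset[OF neg] by blast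
  then obtain t where t: "t \<in> {- \<delta><..<\<delta>}" "t \<notin> (\<Union>p\<in>F. ?C (c p))" by blast
  have "regular (scale_bivector (\<lambda>p. f p - t) \<pi>\<^sub>0)"
    unfolding regular_scale_iff[OF smooth_function_shift[OF f]]
  proof (intro ballI impI)
    fix p d assume p: "p \<in> M" "f p - t = 0" and d: "d \<in> A" "p \<in> fst d"
    obtain q where q: "q \<in> F" "p \<in> fst (c q)" using F(3) p(1) by blast
    have cA: "c q \<in> A" using c q(1) F(2) by blast
    have "frechet_derivative (f \<circ> chart_inv (c q)) (at (snd (c q) p)) \<noteq> (\<lambda>_. 0)"
    proof
      assume "frechet_derivative (f \<circ> chart_inv (c q)) (at (snd (c q) p)) = (\<lambda>_. 0)"
      then have "t \<in> ?C (c q)"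
        using q(2) p(2) chart_inv_left[OF cA q(2)] by (intro image_eqI[of _ _ "snd (c q) p"]) auto
      then show False using t(2) q(1) by blast
    qed
    then have "grad f (c q) p \<noteq> 0"
      using frechet_derivative_at[OF smooth_function_has_derivative[OF f cA q(2)]] by auto
    then have "grad f d p \<noteq> 0" using grad_nonzero_change_chart[OF f cA d(1) q(2) d(2)] by blast
    then show "grad (\<lambda>p. f p - t) d p \<noteq> 0" by (simp add: grad_shift[OF f d])
  qed
  moreover have "\<bar>t\<bar> < \<delta>" using t(1) by auto
  ultimately show ?thesis using that by blast
qed

text \<open>Subtracting \<open>t\<close> from \<open>f\<close> subtracts \<open>t\<close> times
  \<open>\<pi>\<^sub>0\<close>, so each derivative moves linearly in \<open>t\<close>. The
  neighbourhood is centred at an arbitrary \<rho>, so the room for the move is the slack in its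
  strict inequalities; it is uniform because only finitely many conditions on compact sets are
  involved.\<close>

lemma whitney_nbhd_shift:
  assumes wd: "whitney_data M A c K \<epsilon>" and f: "smooth_function A f" and \<rho>: "\<rho> \<in> poisson_structures A"
    and mem: "scale_bivector f \<pi>\<^sub>0 \<in> whitney_nbhd A r c K \<epsilon> \<rho>"
  shows "\<forall>\<^sub>F t in nhds 0. scale_bivector (\<lambda>p. f p - t) \<pi>\<^sub>0 \<in> whitney_nbhd A r c K \<epsilon> \<rho>"
proof -
  let ?\<pi> = "scale_bivector f \<pi>\<^sub>0" and ?\<sigma> = "\<lambda>t. scale_bivector (\<lambda>p. f p - t) \<pi>\<^sub>0"
  have \<pi>b: "?\<pi> \<in> bivector_fields A" and \<sigma>b: "?\<sigma> t \<in> bivector_fields A" for t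
    using scale_bivector_in f smooth_function_shift by auto
  have \<rho>b: "\<rho> \<in> bivector_fields A" using \<rho> poisson_eq by simp
  let ?I = "{i. K i \<noteq> {}}" and ?V = "{vs. set vs \<subseteq> (Basis :: (real^2) set) \<and> length vs \<le> r}"
  let ?D = "\<lambda>vs \<rho> i p. dirderivs vs (\<rho> (c i) \<circ> chart_inv (c i)) (snd (c i) p)"
  have cK: "c i \<in> A" "compact (K i)" "K i \<subseteq> fst (c i)" "\<epsilon> i > 0" for i using wd by (auto simp: whitney_data_def)
  \<comment> \<open>Local finiteness becomes finiteness by compactness of \<open>M\<close>.\<close>
  have fI: "finite ?I"
  proof -
    have "\<forall>p\<in>M. \<exists>W. openin (top_of_set M) W \<and> p \<in> W \<and> finite {i. K i \<inter> W \<noteq> {}}" using wd by (simp add: whitney_data_def)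
    then obtain W where W: "\<And>p. p \<in> M \<Longrightarrow> openin (top_of_set M) (W p) \<and> p \<in> W p \<and> finite {i. K i \<inter> W p \<noteq> {}}" by metis
    obtain F where F: "finite F" "F \<subseteq> M" "M \<subseteq> (\<Union>p\<in>F. W p)"
      by (rule compact_openin_cover[of W]) (use W in auto)
    have "?I \<subseteq> (\<Union>p\<in>F. {i. K i \<inter> W p \<noteq> {}})"
    proof
      fix i assume "i \<in> ?I"
      then obtain x where x: "x \<in> K i" by blast
      then have "x \<in> M" using cK(1,3)[of i] chart_subset[of "c i"] by blast
      then obtain p where "p \<in> F" "x \<in> W p" using F(3) by blast
      then show "i \<in> (\<Union>p\<in>F. {i. K i \<inter> W p \<noteq> {}})" using x by blast
    qed
    moreover have "finite (\<Union>p\<in>F. {i. K i \<inter> W p \<noteq> {}})" using F W by auto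
    ultimately show ?thesis by (rule finite_subset)
  qed
  have fV: "finite ?V" using finite_lists_length_le[of "Basis :: (real^2) set"] by simp
  have est: "\<forall>\<^sub>F t in nhds 0. \<forall>p\<in>K i. norm (?D vs (?\<sigma> t) i p - ?D vs \<rho> i p) < \<epsilon> i" if i: "i \<in> ?I" and vs: "vs \<in> ?V" for i vs
  proof -
    have old: "norm (?D vs ?\<pi> i p - ?D vs \<rho> i p) < \<epsilon> i" if "p \<in> K i" for p
    proof -
      have "p \<in> fst (c i)" using that cK(3) by blast
      moreover have "norm (dirderivs vs ((\<lambda>q. ?\<pi> (c i) q - \<rho> (c i) q) \<circ> chart_inv (c i)) (snd (c i) p)) < \<epsilon> i"
        using mem vs that unfolding whitney_nbhd_def by blast
      ultimately show ?thesis by (simp only: dirderivs_chart_diff[OF \<pi>b \<rho>b cK(1)])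
    qed
    have shift: "?D vs (?\<sigma> t) i p = ?D vs ?\<pi> i p - t *\<^sub>R ?D vs \<pi>\<^sub>0 i p" if "p \<in> K i" for p t
    proof -
      have pc: "p \<in> fst (c i)" using that cK(3) by blast
      then have y: "snd (c i) p \<in> snd (c i) ` fst (c i)" by blast
      note U = open_chart_image[OF cK(1)[of i]]
      have s0: "smooth_on (snd (c i) ` fst (c i)) (\<pi>\<^sub>0 (c i) \<circ> chart_inv (c i))" by (rule chart_smooth[OF \<pi>0 cK(1)])
      have s0': "smooth_on (snd (c i) ` fst (c i)) (\<lambda>y. t *\<^sub>R (\<pi>\<^sub>0 (c i) \<circ> chart_inv (c i)) y)"
        by (intro smooth_on_scaleR smooth_on_const U s0)
      have "?\<sigma> t (c i) \<circ> chart_inv (c i) = (\<lambda>y. (?\<pi> (c i) \<circ> chart_inv (c i)) y - t *\<^sub>R (\<pi>\<^sub>0 (c i) \<circ> chart_inv (c i)) y)"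
        by (simp add: scale_bivector_def fun_eq_iff scaleR_left_diff_distrib)
      then show ?thesis
        using dirderivs_diff[OF U chart_smooth[OF \<pi>b cK(1)] s0' y, of vs] dirderivs_scaleR[OF U s0 y, of vs t] by simp
    qed
    have "continuous_on (K i) (\<lambda>p. norm (?D vs ?\<pi> i p - ?D vs \<rho> i p))"
      by (intro continuous_intros continuous_dirderivs_chart \<pi>b \<rho>b cK)
    then obtain p0 where p0: "p0 \<in> K i" "\<And>p. p \<in> K i \<Longrightarrow> norm (?D vs ?\<pi> i p - ?D vs \<rho> i p) \<le> norm (?D vs ?\<pi> i p0 - ?D vs \<rho> i p0)"
      using continuous_attains_sup[OF cK(2)[of i]] i by blast
    have "continuous_on (K i) (\<lambda>p. norm (?D vs \<pi>\<^sub>0 i p))"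
      by (intro continuous_intros continuous_dirderivs_chart \<pi>0 cK)
    then obtain p1 where p1: "p1 \<in> K i" "\<And>p. p \<in> K i \<Longrightarrow> norm (?D vs \<pi>\<^sub>0 i p) \<le> norm (?D vs \<pi>\<^sub>0 i p1)"
      using continuous_attains_sup[OF cK(2)[of i]] i by blast
    \<comment> \<open>The maximum over \<open>K i\<close> is attained, so it is strictly below the
      bound; \<open>B\<close> is the rate at which \<open>t\<close> uses up the difference.\<close>
    define m where "m = norm (?D vs ?\<pi> i p0 - ?D vs \<rho> i p0)"
    define B where "B = norm (?D vs \<pi>\<^sub>0 i p1)"
    have m: "m < \<epsilon> i" using old[OF p0(1)] by (simp add: m_def)
    have "((\<lambda>t. m + \<bar>t\<bar> * B) \<longlongrightarrow> m + \<bar>0\<bar> * B) (nhds 0)"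
      by (intro tendsto_intros filterlim_ident)
    then have "\<forall>\<^sub>F t in nhds 0. m + \<bar>t\<bar> * B < \<epsilon> i" by (rule order_tendstoD) (use m in simp)
    then show ?thesis
    proof eventually_elim
      case (elim t)
      show ?case
      proof
        fix p assume p: "p \<in> K i"
        have "norm (?D vs (?\<sigma> t) i p - ?D vs \<rho> i p) = norm ((?D vs ?\<pi> i p - ?D vs \<rho> i p) - t *\<^sub>R ?D vs \<pi>\<^sub>0 i p)"
          unfolding shift[OF p] by (rule arg_cong[where f=norm]) (simp add: algebra_simps)
        also have "\<dots> \<le> norm (?D vs ?\<pi> i p - ?D vs \<rho> i p) + \<bar>t\<bar> * norm (?D vs \<pi>\<^sub>0 i p)"
          using norm_triangle_ineq4[of "?D vs ?\<pi> i p - ?D vs \<rho> i p" "t *\<^sub>R ?D vs \<pi>\<^sub>0 i p"] by simp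
        also have "\<dots> \<le> m + \<bar>t\<bar> * B"
          using p0(2)[OF p] p1(2)[OF p] by (intro add_mono mult_left_mono) (auto simp: m_def B_def)
        also have "\<dots> < \<epsilon> i" by (rule elim)
        finally show "norm (?D vs (?\<sigma> t) i p - ?D vs \<rho> i p) < \<epsilon> i" .
      qed
    qed
  qed
  have "\<forall>\<^sub>F t in nhds 0. \<forall>i\<in>?I. \<forall>vs\<in>?V. \<forall>p\<in>K i. norm (?D vs (?\<sigma> t) i p - ?D vs \<rho> i p) < \<epsilon> i"
    by (intro eventually_ball_finite fI fV ballI est)
  then show ?thesis
  proof eventually_elim
    case (elim t)
    show ?case unfolding whitney_nbhd_def
    proof (intro CollectI conjI allI ballI impI)
      show "?\<sigma> t \<in> poisson_structures A" using \<sigma>b poisson_eq by simp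
      fix i p and vs :: "(real^2) list" assume p: "p \<in> K i" and vs: "set vs \<subseteq> Basis \<and> length vs \<le> r"
      have "i \<in> ?I" "vs \<in> ?V" "p \<in> fst (c i)" using p vs cK(3) by blast+
      moreover from this have "norm (?D vs (?\<sigma> t) i p - ?D vs \<rho> i p) < \<epsilon> i" using elim p by blast
      ultimately show "norm (dirderivs vs ((\<lambda>q. ?\<sigma> t (c i) q - \<rho> (c i) q) \<circ> chart_inv (c i)) (snd (c i) p)) < \<epsilon> i"
        by (simp only: dirderivs_chart_diff[OF \<sigma>b \<rho>b cK(1)])
    qed
  qed
qed

text \<open>Being entered for all small \<open>t\<close> passes to finite intersections and to
  unions, so it is enough to test the generating neighbourhoods; they need not be shown to form a
  base.\<close>

lemma whitney_open_shift:
  assumes T: "openin (whitney_topology M A) T" and f: "smooth_function A f" and mem: "scale_bivector f \<pi>\<^sub>0 \<in> T"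
  shows "\<forall>\<^sub>F t in nhds 0. scale_bivector (\<lambda>p. f p - t) \<pi>\<^sub>0 \<in> T"
proof -
  have "generate_topology_on {whitney_nbhd A r c K \<epsilon> \<pi> | r c K \<epsilon> \<pi>. whitney_data M A c K \<epsilon> \<and> \<pi> \<in> poisson_structures A} T"
    using T unfolding whitney_topology_def by (rule openin_topology_generated_by)
  then show ?thesis using mem
  proof induction
    case (Int a b)
    then show ?case by (auto intro: eventually_conj)
  next
    case (UN K)
    then obtain k where k: "k \<in> K" "scale_bivector f \<pi>\<^sub>0 \<in> k" by blast
    from UN.IH[OF this] show ?case by eventually_elim (use k in blast)
  next
    case (Basis s)
    then show ?case using whitney_nbhd_shift[OF _ f] by blast
  qed simp
qed

lemma closure_of_regular:
  assumes "M \<noteq> {}"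
  shows "whitney_topology M A closure_of {\<pi> \<in> poisson_structures A. regular \<pi>} = poisson_structures A"
proof (rule antisym)
  show "whitney_topology M A closure_of {\<pi> \<in> poisson_structures A. regular \<pi>} \<subseteq> poisson_structures A"
    using closure_of_subset_topspace[of "whitney_topology M A"] unfolding topspace_whitney[OF assms] .
  show "poisson_structures A \<subseteq> whitney_topology M A closure_of {\<pi> \<in> poisson_structures A. regular \<pi>}"
  proof
    fix \<pi> assume \<pi>: "\<pi> \<in> poisson_structures A"
    then obtain f where f: "smooth_function A f" "\<pi> = scale_bivector f \<pi>\<^sub>0" using exists_scale poisson_eq by metis
    have "\<exists>\<sigma>. \<sigma> \<in> {\<pi> \<in> poisson_structures A. regular \<pi>} \<and> \<sigma> \<in> T" if T: "\<pi> \<in> T" "openin (whitney_topology M A) T" for T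
    proof -
      have "\<forall>\<^sub>F t in nhds 0. scale_bivector (\<lambda>p. f p - t) \<pi>\<^sub>0 \<in> T"
        using whitney_open_shift[OF T(2) f(1)] T(1) f(2) by blast
      then obtain \<delta> where \<delta>: "\<delta> > 0" "\<And>t. \<bar>t\<bar> < \<delta> \<Longrightarrow> scale_bivector (\<lambda>p. f p - t) \<pi>\<^sub>0 \<in> T"
        unfolding eventually_nhds_metric by (auto simp: dist_real_def)
      obtain t where t: "\<bar>t\<bar> < \<delta>" "regular (scale_bivector (\<lambda>p. f p - t) \<pi>\<^sub>0)"
        using regular_values_dense[OF f(1) \<delta>(1)] .
      moreover have "scale_bivector (\<lambda>p. f p - t) \<pi>\<^sub>0 \<in> poisson_structures A"
        using scale_bivector_in[OF smooth_function_shift[OF f(1)]] poisson_eq by blast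
      ultimately show ?thesis using \<delta>(2) by blast
    qed
    then show "\<pi> \<in> whitney_topology M A closure_of {\<pi> \<in> poisson_structures A. regular \<pi>}"
      using \<pi> topspace_whitney[OF assms] by (simp add: in_closure_of)
  qed
qed

end

theorem proposition1:
  fixes M :: "'a::t2_space set" and A :: "'a chart set" and \<pi>\<^sub>0 :: "'a bivector"
  assumes "compact_connected_oriented_surface M A"
    and "\<pi>\<^sub>0 \<in> bivector_fields A"
    and "nowhere_vanishing A \<pi>\<^sub>0"
  shows "disjoint_family (linear_poisson M A \<pi>\<^sub>0) \<and>
    openin (whitney_topology M A) (\<Union>n. linear_poisson M A \<pi>\<^sub>0 n) \<and>
    whitney_topology M A closure_of (\<Union>n. linear_poisson M A \<pi>\<^sub>0 n) = poisson_structures A"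
proof -
  have M: "smooth_atlas M A" "compact M" "M \<noteq> {}"
    using assms(1) by (auto simp: compact_connected_oriented_surface_def oriented_atlas_def)
  interpret poisson_surface M A \<pi>\<^sub>0 by standard (fact M assms)+
  have "(\<Union>n. linear_poisson M A \<pi>\<^sub>0 n) = {\<pi> \<in> poisson_structures A. regular \<pi>}"
    using linear_poisson_iff_regular by blast
  then show ?thesis
    using disjoint_linear_poisson openin_regular[OF M(3)] closure_of_regular[OF M(3)] by simp
qed

end
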